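(* Let $\vec{\mathcal H}$ be a finite sequence of conjugacy classes of finitely generated subgroups of $F(\mathcal B)$, and suppose $\mathrm{minlex}(\vec{\mathcal H}')>1$ for some (equivalently any) Gersten representative $\vec{\mathcal H}'$ of $\vec{\mathcal H}$. Then the following are equivalent: (1) there is $\alpha\in\mathrm{Aut}(F(\mathcal B))$ such that $\Sigma(\alpha\vec{\mathcal H})$ can be visibly cleaved; (2) for some Gersten representative $\vec{\mathcal H}'$ of $\vec{\mathcal H}$, $\Sigma(\vec{\mathcal H}')$ can be visibly cleaved; (3) for every Gersten representative $\vec{\mathcal H}'$ of $\vec{\mathcal H}$, $\Sigma(\vec{\mathcal H}')$ can be visibly cleaved.
   Context: $F(\mathcal B)$ is the free group on a finite set $\mathcal B$, identified with $\pi_1$ of the rose $R_{\mathcal B}$. For a conjugacy class $[[H]]$ of a finitely generated subgroup, $\Sigma([[H]])$ is the core of the covering graph of $R_{\mathcal B}$ corresponding to $H$, a finite graph with oriented edges labeled in $\mathcal B^{\pm1}$ (empty if $H=1$); for sequences, componentwise, and automorphisms act componentwise. For $b\in\mathcal B$, $n(b,\vec{\mathcal H})$ is the number of edges of $\Sigma(\vec{\mathcal H})$ labeled $b^{\pm1}$ and $\mathrm{minlex}=\min_b n(b,\cdot)$. The complexity is the total number of edges of $\Sigma(\vec{\mathcal H})$; $\vec{\mathcal H}'$ is a Gersten representative of $\vec{\mathcal H}$ if $\vec{\mathcal H}'=\beta\vec{\mathcal H}$ for some automorphism $\beta$ and has minimal complexity in the orbit $\mathrm{Aut}(F(\mathcal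 B))\vec{\mathcal H}$. A sequence $(\Sigma_i)_{i\in I}$ of labeled graphs can be visibly cleaved if there is a partition $\mathcal B=\mathcal B'\sqcup\mathcal B''$ into two nonempty sets and an index $i_0\in I$ such that $\Sigma_{i_0}$ is the wedge (union along a single common vertex) of a connected graph all of whose labels lie in $\mathcal B'^{\pm1}$ and a connected graph all of whose labels lie in $\mathcal B''^{\pm1}$, and for each $i\neq i_0$ the labels of $\Sigma_i$ all lie in $\mathcal B'^{\pm1}$ or all lie in $\mathcal B''^{\pm1}$. *)

theory Defs
  imports "HOL-Algebra.Algebra"
begin

section \<open>The free group F(B) as reduced words\<close>

type_synonym 'b letter = "bool \<times> 'b"   (* (True,b) = b, (False,b) = b^-1 *)
type_synonym 'b word = "'b letter list"

definition letter_inv :: "'b letter \<Rightarrow> 'b letter" where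
  "letter_inv x = (\<not> fst x, snd x)"

fun reduced :: "'b word \<Rightarrow> bool" where
  "reduced [] = True"
| "reduced [x] = True"
| "reduced (x # y # ys) = (y \<noteq> letter_inv x \<and> reduced (y # ys))"

definition cyclically_reduced :: "'b word \<Rightarrow> bool" where
  "cyclically_reduced w \<longleftrightarrow> reduced w \<and> (w \<noteq> [] \<longrightarrow> last w \<noteq> letter_inv (hd w))"

fun push :: "'b letter \<Rightarrow> 'b word \<Rightarrow> 'b word" where
  "push x [] = [x]"
| "push x (y # ys) = (if y = letter_inv x then ys else x # y # ys)"

definition reduce :: "'b word \<Rightarrow> 'b word" where
  "reduce w = rev (foldl (\<lambda>acc x. push x acc) [] w)"

definition free_group :: "'b set \<Rightarrow> 'b word monoid" where
  "free_group B = \<lparr>carrier = {w. set (map snd w) \<subseteq> B \<and> reduced w},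
                   monoid.mult = (\<lambda>u v. reduce (u @ v)), one = []\<rparr>"

definition gen :: "'b \<Rightarrow> 'b word" where
  "gen b = [(True, b)]"

definition fg_subgroup :: "'b set \<Rightarrow> 'b word set \<Rightarrow> bool" where
  "fg_subgroup B H \<longleftrightarrow> subgroup H (free_group B) \<and>
     (\<exists>S. finite S \<and> S \<subseteq> carrier (free_group B) \<and> H = generate (free_group B) S)"

definition aut :: "'b set \<Rightarrow> ('b word \<Rightarrow> 'b word) set" where
  "aut B = iso (free_group B) (free_group B)"

(* action of an automorphism on a sequence of (representatives of) conjugacy classes *)
definition act :: "('b word \<Rightarrow> 'b word) \<Rightarrow> 'b word set list \<Rightarrow> 'b word set list" where
  "act \<alpha> Hs = map (\<lambda>H. \<alpha> ` H) Hs"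

section \<open>Core graph Sigma([[H]]) inside the covering graph of the rose\<close>

(* Covering graph of the rose for H: vertices are right cosets H g, and for each
   vertex C and b in B an edge (C,b) from C to C b labeled b.
   The core is the union of all closed cyclically reduced (immersed) loops. *)

definition core_edges :: "'b set \<Rightarrow> 'b word set \<Rightarrow> ('b word set \<times> 'b) set" where
  "core_edges B H = {(C, b). b \<in> B \<and>
     (\<exists>g w i. g \<in> carrier (free_group B) \<and> w \<in> carrier (free_group B) \<and> w \<noteq> [] \<and>
        cyclically_reduced w \<and>
        g \<otimes>\<^bsub>free_group B\<^esub> w \<otimes>\<^bsub>free_group B\<^esub> inv\<^bsub>free_group B\<^esub> g \<in> H \<and>
        i < length w \<and>
        ((w ! i = (True, b) \<and> C = H #>\<^bsub>free_group B\<^esub> (g \<otimes>\<^bsub>free_group B\<^esub> take i w)) \<or>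
         (w ! i = (False, b) \<and> C = H #>\<^bsub>free_group B\<^esub> (g \<otimes>\<^bsub>free_group B\<^esub> take (Suc i) w))))}"

definition edge_tgt :: "'b set \<Rightarrow> ('b word set \<times> 'b) \<Rightarrow> 'b word set" where
  "edge_tgt B e = fst e #>\<^bsub>free_group B\<^esub> gen (snd e)"

definition verts :: "'b set \<Rightarrow> ('b word set \<times> 'b) set \<Rightarrow> 'b word set set" where
  "verts B E = fst ` E \<union> edge_tgt B ` E"

(* Sigma of a sequence: the sequence of edge sets of the core graphs *)
definition Sigma :: "'b set \<Rightarrow> 'b word set list \<Rightarrow> ('b word set \<times> 'b) set list" where
  "Sigma B Hs = map (core_edges B) Hs"

definition n_count :: "'b set \<Rightarrow> 'b word set list \<Rightarrow> 'b \<Rightarrow> nat" where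
  "n_count B Hs b = (\<Sum>i<length Hs. card {C. (C, b) \<in> core_edges B (Hs ! i)})"

definition minlex :: "'b set \<Rightarrow> 'b word set list \<Rightarrow> nat" where
  "minlex B Hs = Min (n_count B Hs ` B)"

definition complexity :: "'b set \<Rightarrow> 'b word set list \<Rightarrow> nat" where
  "complexity B Hs = (\<Sum>i<length Hs. card (core_edges B (Hs ! i)))"

definition gersten_rep :: "'b set \<Rightarrow> 'b word set list \<Rightarrow> 'b word set list \<Rightarrow> bool" where
  "gersten_rep B Hs Hs' \<longleftrightarrow> (\<exists>\<beta>\<in>aut B. Hs' = act \<beta> Hs) \<and>
     (\<forall>\<alpha>\<in>aut B. complexity B Hs' \<le> complexity B (act \<alpha> Hs))"

section \<open>Visible cleaving\<close>

definition graph_connected :: "'b set \<Rightarrow> 'b word set set \<Rightarrow> ('b word set \<times> 'b) set \<Rightarrow> bool" where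
  "graph_connected B V E \<longleftrightarrow> V \<noteq> {} \<and>
     (\<forall>x\<in>V. \<forall>y\<in>V. (x, y) \<in> ({(fst e, edge_tgt B e) | e. e \<in> E} \<union>
                              {(edge_tgt B e, fst e) | e. e \<in> E})\<^sup>*)"

(* the graph with edge set E is the wedge, at a single common vertex v, of a connected
   graph with labels in B1 and a connected graph with labels in B2 *)
definition wedge_split :: "'b set \<Rightarrow> ('b word set \<times> 'b) set \<Rightarrow> 'b set \<Rightarrow> 'b set \<Rightarrow> bool" where
  "wedge_split B E B1 B2 \<longleftrightarrow> (\<exists>v \<in> verts B E.
     (let E1 = {e \<in> E. snd e \<in> B1}; E2 = {e \<in> E. snd e \<in> B2};
          V1 = verts B E1 \<union> {v}; V2 = verts B E2 \<union> {v}
      in E = E1 \<union> E2 \<and> V1 \<inter> V2 = {v} \<and> graph_connected B V1 E1 \<and> graph_connected B V2 E2))"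

definition visibly_cleavable :: "'b set \<Rightarrow> ('b word set \<times> 'b) set list \<Rightarrow> bool" where
  "visibly_cleavable B Es \<longleftrightarrow> (\<exists>B1 B2 i0. B1 \<union> B2 = B \<and> B1 \<inter> B2 = {} \<and> B1 \<noteq> {} \<and> B2 \<noteq> {} \<and>
     i0 < length Es \<and> wedge_split B (Es ! i0) B1 B2 \<and>
     (\<forall>i<length Es. i \<noteq> i0 \<longrightarrow> snd ` (Es ! i) \<subseteq> B1 \<or> snd ` (Es ! i) \<subseteq> B2))"

end

theory Submission
  imports Defs "Jordan_Normal_Form.Determinant"
begin

text \<open>
  For an almost invariant subset \<open>Q\<close> of the free group \<open>F\<close> and a subgroup \<open>H\<close>, count the cosets \<open>H g\<close> such that
  the limit set of \<open>g\<^sup>-\<^sup>1 H g\<close> meets both \<open>Q\<close> and its complement. For the half-space of words starting with \<open>b\<close> this is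
  the number of edges labelled \<open>b\<close> in the core graph of \<open>H\<close>, so the complexity of \<open>\<alpha> H\<close> is a sum of cut numbers of the
  sets \<open>\<alpha>\<^sup>-\<^sup>1 Q\<close>. Cut numbers are submodular. Uncrossing shows that if no half-space
  \<open>P\<^sub>A\<close> (first letter in \<open>A\<close>) separating \<open>z\<close> from \<open>z\<^sup>-\<^sup>1\<close> is cut less often than that of \<open>z\<close>,
  then no almost invariant set separating the ends of an axis of \<open>z\<close> is; since the exponent matrix of an automorphism
  is invertible, local minima under Whitehead moves are therefore global minima.

  Adding to the given sequence a test sequence that detects signed permutations, any element of the orbit descends to a
  given minimal one by Whitehead moves that never increase the complexity. Such moves never increase the number
  of edges with a given label, so every label occurs at least twice throughout. Start from a cleaved element
  of least complexity among the cleaved ones. A move in the descent whose multiplier lies in \<open>P\<close>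
  cannot be cheaper than its restriction to \<open>P\<close>, which preserves the cleaving; hence on the other side \<open>R\<close>
  its half-space is crossed at most at the wedge point, and because each label occurs twice it must there be
  closed under inversion. Such a move yields a cleaved graph again, and so the minimal element is cleaved.
\<close>

section \<open>Almost invariant sets and the subgroups they cut\<close>

text \<open>Core graphs transform badly under an automorphism, whereas a cut set \<open>Q\<close> is
  simply replaced by its preimage. The price is that the preimage of a half-space is in general only
  almost invariant, so local minimality has to be tested against all almost invariant sets. An
  automorphism may also mix the labels, so no label can be compared with itself; a nonzero term of
  the determinant pairs each label with a suitable partner, and only the sums over all labels are
  compared.

  Elements of equal complexity need not be joined by strictly decreasing moves. The test sequence
  breaks such ties: with the given sequence weighted heavily, the combined complexity behaves like a
  lexicographic order whose minimum is reached only up to a signed permutation.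

  The bound on \<open>minlex\<close> acts at one point: a half-space crossed only at the wedge
  vertex has cut number at most 1, which must lie below every edge count. Since moves are available
  only in the direction of descent, this bound is carried backwards from a minimal element to its
  whole orbit.\<close>

locale torsion_free_group = group G for G (structure) +
  assumes torsion_free: "x \<in> carrier G \<Longrightarrow> x \<noteq> \<one> \<Longrightarrow> n > 0 \<Longrightarrow> x [^] (n::nat) \<noteq> \<one>"
begin

section \<open>Conjugation in a group\<close>

lemma inv_cancel_left [simp]:
  "x \<in> carrier G \<Longrightarrow> y \<in> carrier G \<Longrightarrow> inv x \<otimes> (x \<otimes> y) = y"
  "x \<in> carrier G \<Longrightarrow> y \<in> carrier G \<Longrightarrow> x \<otimes> (inv x \<otimes> y) = y"
  by (simp_all flip: m_assoc)

definition conjg :: "'a \<Rightarrow> 'a \<Rightarrow> 'a" where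
  "conjg g x = inv g \<otimes> x \<otimes> g"

lemma conjg_closed [simp]: "g \<in> carrier G \<Longrightarrow> x \<in> carrier G \<Longrightarrow> conjg g x \<in> carrier G"
  by (simp add: conjg_def)

lemma conjg_one [simp]: "x \<in> carrier G \<Longrightarrow> conjg \<one> x = x"
  by (simp add: conjg_def)

lemma conjg_conjg: "\<lbrakk>g \<in> carrier G; h \<in> carrier G; x \<in> carrier G\<rbrakk> \<Longrightarrow> conjg h (conjg g x) = conjg (g \<otimes> h) x"
  by (simp add: conjg_def m_assoc inv_mult_group)

lemma conjg_cancel [simp]:
  "\<lbrakk>g \<in> carrier G; x \<in> carrier G\<rbrakk> \<Longrightarrow> conjg (inv g) (conjg g x) = x"
  "\<lbrakk>g \<in> carrier G; x \<in> carrier G\<rbrakk> \<Longrightarrow> conjg g (conjg (inv g) x) = x"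
  by (simp_all add: conjg_conjg)

lemma conjg_eq_one [simp]: "\<lbrakk>g \<in> carrier G; x \<in> carrier G\<rbrakk> \<Longrightarrow> conjg g x = \<one> \<longleftrightarrow> x = \<one>"
  by (metis conjg_cancel(1) conjg_def inv_closed l_inv one_closed r_one)

lemma conjg_mult: "\<lbrakk>g \<in> carrier G; x \<in> carrier G; y \<in> carrier G\<rbrakk> \<Longrightarrow> conjg g (x \<otimes> y) = conjg g x \<otimes> conjg g y"
  by (simp add: conjg_def m_assoc)

lemma conjg_inv: "\<lbrakk>g \<in> carrier G; x \<in> carrier G\<rbrakk> \<Longrightarrow> conjg g (inv x) = inv (conjg g x)"
  by (simp add: conjg_def m_assoc inv_mult_group)

lemma conjg_pow: "\<lbrakk>g \<in> carrier G; x \<in> carrier G\<rbrakk> \<Longrightarrow> conjg g x [^] (n::nat) = conjg g (x [^] n)"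
  by (induction n) (simp_all add: conjg_mult, simp add: conjg_def)

lemma conjg_image_image: "\<lbrakk>g \<in> carrier G; h \<in> carrier G; H \<subseteq> carrier G\<rbrakk>
    \<Longrightarrow> conjg h ` conjg g ` H = conjg (g \<otimes> h) ` H"
  by (auto simp: image_image conjg_conjg subset_iff intro!: image_cong)

lemma conjg_image_one: "H \<subseteq> carrier G \<Longrightarrow> conjg \<one> ` H = H"
  by (auto simp: subset_iff image_iff)

lemma conjg_hom: "g \<in> carrier G \<Longrightarrow> group_hom G G (conjg g)"
  by unfold_locales (auto simp: hom_def conjg_mult)

lemma conjg_iso: "g \<in> carrier G \<Longrightarrow> conjg g \<in> iso G G"
proof -
  assume g: "g \<in> carrier G"
  have "bij_betw (conjg g) (carrier G) (carrier G)"
    by (rule bij_betw_byWitness[where f' = "conjg (inv g)"]) (use g in auto)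
  then show ?thesis
    using conjg_hom[OF g] by (simp add: iso_def group_hom_def group_hom_axioms_def)
qed

lemma conjg_subgroup: "g \<in> carrier G \<Longrightarrow> subgroup H G \<Longrightarrow> subgroup (conjg g ` H) G"
  by (rule group_hom.subgroup_img_is_subgroup[OF conjg_hom])

lemma conjg_self: 
  assumes "subgroup H G" "h \<in> H" shows "conjg h ` H = H"
proof
  have h: "h \<in> carrier G" using assms subgroup.mem_carrier by metis
  show 1: "conjg h ` H \<subseteq> H"
    using assms by (auto simp: conjg_def subgroup.m_closed subgroup.m_inv_closed)
  have "conjg (inv h) ` H \<subseteq> H"
    using assms h by (auto simp: conjg_def subgroup.m_closed subgroup.m_inv_closed)
  then have "conjg h ` conjg (inv h) ` H \<subseteq> conjg h ` H" by blast
  then show "H \<subseteq> conjg h ` H"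
    using assms h by (simp add: conjg_image_image subgroup.subset conjg_image_one)
qed

section \<open>Almost invariant sets and the ends of cyclic subgroups\<close>

definition almost_invariant :: "'a set \<Rightarrow> bool" where
  "almost_invariant Q \<longleftrightarrow> (\<forall>k\<in>carrier G. finite {g\<in>carrier G. (g \<in> Q) \<noteq> (g \<otimes> k \<in> Q)})"

lemma almost_invariant_Compl: "almost_invariant Q \<Longrightarrow> almost_invariant (- Q)"
  by (simp add: almost_invariant_def)

lemma almost_invariant_Un:
  assumes "almost_invariant P" "almost_invariant Q" shows "almost_invariant (P \<union> Q)"
  unfolding almost_invariant_def
proof
  fix k assume k: "k \<in> carrier G"
  show "finite {g\<in>carrier G. (g \<in> P \<union> Q) \<noteq> (g \<otimes> k \<in> P \<union> Q)}"
    by (rule finite_subset[of _ "{g\<in>carrier G. (g \<in> P) \<noteq> (g \<otimes> k \<in> P)} \<union> {g\<in>carrier G. (g \<in> Q) \<noteq> (g \<otimes> k \<in> Q)}"])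
      (use assms k in \<open>auto simp: almost_invariant_def\<close>)
qed

lemma almost_invariant_Int:
  assumes "almost_invariant P" "almost_invariant Q" shows "almost_invariant (P \<inter> Q)"
  using almost_invariant_Compl[OF almost_invariant_Un[OF assms[THEN almost_invariant_Compl]]] by simp

lemma almost_invariant_Diff:
  assumes "almost_invariant P" "almost_invariant Q" shows "almost_invariant (P - Q)"
  unfolding Diff_eq by (intro almost_invariant_Int almost_invariant_Compl assms)

text \<open>The left translate \<open>x Q\<close>. Left translation commutes with the right
  multiplications that define the coboundary, so almost invariance survives.\<close>

definition translate :: "'a \<Rightarrow> 'a set \<Rightarrow> 'a set" where
  "translate x Q = {g\<in>carrier G. inv x \<otimes> g \<in> Q}"

lemma almost_invariant_translate:
  assumes "almost_invariant Q" "x \<in> carrier G" shows "almost_invariant (translate x Q)"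
  unfolding almost_invariant_def
proof
  fix k assume k: "k \<in> carrier G"
  have "{g\<in>carrier G. (g \<in> translate x Q) \<noteq> (g \<otimes> k \<in> translate x Q)}
      \<subseteq> (\<lambda>g. x \<otimes> g) ` {g\<in>carrier G. (g \<in> Q) \<noteq> (g \<otimes> k \<in> Q)}"
  proof
    fix g assume "g \<in> {g\<in>carrier G. (g \<in> translate x Q) \<noteq> (g \<otimes> k \<in> translate x Q)}"
    then show "g \<in> (\<lambda>g. x \<otimes> g) ` {g\<in>carrier G. (g \<in> Q) \<noteq> (g \<otimes> k \<in> Q)}"
      using assms k by (intro image_eqI[of _ _ "inv x \<otimes> g"]) (auto simp: translate_def m_assoc)
  qed
  then show "finite {g\<in>carrier G. (g \<in> translate x Q) \<noteq> (g \<otimes> k \<in> translate x Q)}"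
    by (rule finite_subset) (use assms k in \<open>auto simp: almost_invariant_def\<close>)
qed

text \<open>\<open>\<alpha>\<close> maps the coboundary of the preimage in direction
  \<open>k\<close> injectively into that of \<open>Q\<close> in direction
  \<open>\<alpha> k\<close>.\<close>

lemma almost_invariant_vimage:
  assumes "almost_invariant Q" "\<alpha> \<in> iso G G" shows "almost_invariant (\<alpha> -` Q)"
  unfolding almost_invariant_def
proof
  fix k assume k: "k \<in> carrier G"
  have inj: "inj_on \<alpha> (carrier G)" and cl: "\<And>x. x \<in> carrier G \<Longrightarrow> \<alpha> x \<in> carrier G"
    and mul: "\<And>x y. \<lbrakk>x \<in> carrier G; y \<in> carrier G\<rbrakk> \<Longrightarrow> \<alpha> (x \<otimes> y) = \<alpha> x \<otimes> \<alpha> y"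
    using assms(2) by (auto simp: iso_def hom_def bij_betw_def)
  have "\<alpha> ` {g\<in>carrier G. (g \<in> \<alpha> -` Q) \<noteq> (g \<otimes> k \<in> \<alpha> -` Q)} \<subseteq> {g\<in>carrier G. (g \<in> Q) \<noteq> (g \<otimes> \<alpha> k \<in> Q)}"
    using k by (auto simp: mul cl)
  moreover have "finite {g\<in>carrier G. (g \<in> Q) \<noteq> (g \<otimes> \<alpha> k \<in> Q)}"
    using assms(1) cl[OF k] by (auto simp: almost_invariant_def)
  ultimately show "finite {g\<in>carrier G. (g \<in> \<alpha> -` Q) \<noteq> (g \<otimes> k \<in> \<alpha> -` Q)}"
    using inj_on_subset[OF inj, of "{g\<in>carrier G. (g \<in> \<alpha> -` Q) \<noteq> (g \<otimes> k \<in> \<alpha> -` Q)}"]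
    by (auto dest: finite_subset intro: finite_imageD)
qed

text \<open>\<open>tends Q l\<close> says that the attracting end of \<open>l\<close> lies in \<open>Q\<close>.\<close>

definition tends :: "'a set \<Rightarrow> 'a \<Rightarrow> bool" where
  "tends Q l \<longleftrightarrow> (\<forall>\<^sub>F n in sequentially. l [^] (n::nat) \<in> Q)"

lemma inj_pow:
  assumes "l \<in> carrier G" "l \<noteq> \<one>" shows "inj (\<lambda>n::nat. l [^] n)"
proof (rule linorder_injI)
  fix m n :: nat assume "m < n"
  have "l [^] n = l [^] m \<otimes> l [^] (n - m)"
    using assms \<open>m < n\<close> by (simp add: nat_pow_mult)
  moreover have "l [^] (n - m) \<noteq> \<one>" using torsion_free assms \<open>m < n\<close> by simp
  ultimately show "l [^] m \<noteq> l [^] n"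
    using assms l_cancel_one'[of "l [^] m" "l [^] (n - m)"] by simp
qed

text \<open>By torsion-freeness the powers of a nontrivial element are distinct, so they leave every
  finite set. Limits along powers therefore ignore finite changes of a set.\<close>

lemma eventually_pow_notin:
  assumes "l \<in> carrier G" "l \<noteq> \<one>" "finite D"
  shows "\<forall>\<^sub>F n in sequentially. l [^] (n::nat) \<notin> D"
proof -
  have "finite ((\<lambda>n::nat. l [^] n) -` D)"
    using assms inj_pow finite_vimageI by blast
  then obtain N where "\<forall>n\<in>(\<lambda>n::nat. l [^] n) -` D. n < N"
    using finite_nat_set_iff_bounded by blast
  then show ?thesis by (intro eventually_sequentiallyI[of N]) (metis linorder_not_le vimageI)
qed

lemma tends_cong_finite:
  assumes "l \<in> carrier G" "l \<noteq> \<one>" "finite {g\<in>carrier G. (g \<in> P) \<noteq> (g \<in> Q)}"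
  shows "tends P l \<longleftrightarrow> tends Q l"
proof -
  have "\<forall>\<^sub>F n in sequentially. l [^] (n::nat) \<in> P \<longleftrightarrow> l [^] n \<in> Q"
    using eventually_pow_notin[OF assms] by eventually_elim (use assms in auto)
  then show ?thesis unfolding tends_def by (rule eventually_cong) simp
qed

text \<open>Right multiplication by \<open>l\<close> alters membership in \<open>Q\<close> at
  finitely many elements only, so membership of \<open>l^n\<close> is eventually constant and the
  end falls on exactly one side.\<close>

lemma tends_Compl:
  assumes "l \<in> carrier G" "l \<noteq> \<one>" "almost_invariant Q"
  shows "tends (- Q) l \<longleftrightarrow> \<not> tends Q l"
proof -
  have "finite {g\<in>carrier G. (g \<in> Q) \<noteq> (g \<otimes> l \<in> Q)}"
    using assms by (simp add: almost_invariant_def)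
  from eventually_pow_notin[OF assms(1,2) this]
  have "\<forall>\<^sub>F n in sequentially. l [^] n \<in> Q \<longleftrightarrow> l [^] (Suc n) \<in> Q"
    by eventually_elim (use assms in auto)
  then obtain N where N: "\<And>n. n \<ge> N \<Longrightarrow> l [^] n \<in> Q \<longleftrightarrow> l [^] (Suc n) \<in> Q"
    by (auto simp: eventually_sequentially)
  have const: "l [^] n \<in> Q \<longleftrightarrow> l [^] N \<in> Q" if "n \<ge> N" for n
    using that by (induction n rule: dec_induct) (use N in auto)
  show ?thesis
    unfolding tends_def eventually_sequentially Compl_iff using const
    by (metis linorder_linear order_refl)
qed

lemma tends_Un:
  assumes "l \<in> carrier G" "l \<noteq> \<one>" "almost_invariant P" "almost_invariant Q"
  shows "tends (P \<union> Q) l \<longleftrightarrow> tends P l \<or> tends Q l"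
proof -
  have "tends (- (P \<union> Q)) l \<longleftrightarrow> tends (- P) l \<and> tends (- Q) l"
    by (simp add: tends_def eventually_conj_iff)
  then show ?thesis using assms tends_Compl almost_invariant_Un by metis
qed

lemma tends_Int: "tends (P \<inter> Q) l \<longleftrightarrow> tends P l \<and> tends Q l"
  by (simp add: tends_def eventually_conj_iff)

lemma tends_Diff:
  assumes "l \<in> carrier G" "l \<noteq> \<one>" "almost_invariant P" "almost_invariant Q"
  shows "tends (P - Q) l \<longleftrightarrow> tends P l \<and> \<not> tends Q l"
  using assms by (simp add: Diff_eq tends_Int tends_Compl)

text \<open>\<open>x^-1 l^n\<close> and \<open>(x^-1 l x)^n\<close> differ by right multiplication
  by \<open>x\<close>, which almost invariance makes harmless for large \<open>n\<close>.\<close>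

lemma tends_translate:
  assumes "l \<in> carrier G" "l \<noteq> \<one>" "almost_invariant Q" "x \<in> carrier G"
  shows "tends (translate x Q) l \<longleftrightarrow> tends Q (conjg x l)"
proof -
  have "finite {g\<in>carrier G. (g \<in> translate x Q) \<noteq> (g \<otimes> x \<in> translate x Q)}"
    using assms almost_invariant_translate by (simp add: almost_invariant_def)
  from eventually_pow_notin[OF assms(1,2) this]
  have "\<forall>\<^sub>F n in sequentially. l [^] n \<in> translate x Q \<longleftrightarrow> conjg x l [^] n \<in> Q"
    by eventually_elim (use assms in \<open>auto simp: translate_def conjg_pow, auto simp: conjg_def m_assoc\<close>)
  then show ?thesis unfolding tends_def by (rule eventually_cong) simp
qed

lemma iso_pow:
  assumes "\<alpha> \<in> iso G G" "l \<in> carrier G" shows "\<alpha> (l [^] (n::nat)) = \<alpha> l [^] n"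
proof -
  interpret group_hom G G \<alpha> by unfold_locales (use assms in \<open>simp add: iso_def\<close>)
  show ?thesis using assms by (rule_tac hom_nat_pow)
qed

lemma tends_vimage: "\<alpha> \<in> iso G G \<Longrightarrow> l \<in> carrier G \<Longrightarrow> tends (\<alpha> -` Q) l \<longleftrightarrow> tends Q (\<alpha> l)"
  by (simp add: tends_def iso_pow)

text \<open>Attracting ends of single elements stand in for the limit set; in a subgroup the
  inverses supply the repelling ends as well. The trivial element has no end and is left
  out.\<close>

definition crosses :: "'a set \<Rightarrow> 'a set \<Rightarrow> bool" where
  "crosses Q L \<longleftrightarrow> (\<exists>l\<in>L - {\<one>}. \<exists>m\<in>L - {\<one>}. tends Q l \<and> \<not> tends Q m)"

text \<open>The coset \<open>H g\<close> is a vertex of the covering graph, and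
  \<open>g^-1 H g\<close> is the group of loops read from that vertex.\<close>

definition cuts :: "'a set \<Rightarrow> 'a set \<Rightarrow> 'a set set" where
  "cuts Q H = {H #> g | g. g \<in> carrier G \<and> crosses Q (conjg g ` H)}"

section \<open>Cut cosets: invariance, submodularity and finiteness\<close>

lemma r_coset_eq_iff:
  assumes "subgroup H G" "g \<in> carrier G" "k \<in> carrier G"
  shows "H #> g = H #> k \<longleftrightarrow> g \<otimes> inv k \<in> H"
proof
  assume "H #> g = H #> k"
  then have "g \<in> H #> k" using assms rcos_self by blast
  then obtain h where "h \<in> H" "g = h \<otimes> k" by (auto simp: r_coset_def)
  then show "g \<otimes> inv k \<in> H" using assms by (simp add: m_assoc subgroup.mem_carrier)
next
  assume *: "g \<otimes> inv k \<in> H"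
  then have "g \<in> H #> k" using assms
    by (auto simp: r_coset_def m_assoc intro!: bexI[of _ "g \<otimes> inv k"])
  then show "H #> g = H #> k" using assms repr_independence by blast
qed

lemma conjg_image_coset:
  assumes "subgroup H G" "g \<in> carrier G" "k \<in> carrier G" "H #> g = H #> k"
  shows "conjg g ` H = conjg k ` H"
proof -
  have h: "g \<otimes> inv k \<in> H" using assms r_coset_eq_iff by blast
  have "conjg g ` H = conjg ((g \<otimes> inv k) \<otimes> k) ` H" using assms by (simp add: m_assoc)
  also have "\<dots> = conjg k ` conjg (g \<otimes> inv k) ` H"
    using assms by (simp add: conjg_image_image subgroup.subset)
  also have "\<dots> = conjg k ` H" using conjg_self[OF assms(1) h] by simp
  finally show ?thesis .
qed

text \<open>The conjugate by \<open>g\<close> depends only on the coset \<open>H #> g\<close>, so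
  any representative may be tested although the definition merely asks for one.\<close>

lemma coset_in_cuts_iff:
  assumes "subgroup H G" "g \<in> carrier G"
  shows "H #> g \<in> cuts Q H \<longleftrightarrow> crosses Q (conjg g ` H)"
proof
  assume "H #> g \<in> cuts Q H"
  then obtain k where k: "k \<in> carrier G" "H #> g = H #> k" "crosses Q (conjg k ` H)"
    by (auto simp: cuts_def)
  then show "crosses Q (conjg g ` H)" using conjg_image_coset[OF assms k(1,2)] by simp
qed (use assms in \<open>auto simp: cuts_def\<close>)

lemma crosses_Compl:
  assumes "L \<subseteq> carrier G" "almost_invariant Q"
  shows "crosses (- Q) L \<longleftrightarrow> crosses Q L"
proof -
  have "tends (- Q) l \<longleftrightarrow> \<not> tends Q l" if "l \<in> L - {\<one>}" for l
    using tends_Compl[OF _ _ assms(2)] that assms(1) by blast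
  then show ?thesis unfolding crosses_def by blast
qed

lemma cuts_Compl:
  assumes "subgroup H G" "almost_invariant Q" shows "cuts (- Q) H = cuts Q H"
proof -
  have "conjg g ` H \<subseteq> carrier G" if "g \<in> carrier G" for g
    using assms conjg_subgroup that subgroup.subset by metis
  then have "crosses (- Q) (conjg g ` H) \<longleftrightarrow> crosses Q (conjg g ` H)" if "g \<in> carrier G" for g
    using crosses_Compl[OF _ assms(2)] that by blast
  then show ?thesis unfolding cuts_def by (intro Collect_cong ex_cong) blast
qed

lemma cuts_cong_finite:
  assumes "subgroup H G" "finite {g\<in>carrier G. (g \<in> P) \<noteq> (g \<in> Q)}"
  shows "cuts P H = cuts Q H"
proof -
  have "crosses P L \<longleftrightarrow> crosses Q L" if "L \<subseteq> carrier G" for L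
  proof -
    have "tends P l \<longleftrightarrow> tends Q l" if "l \<in> L - {\<one>}" for l
      using tends_cong_finite[OF _ _ assms(2)] that \<open>L \<subseteq> carrier G\<close> by blast
    then show ?thesis unfolding crosses_def by blast
  qed
  moreover have "conjg g ` H \<subseteq> carrier G" if "g \<in> carrier G" for g
    using assms conjg_subgroup that subgroup.subset by metis
  ultimately have "crosses P (conjg g ` H) \<longleftrightarrow> crosses Q (conjg g ` H)" if "g \<in> carrier G" for g
    using that by blast
  then show ?thesis unfolding cuts_def by (intro Collect_cong ex_cong) blast
qed

lemma crosses_translate:
  assumes "L \<subseteq> carrier G" "almost_invariant Q" "x \<in> carrier G"
  shows "crosses (translate x Q) L \<longleftrightarrow> crosses Q (conjg x ` L)"
proof -
  have "conjg x ` L - {\<one>} = conjg x ` (L - {\<one>})" using assms by (auto simp: subset_iff)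
  then show ?thesis unfolding crosses_def using assms tends_translate by (auto simp: subset_iff)
qed

text \<open>Moving \<open>Q\<close> by \<open>x\<close> amounts to moving the base vertex: the
  translate is crossed at \<open>H g\<close> exactly when \<open>Q\<close> is crossed at
  \<open>H g x\<close>.\<close>

lemma cuts_translate:
  assumes H: "subgroup H G" and Q: "almost_invariant Q" and x: "x \<in> carrier G"
  shows "cuts Q H = (\<lambda>C. C #> x) ` cuts (translate x Q) H"
proof -
  have sub: "conjg g ` H \<subseteq> carrier G" if "g \<in> carrier G" for g
    using H conjg_subgroup that subgroup.subset by metis
  have eq: "crosses (translate x Q) (conjg g ` H) \<longleftrightarrow> crosses Q (conjg (g \<otimes> x) ` H)" if "g \<in> carrier G" for g
    using crosses_translate[OF sub[OF that] Q x] that x H by (simp add: conjg_image_image subgroup.subset)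
  have mult: "H #> g #> x = H #> (g \<otimes> x)" if "g \<in> carrier G" for g
    using that x H by (simp add: coset_mult_assoc subgroup.subset)
  show ?thesis
  proof (intro equalityI subsetI)
    fix C assume "C \<in> cuts Q H"
    then obtain g where g: "g \<in> carrier G" "C = H #> g" "crosses Q (conjg g ` H)"
      by (auto simp: cuts_def)
    let ?g = "g \<otimes> inv x"
    have [simp]: "?g \<in> carrier G" "?g \<otimes> x = g" using g x by (simp_all add: m_assoc)
    have "H #> ?g \<in> cuts (translate x Q) H" using g eq[of ?g] coset_in_cuts_iff[OF H] by simp
    moreover have "H #> ?g #> x = C" using mult[of ?g] g by simp
    ultimately show "C \<in> (\<lambda>C. C #> x) ` cuts (translate x Q) H" by blast
  next
    fix C assume "C \<in> (\<lambda>C. C #> x) ` cuts (translate x Q) H"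
    then obtain g where g: "g \<in> carrier G" "C = H #> g #> x" "crosses (translate x Q) (conjg g ` H)"
      by (auto simp: cuts_def)
    then show "C \<in> cuts Q H" using eq mult coset_in_cuts_iff[OF H, of "g \<otimes> x"] x by simp
  qed
qed

lemma cuts_subset: "subgroup H G \<Longrightarrow> C \<in> cuts Q H \<Longrightarrow> C \<subseteq> carrier G"
  by (auto simp: cuts_def dest: r_coset_subset_G[OF subgroup.subset])

lemma card_cuts_translate:
  assumes "subgroup H G" "almost_invariant Q" "x \<in> carrier G"
  shows "card (cuts (translate x Q) H) = card (cuts Q H)"
proof -
  have "inj_on (\<lambda>C. C #> x) (cuts (translate x Q) H)"
  proof (rule inj_on_inverseI[where g = "\<lambda>C. C #> inv x"])
    fix C assume "C \<in> cuts (translate x Q) H"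
    then have "C \<subseteq> carrier G" using cuts_subset assms by blast
    then show "C #> x #> inv x = C" using assms by (simp add: coset_mult_assoc coset_mult_one)
  qed
  then show ?thesis using cuts_translate[OF assms] by (simp add: card_image)
qed

text \<open>Left multiplication by \<open>k\<close> matches the coset of \<open>g\<close> for
  \<open>k^-1 H k\<close> with the coset \<open>H k g\<close>, and both carry the same loop group.
  Cut numbers thus depend only on the conjugacy class.\<close>

lemma card_cuts_conjg:
  assumes H: "subgroup H G" and k: "k \<in> carrier G"
  shows "card (cuts Q (conjg k ` H)) = card (cuts Q H)"
proof -
  have K: "subgroup (conjg k ` H) G" using conjg_subgroup assms by blast
  have Hs: "H \<subseteq> carrier G" using H subgroup.subset by blast
  have eq: "k <# (conjg k ` H #> g) = H #> (k \<otimes> g)" if "g \<in> carrier G" for g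
    unfolding l_coset_def r_coset_def using that k Hs
    by (auto simp: conjg_def m_assoc subset_iff image_iff)
  have "bij_betw (\<lambda>C. k <# C) (cuts Q (conjg k ` H)) (cuts Q H)"
  proof (rule bij_betw_imageI)
    show "inj_on (\<lambda>C. k <# C) (cuts Q (conjg k ` H))"
    proof (rule inj_on_inverseI[where g = "\<lambda>C. inv k <# C"])
      fix C assume "C \<in> cuts Q (conjg k ` H)"
      then have "C \<subseteq> carrier G" using cuts_subset K by blast
      then show "inv k <# (k <# C) = C" using k by (auto simp: l_coset_def subset_iff)
    qed
    show "(\<lambda>C. k <# C) ` cuts Q (conjg k ` H) = cuts Q H"
    proof (intro equalityI subsetI)
      fix C assume "C \<in> (\<lambda>C. k <# C) ` cuts Q (conjg k ` H)"
      then obtain g where g: "g \<in> carrier G" "C = k <# (conjg k ` H #> g)" "crosses Q (conjg g ` conjg k ` H)"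
        by (auto simp: cuts_def)
      then show "C \<in> cuts Q H" using eq[OF g(1)] k Hs
        by (auto simp: cuts_def conjg_image_image)
    next
      fix C assume "C \<in> cuts Q H"
      then obtain g where g: "g \<in> carrier G" "C = H #> g" "crosses Q (conjg g ` H)"
        by (auto simp: cuts_def)
      let ?g = "inv k \<otimes> g"
      have "conjg ?g ` conjg k ` H = conjg g ` H" using g k Hs by (simp add: conjg_image_image)
      then have "conjg k ` H #> ?g \<in> cuts Q (conjg k ` H)" 
        using coset_in_cuts_iff[OF K, of ?g] g k by simp
      moreover have "k <# (conjg k ` H #> ?g) = C" using eq[of ?g] g k by simp
      ultimately show "C \<in> (\<lambda>C. k <# C) ` cuts Q (conjg k ` H)" by blast
    qed
  qed
  then show ?thesis by (rule bij_betw_same_card)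
qed

text \<open>Carrying cosets and conjugates back along \<open>\<alpha>\<close> trades the image
  subgroup for the preimage set; all members of an orbit can then be compared on one fixed
  \<open>H\<close>.\<close>

lemma card_cuts_iso_image:
  assumes \<alpha>: "\<alpha> \<in> iso G G" and H: "subgroup H G"
  shows "card (cuts Q (\<alpha> ` H)) = card (cuts (\<alpha> -` Q) H)"
proof -
  interpret \<alpha>: group_hom G G \<alpha> by unfold_locales (use \<alpha> in \<open>simp add: iso_def\<close>)
  have inj: "inj_on \<alpha> (carrier G)" and img: "\<alpha> ` carrier G = carrier G"
    using \<alpha> by (auto simp: iso_def bij_betw_def)
  have K: "subgroup (\<alpha> ` H) G" using H \<alpha>.subgroup_img_is_subgroup by blast
  have Hs: "H \<subseteq> carrier G" using H subgroup.subset by blast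
  have cj: "\<alpha> (conjg g h) = conjg (\<alpha> g) (\<alpha> h)" if "g \<in> carrier G" "h \<in> carrier G" for g h
    using that by (simp add: conjg_def)
  have one: "\<alpha> l = \<one> \<longleftrightarrow> l = \<one>" if "l \<in> carrier G" for l
    using that inj by (metis \<alpha>.hom_one inj_onD one_closed)
  have cr: "crosses Q (conjg (\<alpha> g) ` \<alpha> ` H) \<longleftrightarrow> crosses (\<alpha> -` Q) (conjg g ` H)" if g: "g \<in> carrier G" for g
  proof -
    have L: "conjg g ` H \<subseteq> carrier G" using g Hs by auto
    have "conjg (\<alpha> g) ` \<alpha> ` H = \<alpha> ` conjg g ` H"
      using g Hs by (auto simp: image_image cj subset_iff intro!: image_cong)
    moreover have "\<alpha> ` conjg g ` H - {\<one>} = \<alpha> ` (conjg g ` H - {\<one>})" using one L by (auto simp: subset_iff)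
    ultimately show ?thesis unfolding crosses_def using tends_vimage[OF \<alpha>] L by (auto simp: subset_iff)
  qed
  have cos: "\<alpha> ` (H #> g) = \<alpha> ` H #> \<alpha> g" if "g \<in> carrier G" for g
    using that Hs by (auto simp: r_coset_def subset_iff image_iff)
  have "bij_betw (\<lambda>C. \<alpha> ` C) (cuts (\<alpha> -` Q) H) (cuts Q (\<alpha> ` H))"
  proof (rule bij_betw_imageI)
    show "inj_on (\<lambda>C. \<alpha> ` C) (cuts (\<alpha> -` Q) H)"
      using inj_on_image_eq_iff[OF inj] cuts_subset[OF H] by (auto simp: inj_on_def)
    show "(\<lambda>C. \<alpha> ` C) ` cuts (\<alpha> -` Q) H = cuts Q (\<alpha> ` H)"
    proof (intro equalityI subsetI)
      fix C assume "C \<in> (\<lambda>C. \<alpha> ` C) ` cuts (\<alpha> -` Q) H"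
      then obtain g where "g \<in> carrier G" "C = \<alpha> ` (H #> g)" "crosses (\<alpha> -` Q) (conjg g ` H)"
        by (auto simp: cuts_def)
      then show "C \<in> cuts Q (\<alpha> ` H)" using cr cos by (auto simp: cuts_def)
    next
      fix C assume "C \<in> cuts Q (\<alpha> ` H)"
      then obtain k where k: "k \<in> carrier G" "C = \<alpha> ` H #> k" "crosses Q (conjg k ` \<alpha> ` H)"
        by (auto simp: cuts_def)
      then obtain g where g: "g \<in> carrier G" "k = \<alpha> g" using img by blast
      then have "H #> g \<in> cuts (\<alpha> -` Q) H" using k cr coset_in_cuts_iff[OF H] by simp
      moreover have "\<alpha> ` (H #> g) = C" using g k cos by simp
      ultimately show "C \<in> (\<lambda>C. \<alpha> ` C) ` cuts (\<alpha> -` Q) H" by blast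
    qed
  qed
  then show ?thesis using bij_betw_same_card by force
qed

text \<open>A group crossing the intersection or the union crosses \<open>P\<close> or
  \<open>Q\<close>. If it crosses both of them, it has an end in \<open>P \<inter> Q\<close> and one
  outside \<open>P \<union> Q\<close>, hence crosses \<open>P\<close> and \<open>Q\<close>. Counting
  cosets gives the inequality.\<close>

lemma card_cuts_submodular:
  assumes H: "subgroup H G" and P: "almost_invariant P" and Q: "almost_invariant Q"
    and fin: "finite (cuts P H)" "finite (cuts Q H)"
  shows "card (cuts (P \<inter> Q) H) + card (cuts (P \<union> Q) H) \<le> card (cuts P H) + card (cuts Q H)"
proof -
  let ?I = "cuts (P \<inter> Q) H" and ?U = "cuts (P \<union> Q) H"
  have *: "(crosses (P \<inter> Q) L \<or> crosses (P \<union> Q) L \<longrightarrow> crosses P L \<or> crosses Q L) \<and>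
        (crosses (P \<inter> Q) L \<and> crosses (P \<union> Q) L \<longrightarrow> crosses P L \<and> crosses Q L)" if L: "L \<subseteq> carrier G" for L
  proof -
    have t: "tends (P \<union> Q) l \<longleftrightarrow> tends P l \<or> tends Q l" if "l \<in> L - {\<one>}" for l
      using tends_Un[OF _ _ P Q] that L by auto
    show ?thesis unfolding crosses_def by (auto simp: t tends_Int)
  qed
  have sub: "conjg g ` H \<subseteq> carrier G" if "g \<in> carrier G" for g
    using conjg_subgroup[OF that H] subgroup.subset by blast
  have 1: "?I \<union> ?U \<subseteq> cuts P H \<union> cuts Q H"
  proof
    fix C assume C: "C \<in> ?I \<union> ?U"
    then obtain g where g: "g \<in> carrier G" "C = H #> g" by (auto simp: cuts_def)
    then show "C \<in> cuts P H \<union> cuts Q H"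
      using C *[OF sub[OF g(1)]] coset_in_cuts_iff[OF H g(1)] by auto
  qed
  have 2: "?I \<inter> ?U \<subseteq> cuts P H \<inter> cuts Q H"
  proof
    fix C assume C: "C \<in> ?I \<inter> ?U"
    then obtain g where g: "g \<in> carrier G" "C = H #> g" by (auto simp: cuts_def)
    then show "C \<in> cuts P H \<inter> cuts Q H"
      using C *[OF sub[OF g(1)]] coset_in_cuts_iff[OF H g(1)] by auto
  qed
  have "finite (?I \<union> ?U)" by (rule finite_subset[OF 1]) (simp add: fin)
  then have "card ?I + card ?U = card (?I \<union> ?U) + card (?I \<inter> ?U)" using card_Un_Int[of ?I ?U] by simp
  also have "\<dots> \<le> card (cuts P H \<union> cuts Q H) + card (cuts P H \<inter> cuts Q H)"
    by (intro add_mono card_mono 1 2) (simp_all add: fin)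
  also have "\<dots> = card (cuts P H) + card (cuts Q H)" using card_Un_Int[OF fin] by simp
  finally show ?thesis .
qed

text \<open>If \<open>g^-1 H\<close> avoids the coboundary of \<open>Q\<close> in the directions of
  the generators and their inverses, membership in \<open>Q\<close> is constant on it and nothing is
  crossed. So each cut coset is found from one of finitely many boundary points.\<close>

lemma finite_cuts:
  assumes S: "finite S" "S \<subseteq> carrier G" and Q: "almost_invariant Q"
  shows "finite (cuts Q (generate G S))"
proof -
  let ?H = "generate G S"
  have H: "subgroup ?H G" using S generate_is_subgroup by blast
  define D where "D = (\<Union>s\<in>S. {g\<in>carrier G. (g \<in> Q) \<noteq> (g \<otimes> s \<in> Q)})"
  have D: "finite D" using S Q by (auto simp: D_def almost_invariant_def)
  define D' where "D' = (\<Union>s\<in>S. {g\<in>carrier G. (g \<in> Q) \<noteq> (g \<otimes> inv s \<in> Q)})"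
  have D': "finite D'" using S Q by (auto simp: D'_def almost_invariant_def)
  \<comment> \<open>Constancy is claimed at all points of the orbit at once, because a product
    \<open>h1 h2\<close> is traversed from the intermediate point \<open>k h1\<close>.\<close>
  have const: "(\<forall>k\<in>?H. g \<otimes> k \<notin> D \<union> D') \<Longrightarrow> h \<in> ?H \<Longrightarrow> \<forall>k\<in>?H. (g \<otimes> k \<in> Q) \<longleftrightarrow> (g \<otimes> k \<otimes> h \<in> Q)"
    if g: "g \<in> carrier G" for g h
  proof (rotate_tac, induction h rule: generate.induct)
    case one
    then show ?case using g H by (auto simp: subgroup.mem_carrier)
  next
    case (incl h)
    then show ?case using g H S by (auto simp: D_def subgroup.mem_carrier)
  next
    case (inv h)
    then show ?case using g H S by (auto simp: D'_def subgroup.mem_carrier)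
  next
    case (eng h1 h2)
    have c: "h1 \<in> carrier G" "h2 \<in> carrier G" using eng.hyps subgroup.mem_carrier[OF H] by auto
    show ?case
    proof
      fix k assume k: "k \<in> ?H"
      then have kc: "k \<in> carrier G" using subgroup.mem_carrier[OF H] by simp
      have "k \<otimes> h1 \<in> ?H" using k eng.hyps by (simp add: generate.eng)
      then have "g \<otimes> (k \<otimes> h1) \<in> Q \<longleftrightarrow> g \<otimes> (k \<otimes> h1) \<otimes> h2 \<in> Q" using eng.IH(2) eng.prems by simp
      moreover have "g \<otimes> k \<in> Q \<longleftrightarrow> g \<otimes> k \<otimes> h1 \<in> Q" using eng.IH(1) eng.prems k by simp
      ultimately show "g \<otimes> k \<in> Q \<longleftrightarrow> g \<otimes> k \<otimes> (h1 \<otimes> h2) \<in> Q" using c kc g by (simp add: m_assoc)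
    qed
  qed
  \<comment> \<open>A boundary point \<open>d = g^-1 k\<close> with \<open>k\<close> in
    \<open>H\<close> determines the coset: \<open>H d^-1 = H k^-1 g = H g\<close>.\<close>
  have "cuts Q ?H \<subseteq> (\<lambda>d. ?H #> inv d) ` (D \<union> D')"
  proof
    fix C assume "C \<in> cuts Q ?H"
    then obtain g l m where g: "g \<in> carrier G" "C = ?H #> g" and lm: "l \<in> ?H" "m \<in> ?H" "l \<noteq> \<one>" "m \<noteq> \<one>"
      "tends Q (conjg g l)" "\<not> tends Q (conjg g m)"
    proof -
      from \<open>C \<in> cuts Q ?H\<close> obtain g where g: "g \<in> carrier G" "C = ?H #> g" "crosses Q (conjg g ` ?H)"
        by (auto simp: cuts_def)
      then obtain l m where lm: "l \<in> ?H" "m \<in> ?H" "conjg g l \<noteq> \<one>" "conjg g m \<noteq> \<one>"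
        "tends Q (conjg g l)" "\<not> tends Q (conjg g m)" by (auto simp: crosses_def)
      then have "l \<noteq> \<one>" "m \<noteq> \<one>" using g by auto
      then show thesis using that g lm by blast
    qed
    have lmc: "l \<in> carrier G" "m \<in> carrier G" using lm subgroup.mem_carrier[OF H] by auto
    have "\<exists>k\<in>?H. inv g \<otimes> k \<in> D \<union> D'"
    proof (rule ccontr)
      assume "\<not> ?thesis"
      then have nD: "\<forall>k\<in>?H. inv g \<otimes> k \<notin> D \<union> D'" by blast
      have *: "\<forall>h\<in>?H. \<forall>k\<in>?H. (inv g \<otimes> k \<in> Q) \<longleftrightarrow> (inv g \<otimes> k \<otimes> h \<in> Q)"
        by (rule ballI, rule const[OF _ nD]) (use g in auto)
      then have **: "inv g \<otimes> h \<in> Q \<longleftrightarrow> inv g \<in> Q" if "h \<in> ?H" for h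
        using bspec[OF bspec[OF *], of h \<one>] that g generate.one[of G S] by simp
      have "tends (translate g Q) h \<longleftrightarrow> inv g \<in> Q" if "h \<in> ?H" "h \<in> carrier G" for h
      proof -
        have "h [^] (n::nat) \<in> ?H" for n using that by (induction n) (auto intro: generate.intros)
        then show ?thesis using ** that by (simp add: tends_def translate_def)
      qed
      then have "tends (translate g Q) l \<longleftrightarrow> tends (translate g Q) m" using lm lmc by simp
      then show False using lm lmc tends_translate[OF _ _ Q g(1)] by simp
    qed
    then obtain k where k: "k \<in> ?H" "inv g \<otimes> k \<in> D \<union> D'" by blast
    have kc: "k \<in> carrier G" using k subgroup.mem_carrier[OF H] by simp
    have "?H #> inv (inv g \<otimes> k) = ?H #> g" using g k kc H
      by (subst r_coset_eq_iff) (auto simp: inv_mult_group m_assoc subgroup.m_inv_closed)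
    then show "C \<in> (\<lambda>d. ?H #> inv d) ` (D \<union> D')" using k(2) g(2) by (intro image_eqI) auto
  qed
  then show ?thesis by (rule finite_subset) (simp add: D D')
qed

end

section \<open>Reduced words\<close>

lemma letter_inv_inv [simp]: "letter_inv (letter_inv x) = x"
  by (simp add: letter_inv_def)

lemma letter_inv_neq [simp]: "letter_inv x \<noteq> x" "x \<noteq> letter_inv x"
  by (cases x; simp add: letter_inv_def)+

lemma letter_inv_eq_iff [simp]: "letter_inv x = letter_inv y \<longleftrightarrow> x = y"
  by (metis letter_inv_inv)

lemma snd_letter_inv [simp]: "snd (letter_inv x) = snd x"
  by (simp add: letter_inv_def)

lemma snd_eq_iff_letter: "snd x = snd y \<longleftrightarrow> x = y \<or> x = letter_inv y"
  by (cases x; cases y) (auto simp: letter_inv_def)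

lemma reduced_successively: "reduced w \<longleftrightarrow> successively (\<lambda>x y. y \<noteq> letter_inv x) w"
  by (induction w rule: reduced.induct) auto

lemma reduced_append:
  "reduced (u @ v) \<longleftrightarrow> reduced u \<and> reduced v \<and> (u \<noteq> [] \<longrightarrow> v \<noteq> [] \<longrightarrow> hd v \<noteq> letter_inv (last u))"
  by (auto simp: reduced_successively successively_append_iff)

lemma reduced_Cons: "reduced (x # w) \<longleftrightarrow> reduced w \<and> (w \<noteq> [] \<longrightarrow> hd w \<noteq> letter_inv x)"
  using reduced_append[of "[x]" w] by auto

lemma reduced_rev [simp]: "reduced (rev w) \<longleftrightarrow> reduced w"
proof -
  have "successively (\<lambda>x y. x \<noteq> letter_inv y) w \<longleftrightarrow> successively (\<lambda>x y. y \<noteq> letter_inv x) w"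
    by (rule successively_cong) (metis letter_inv_inv, simp)
  then show ?thesis by (simp add: reduced_successively)
qed

section \<open>Formal inverses and free reduction by a stack\<close>

definition winv :: "'b word \<Rightarrow> 'b word" where
  "winv w = rev (map letter_inv w)"

lemma winv_simps [simp]:
  "winv [] = []" "winv (u @ v) = winv v @ winv u" "winv (x # v) = winv v @ [letter_inv x]" "winv (winv w) = w"
  "length (winv w) = length w" "winv w = [] \<longleftrightarrow> w = []" "snd ` set (winv w) = snd ` set w"
  by (auto simp: winv_def rev_map image_image o_def)

lemma hd_winv [simp]: "w \<noteq> [] \<Longrightarrow> hd (winv w) = letter_inv (last w)"
  by (simp add: winv_def hd_rev last_map)

lemma last_winv [simp]: "w \<noteq> [] \<Longrightarrow> last (winv w) = letter_inv (hd w)"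
  by (simp add: winv_def last_rev hd_map)

lemma reduced_winv [simp]: "reduced (winv w) \<longleftrightarrow> reduced w"
proof -
  have "reduced (map letter_inv w) \<longleftrightarrow> reduced w" 
    unfolding reduced_successively successively_map letter_inv_eq_iff ..
  then show ?thesis by (simp add: winv_def)
qed

lemma push_reduced: "reduced w \<Longrightarrow> reduced (push x w)"
  by (cases w) (auto simp: reduced_Cons)

lemma push_push [simp]: "reduced w \<Longrightarrow> push (letter_inv x) (push x w) = w"
  by (cases w; cases "tl w") (auto simp: reduced_Cons)

lemma push_push' [simp]: "reduced w \<Longrightarrow> push x (push (letter_inv x) w) = w"
  using push_push[of w "letter_inv x"] by simp

abbreviation pushes :: "'b word \<Rightarrow> 'b word \<Rightarrow> 'b word" where
  "pushes a w \<equiv> foldl (\<lambda>acc x. push x acc) a w"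

lemma pushes_reduced: "reduced a \<Longrightarrow> reduced (pushes a w)"
  by (induction w arbitrary: a) (auto simp: push_reduced)

lemma pushes_push:
  assumes "reduced a" "reduced c" shows "pushes a (rev (push x c)) = push x (pushes a (rev c))"
proof (cases c)
  case (Cons y ys)
  then show ?thesis using assms pushes_reduced[OF assms(1), of "rev ys"] by auto
qed simp

text \<open>A cancelling pair pushed onto a reduced stack restores it, so a word and its free
  reduction act alike on stacks. This yields associativity of the product without a confluence
  argument.\<close>

lemma pushes_reduce: "reduced a \<Longrightarrow> pushes a (reduce w) = pushes a w"
  by (induction w rule: rev_induct) (simp_all add: reduce_def pushes_push pushes_reduced)

lemma pushes_reduced_append: "reduced (rev a @ w) \<Longrightarrow> pushes a w = rev w @ a"
proof (induction w arbitrary: a)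
  case (Cons x w)
  have "push x a = x # a" using Cons.prems by (cases a) (auto simp: reduced_append)
  then show ?case using Cons by simp
qed simp

lemma reduce_eq_self: "reduced w \<Longrightarrow> reduce w = w"
  using pushes_reduced_append[of "[]" w] by (simp add: reduce_def)

lemma reduced_reduce [simp]: "reduced (reduce w)"
  by (simp add: reduce_def pushes_reduced)

lemma reduce_append_left [simp]: "reduce (reduce u @ v) = reduce (u @ v)"
  by (simp add: reduce_def pushes_reduce[unfolded reduce_def])

lemma reduce_append_right [simp]: "reduce (u @ reduce v) = reduce (u @ v)"
  using pushes_reduce[OF pushes_reduced[of "[]" u], of v] by (simp add: reduce_def)

lemma reduce_cancel_letter: "reduce (u @ letter_inv x # x # v) = reduce (u @ v)"
  using pushes_reduced[of "[]" u] by (simp add: reduce_def)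

lemma reduce_cancel: "reduce (u @ winv w @ w @ v) = reduce (u @ v)"
proof (induction w arbitrary: u v)
  case (Cons x w)
  have "reduce (u @ winv (x # w) @ (x # w) @ v) = reduce ((u @ winv w) @ letter_inv x # x # (w @ v))" by simp
  also have "\<dots> = reduce (u @ winv w @ w @ v)" by (subst reduce_cancel_letter) simp
  finally show ?case using Cons by simp
qed simp

lemma reduce_cancel': "reduce (u @ w @ winv w @ v) = reduce (u @ v)"
  using reduce_cancel[of u "winv w" v] by simp

lemma set_push: "set (push x w) \<subseteq> insert x (set w)"
  by (cases w) auto

lemma set_pushes: "set (pushes a w) \<subseteq> set a \<union> set w"
  by (induction w arbitrary: a) (auto dest!: subsetD[OF set_push])

lemma set_reduce: "set (reduce w) \<subseteq> set w"
  using set_pushes[of "[]" w] by (simp add: reduce_def)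

text \<open>A first letter that cancels against the last is stripped together with it. A reduced
  word is never exhausted this way, since its two middle letters do not cancel.\<close>

lemma cyclically_reduced_decomp:
  "reduced w \<Longrightarrow> w \<noteq> [] \<Longrightarrow> \<exists>u v. w = u @ v @ winv u \<and> v \<noteq> [] \<and> cyclically_reduced v"
proof (induction w rule: length_induct)
  case (1 w)
  show ?case
  proof (cases "cyclically_reduced w")
    case True
    then show ?thesis using 1 by (intro exI[of _ "[]"] exI[of _ w]) simp
  next
    case False
    then have l: "last w = letter_inv (hd w)" using 1 by (simp add: cyclically_reduced_def)
    obtain x t where w: "w = x # t" using 1 by (cases w) auto
    have "t \<noteq> []" using l w by auto
    then obtain s where s: "w = x # s @ [letter_inv x]"
      using l w by (metis append_butlast_last_id last_ConsR list.sel(1))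
    have "reduced s" "s \<noteq> []" using 1(2) s by (auto simp: reduced_Cons reduced_append)
    moreover have "length s < length w" using s by simp
    ultimately obtain u v where "s = u @ v @ winv u" "v \<noteq> []" "cyclically_reduced v" using 1(1) by blast
    then show ?thesis using s by (intro exI[of _ "x # u"] exI[of _ v]) simp
  qed
qed

lemma hd_last_concat_replicate:
  "v \<noteq> [] \<Longrightarrow> n > 0 \<Longrightarrow> concat (replicate n v) \<noteq> []"
  "v \<noteq> [] \<Longrightarrow> n > 0 \<Longrightarrow> hd (concat (replicate n v)) = hd v"
  "v \<noteq> [] \<Longrightarrow> n > 0 \<Longrightarrow> last (concat (replicate n v)) = last v"
proof -
  assume v: "v \<noteq> []" and n: "n > 0"
  obtain m where m: "n = Suc m" using n gr0_conv_Suc by blast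
  show "concat (replicate n v) \<noteq> []" "hd (concat (replicate n v)) = hd v" using v m by auto
  have "concat (replicate n v) = concat (replicate m v) @ v"
    unfolding m replicate_Suc by (metis concat_append concat.simps append_Nil2 replicate_append_same)
  then show "last (concat (replicate n v)) = last v" using v by simp
qed

lemma reduced_concat_replicate:
  assumes "cyclically_reduced v" shows "reduced (concat (replicate n v))"
proof (cases "v = []")
  case False
  show ?thesis
  proof (induction n)
    case (Suc n)
    show ?case
    proof (cases "n = 0")
      case False
      then show ?thesis using Suc assms \<open>v \<noteq> []\<close> hd_last_concat_replicate[of v n]
        by (auto simp: reduced_append cyclically_reduced_def)
    qed (use assms in \<open>auto simp: cyclically_reduced_def\<close>)
  qed simp
qed (simp add: concat_replicate_trivial)

section \<open>The free group\<close>

locale free_grp =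
  fixes B :: "'b set"
begin

abbreviation F :: "'b word set" where "F \<equiv> carrier (free_group B)"
abbreviation mul (infixl "\<cdot>" 70) where "x \<cdot> y \<equiv> x \<otimes>\<^bsub>free_group B\<^esub> y"
abbreviation ginv where "ginv x \<equiv> inv\<^bsub>free_group B\<^esub> x"
abbreviation gpow (infixr "^^^" 75) where "x ^^^ n \<equiv> x [^]\<^bsub>free_group B\<^esub> (n::nat)"

lemma mem_F: "w \<in> F \<longleftrightarrow> snd ` set w \<subseteq> B \<and> reduced w"
  by (simp add: free_group_def)

lemma mul_def: "u \<cdot> v = reduce (u @ v)"
  by (simp add: free_group_def)

lemma one_F [simp]: "\<one>\<^bsub>free_group B\<^esub> = []"
  by (simp add: free_group_def)

lemma group_F: "group (free_group B)"
proof (rule groupI)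
  fix x y assume "x \<in> F" "y \<in> F"
  then show "x \<cdot> y \<in> F" using image_mono[OF set_reduce[of "x @ y"], of snd]
    by (simp add: mem_F mul_def image_Un) (meson Un_least subset_trans)
next
  fix x assume x: "x \<in> F"
  then show "\<one>\<^bsub>free_group B\<^esub> \<cdot> x = x" by (simp add: mul_def mem_F reduce_eq_self)
  have "winv x \<in> F" using x by (simp add: mem_F)
  moreover have "winv x \<cdot> x = \<one>\<^bsub>free_group B\<^esub>"
    using reduce_cancel[of "[]" x "[]"] by (simp add: mul_def reduce_eq_self)
  ultimately show "\<exists>y\<in>F. y \<cdot> x = \<one>\<^bsub>free_group B\<^esub>" by blast
qed (simp_all add: mul_def mem_F)

end

sublocale free_grp \<subseteq> group "free_group B"
  by (rule group_F)

context free_grp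
begin

lemma winv_F [simp]: "winv w \<in> F \<longleftrightarrow> w \<in> F"
  by (simp add: mem_F)

lemma ginv_eq [simp]: "w \<in> F \<Longrightarrow> ginv w = winv w"
  using reduce_cancel[of "[]" w "[]"] by (intro inv_equality) (simp_all add: mul_def reduce_eq_self)

lemma mul_append: "u @ v \<in> F \<Longrightarrow> u \<cdot> v = u @ v"
  by (simp add: mul_def mem_F reduce_eq_self)

lemma append_F: "u @ v \<in> F \<longleftrightarrow> u \<in> F \<and> v \<in> F \<and> (u \<noteq> [] \<longrightarrow> v \<noteq> [] \<longrightarrow> hd v \<noteq> letter_inv (last u))"
  by (auto simp: mem_F reduced_append)

lemma Nil_F [simp]: "[] \<in> F"
  by (simp add: mem_F)

lemma single_F [simp]: "[x] \<in> F \<longleftrightarrow> snd x \<in> B"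
  by (simp add: mem_F)

lemma mul_Nil [simp]: "w \<in> F \<Longrightarrow> w \<cdot> [] = w" "w \<in> F \<Longrightarrow> [] \<cdot> w = w"
  using r_one l_one by auto

lemma mul_winv [simp]: "w \<in> F \<Longrightarrow> w \<cdot> winv w = []" "w \<in> F \<Longrightarrow> winv w \<cdot> w = []"
  using r_inv l_inv by force+

lemma mul_eq_Nil: "u \<in> F \<Longrightarrow> v \<in> F \<Longrightarrow> u \<cdot> v = [] \<longleftrightarrow> v = winv u"
  using inv_equality[of u v] by (auto simp del: winv_simps simp: winv_simps(4))

text \<open>\<open>s\<close> is the part that cancels; as \<open>p @ q\<close> is again reduced, the
  cancellation is complete.\<close>

lemma mul_cancel:
  "u \<in> F \<Longrightarrow> v \<in> F \<Longrightarrow> \<exists>p s q. u = p @ s \<and> v = winv s @ q \<and> u \<cdot> v = p @ q \<and> p @ q \<in> F"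
proof (induction u arbitrary: v rule: rev_induct)
  case Nil
  then show ?case by (intro exI[of _ "[]"] exI[of _ v]) simp
next
  case (snoc x u)
  show ?case
  proof (cases "v \<noteq> [] \<and> hd v = letter_inv x")
    case True
    then obtain v' where v: "v = letter_inv x # v'" by (cases v) auto
    have F: "u \<in> F" "v' \<in> F" using snoc.prems v append_F[of "[letter_inv x]" v'] append_F[of u] by auto
    then obtain p s q where "u = p @ s" "v' = winv s @ q" "u \<cdot> v' = p @ q" "p @ q \<in> F"
      using snoc.IH by blast
    moreover have "(u @ [x]) \<cdot> v = u \<cdot> v'"
      using reduce_cancel'[of u "[x]" v'] v by (simp add: mul_def)
    ultimately show ?thesis using v by (intro exI[of _ p] exI[of _ "s @ [x]"] exI[of _ q]) simp
  next
    case False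
    then have "(u @ [x]) @ v \<in> F" using snoc.prems by (subst append_F) auto
    then show ?thesis by (intro exI[of _ "u @ [x]"] exI[of _ "[]"] exI[of _ v]) (simp add: mul_append)
  qed
qed

lemma mul_letter:
  assumes "g \<in> F" "snd y \<in> B"
  shows "g \<cdot> [y] = (if g \<noteq> [] \<and> last g = letter_inv y then butlast g else g @ [y])"
proof (cases "g \<noteq> [] \<and> last g = letter_inv y")
  case True
  then obtain u where u: "g = u @ [letter_inv y]" by (metis append_butlast_last_id)
  then show ?thesis using reduce_cancel_letter[of u y "[]"] assms append_F[of u "[letter_inv y]"]
    by (simp add: mul_def mem_F reduce_eq_self)
next
  case False
  then have "g @ [y] \<in> F" using assms by (subst append_F) auto
  then show ?thesis using False by (auto simp: mul_append)
qed

text \<open>In a power only the inner pieces \<open>winv u @ u\<close> cancel, because the core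
  \<open>v\<close> is cyclically reduced. Hence positive powers keep the first letter of
  \<open>w\<close> and grow in length.\<close>

lemma pow_word:
  assumes "w \<in> F" "w \<noteq> []"
  obtains u v where "w = u @ v @ winv u" "v \<noteq> []" "cyclically_reduced v"
    "\<And>n. n > 0 \<Longrightarrow> w ^^^ n = u @ concat (replicate n v) @ winv u"
proof -
  obtain u v where w: "w = u @ v @ winv u" "v \<noteq> []" "cyclically_reduced v"
    using cyclically_reduced_decomp[of w] assms by (auto simp: mem_F)
  have "w ^^^ n = u @ concat (replicate n v) @ winv u" if "n > 0" for n
    using that
  proof (induction n)
    case (Suc n)
    show ?case
    proof (cases "n = 0")
      case False
      have "w ^^^ Suc n = reduce ((u @ concat (replicate n v)) @ winv u @ u @ (v @ winv u))"
        using Suc False w(1) by (simp add: mul_def)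
      also have "\<dots> = reduce (u @ (concat (replicate n v) @ v) @ winv u)"
        by (subst reduce_cancel) simp
      also have "concat (replicate n v) @ v = concat (replicate (Suc n) v)"
        by (metis concat_append concat.simps append_Nil2 replicate_append_same replicate_Suc)
      also have "reduce (u @ concat (replicate (Suc n) v) @ winv u) = u @ concat (replicate (Suc n) v) @ winv u"
      proof (rule reduce_eq_self)
        have "reduced (u @ v @ winv u)" using assms w by (simp add: mem_F)
        then show "reduced (u @ concat (replicate (Suc n) v) @ winv u)"
          using w hd_last_concat_replicate[of v "Suc n"] reduced_concat_replicate[of v "Suc n"]
          by (auto simp: reduced_append simp del: replicate_Suc)
      qed
      finally show ?thesis .
    qed (use w assms in simp)
  qed simp
  then show thesis using that w by blast
qed

lemma hd_pow: "w \<in> F \<Longrightarrow> w \<noteq> [] \<Longrightarrow> n > 0 \<Longrightarrow> hd (w ^^^ n) = hd w"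
  by (rule pow_word[of w]) (auto simp: hd_append hd_last_concat_replicate)

lemma length_pow: "w \<in> F \<Longrightarrow> w \<noteq> [] \<Longrightarrow> n \<le> length (w ^^^ n)"
proof (cases "n = 0")
  case False
  assume w: "w \<in> F" "w \<noteq> []"
  obtain u v where "v \<noteq> []" "w ^^^ n = u @ concat (replicate n v) @ winv u"
    by (rule pow_word[OF w]) (use False in auto)
  moreover have "n \<le> length (concat (replicate n v))" if "v \<noteq> []" for v :: "'b word"
    using that by (induction n) (auto simp: Suc_le_eq intro: le_trans add_mono simp flip: length_greater_0_conv)
  ultimately show ?thesis by (simp add: trans_le_add1 trans_le_add2)
qed simp

end

sublocale free_grp \<subseteq> torsion_free_group "free_group B"
proof
  fix x :: "'b word" and n :: nat
  assume "x \<in> F" "x \<noteq> \<one>\<^bsub>free_group B\<^esub>" "n > 0"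
  then show "x ^^^ n \<noteq> \<one>\<^bsub>free_group B\<^esub>" using length_pow[of x n] by auto
qed

context free_grp
begin

section \<open>Half-spaces of the Cayley tree\<close>

definition hdset :: "'b letter set \<Rightarrow> 'b word set" where
  "hdset A = {w\<in>F. w \<noteq> [] \<and> hd w \<in> A}"

lemma tends_hdset: "l \<in> F \<Longrightarrow> l \<noteq> [] \<Longrightarrow> tends (hdset A) l \<longleftrightarrow> hd l \<in> A"
proof -
  assume l: "l \<in> F" "l \<noteq> []"
  have *: "l ^^^ n \<in> hdset A \<longleftrightarrow> hd l \<in> A" if "n > 0" for n
    using that l hd_pow[OF l that] length_pow[OF l, of n] by (auto simp: hdset_def)
  have "\<forall>\<^sub>F n in sequentially. l ^^^ n \<in> hdset A \<longleftrightarrow> hd l \<in> A"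
    by (rule eventually_sequentiallyI[of 1]) (use * in simp)
  then have "tends (hdset A) l \<longleftrightarrow> (\<forall>\<^sub>F n in sequentially. hd l \<in> A)"
    unfolding tends_def by (rule eventually_cong) simp
  then show ?thesis by simp
qed

text \<open>Right multiplication by a letter acts at the far end of a reduced word. Membership
  therefore changes only across the edges that join the identity to the letters of
  \<open>A\<close>.\<close>

lemma hdset_coboundary:
  assumes "g \<in> F" "snd y \<in> B"
  shows "(g \<in> hdset A) \<noteq> (g \<cdot> [y] \<in> hdset A) \<longleftrightarrow> g = [] \<and> y \<in> A \<or> g = [letter_inv y] \<and> letter_inv y \<in> A"
proof -
  have F: "g \<cdot> [y] \<in> F" using assms by simp
  show ?thesis
  proof (cases "g = []")
    case True
    then show ?thesis using assms by (auto simp: hdset_def)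
  next
    case False
    then obtain x t where g: "g = x # t" by (cases g) auto
    show ?thesis
    proof (cases "t = []")
      case True
      then show ?thesis using assms g F by (auto simp: hdset_def mul_letter)
    next
      case tne: False
      then have "g \<cdot> [y] \<noteq> [] \<and> hd (g \<cdot> [y]) = x" using assms g by (auto simp: mul_letter)
      then show ?thesis using assms g F tne by (auto simp: hdset_def)
    qed
  qed
qed

lemma almost_invariant_by_letters:
  assumes "\<And>y. snd y \<in> B \<Longrightarrow> finite {g\<in>F. (g \<in> Q) \<noteq> (g \<cdot> [y] \<in> Q)}"
  shows "almost_invariant Q"
  unfolding almost_invariant_def
proof
  fix k assume "k \<in> F"
  then show "finite {g\<in>F. (g \<in> Q) \<noteq> (g \<cdot> k \<in> Q)}"
  proof (induction k)
    case Nil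
    then show ?case by (auto intro: finite_subset[of _ "{}"])
  next
    case (Cons y k)
    have F: "k \<in> F" "snd y \<in> B" using Cons.prems append_F[of "[y]" k] by auto
    let ?D = "{g\<in>F. (g \<in> Q) \<noteq> (g \<cdot> k \<in> Q)}"
    have k: "g \<cdot> (y # k) = g \<cdot> [y] \<cdot> k" if "g \<in> F" for g
      using that F mul_append[of "[y]" k] Cons.prems by (simp add: m_assoc)
    have "{g\<in>F. (g \<in> Q) \<noteq> (g \<cdot> (y # k) \<in> Q)} \<subseteq> {g\<in>F. (g \<in> Q) \<noteq> (g \<cdot> [y] \<in> Q)} \<union> (\<lambda>h. h \<cdot> winv [y]) ` ?D"
    proof
      fix g assume g: "g \<in> {g\<in>F. (g \<in> Q) \<noteq> (g \<cdot> (y # k) \<in> Q)}"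
      show "g \<in> {g\<in>F. (g \<in> Q) \<noteq> (g \<cdot> [y] \<in> Q)} \<union> (\<lambda>h. h \<cdot> winv [y]) ` ?D"
      proof (cases "(g \<in> Q) \<noteq> (g \<cdot> [y] \<in> Q)")
        case False
        then have "g \<cdot> [y] \<in> ?D" using g k F by auto
        moreover have "g = g \<cdot> [y] \<cdot> winv [y]" using g F mul_winv(1)[of "[y]"] by (simp add: m_assoc del: winv_simps)
        ultimately show ?thesis by blast
      qed (use g in auto)
    qed
    then show ?case using assms[OF F(2)] Cons.IH[OF F(1)] by (meson finite_Un finite_imageI finite_subset)
  qed
qed

lemma almost_invariant_hdset [simp]: "almost_invariant (hdset A)"
proof (rule almost_invariant_by_letters)
  fix y :: "'b letter" assume "snd y \<in> B"
  then have "{g\<in>F. (g \<in> hdset A) \<noteq> (g \<cdot> [y] \<in> hdset A)} \<subseteq> {[], [letter_inv y]}"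
    using hdset_coboundary by blast
  then show "finite {g\<in>F. (g \<in> hdset A) \<noteq> (g \<cdot> [y] \<in> hdset A)}" by (rule finite_subset) simp
qed

text \<open>Connectedness of the Cayley graph: membership is followed from the identity along the
  letters of \<open>g\<close>, knowing where it changes.\<close>

lemma eq_on_F_by_letters:
  assumes "[] \<in> P \<longleftrightarrow> [] \<in> Q"
    and "\<And>g y. g \<in> F \<Longrightarrow> snd y \<in> B \<Longrightarrow> ((g \<in> P) \<noteq> (g \<cdot> [y] \<in> P)) \<longleftrightarrow> ((g \<in> Q) \<noteq> (g \<cdot> [y] \<in> Q))"
  shows "g \<in> F \<Longrightarrow> g \<in> P \<longleftrightarrow> g \<in> Q"
proof (induction g rule: rev_induct)
  case (snoc y g)
  have "g \<in> F" "snd y \<in> B" "g \<cdot> [y] = g @ [y]" using snoc.prems append_F[of g "[y]"] mul_append by auto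
  then show ?case using snoc.IH assms(2)[of g y] by auto
qed (use assms in simp)


section \<open>Edges of the core graph as cut cosets\<close>

lemma Cons_F: "x # w \<in> F \<longleftrightarrow> snd x \<in> B \<and> w \<in> F \<and> (w \<noteq> [] \<longrightarrow> hd w \<noteq> letter_inv x)"
  using append_F[of "[x]" w] by auto

lemma fg_subgroup_subgroup: "fg_subgroup B H \<Longrightarrow> subgroup H (free_group B)"
  by (simp add: fg_subgroup_def)

lemma fg_subgroup_finite_cuts: "fg_subgroup B H \<Longrightarrow> almost_invariant Q \<Longrightarrow> finite (cuts Q H)"
  unfolding fg_subgroup_def using finite_cuts by blast

lemma conjg_F [simp]: "g \<in> F \<Longrightarrow> H \<subseteq> F \<Longrightarrow> conjg g ` H \<subseteq> F"
  by auto

lemma crosses_hdset: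
  assumes "L \<subseteq> F"
  shows "crosses (hdset A) L \<longleftrightarrow> (\<exists>l\<in>L - {[]}. \<exists>m\<in>L - {[]}. hd l \<in> A \<and> hd m \<notin> A)"
proof -
  have "tends (hdset A) l \<longleftrightarrow> hd l \<in> A" if "l \<in> L - {[]}" for l using tends_hdset that assms by blast
  then show ?thesis unfolding crosses_def by simp
qed

text \<open>Either \<open>l\<close> itself is cyclically reduced, or \<open>winv m\<close> is and
  starts like \<open>l\<close>, or \<open>l\<close> and \<open>m\<close> join without cancellation
  and \<open>l @ m\<close> is. A vertex with two loop directions thus lies on an immersed closed
  path through a prescribed one of them.\<close>

lemma cyclically_reduced_of_heads:
  assumes L: "subgroup L (free_group B)" and lm: "l \<in> L" "m \<in> L" "l \<noteq> []" "m \<noteq> []" "hd m \<noteq> hd l"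
  shows "\<exists>w\<in>L. w \<noteq> [] \<and> cyclically_reduced w \<and> hd w = hd l"
proof -
  have F: "l \<in> F" "m \<in> F" using L lm subgroup.mem_carrier by metis+
  consider "last l \<noteq> letter_inv (hd l)" | "last m = letter_inv (hd l)"
    | "last l = letter_inv (hd l)" "last m \<noteq> letter_inv (hd l)" by blast
  then show ?thesis
  proof cases
    case 1
    then show ?thesis using lm F by (auto simp: cyclically_reduced_def mem_F)
  next
    case 2
    have "winv m \<in> L" using subgroup.m_inv_closed[OF L lm(2)] F by simp
    then show ?thesis using lm F 2 by (intro bexI[of _ "winv m"]) (auto simp: cyclically_reduced_def mem_F)
  next
    case 3
    have lmF: "l @ m \<in> F" using F lm 3 by (subst append_F) auto
    then have "l @ m \<in> L" using subgroup.m_closed[OF L lm(1,2)] by (simp add: mul_append)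
    then show ?thesis using lm 3 lmF by (intro bexI[of _ "l @ m"]) (auto simp: cyclically_reduced_def mem_F)
  qed
qed

lemma cyclically_reduced_rotate:
  assumes "cyclically_reduced (u @ v)" shows "cyclically_reduced (v @ u)"
proof -
  have *: "x = letter_inv y \<longleftrightarrow> y = letter_inv x" for x y :: "'b letter" by (metis letter_inv_inv)
  show ?thesis
    using assms * by (cases "u = []"; cases "v = []") (auto simp: cyclically_reduced_def reduced_append)
qed

text \<open>Of an immersed loop through the edge and its inverse, both read from the source, exactly
  one starts with \<open>b\<close>, so the half-space is crossed. Conversely, two distinct first
  letters at the source produce such a loop.\<close>

lemma core_edges_eq_cuts:
  assumes H: "subgroup H (free_group B)" and b: "b \<in> B"
  shows "{C. (C, b) \<in> core_edges B H} = cuts (hdset {(True, b)}) H"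
proof (intro equalityI subsetI)
  fix C assume "C \<in> cuts (hdset {(True, b)}) H"
  then obtain g where g: "g \<in> F" "C = H #>\<^bsub>free_group B\<^esub> g" "crosses (hdset {(True, b)}) (conjg g ` H)"
    by (auto simp: cuts_def)
  have L: "subgroup (conjg g ` H) (free_group B)" using conjg_subgroup g H by blast
  obtain l m where "l \<in> conjg g ` H" "m \<in> conjg g ` H" "l \<noteq> []" "m \<noteq> []" "hd l = (True, b)" "hd m \<noteq> (True, b)"
    using g(3) crosses_hdset[OF subgroup.subset[OF L]] by auto
  then obtain w where w: "w \<in> conjg g ` H" "w \<noteq> []" "cyclically_reduced w" "hd w = (True, b)"
    using cyclically_reduced_of_heads[OF L] by metis
  then obtain h where h: "h \<in> H" "w = conjg g h" by blast
  have hF: "h \<in> F" "w \<in> F" using h H g subgroup.mem_carrier by fastforce+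
  have "g \<cdot> w \<cdot> ginv g = h" using h hF g by (simp add: conjg_def m_assoc del: ginv_eq)
  moreover have "w ! 0 = (True, b)" "g \<cdot> take 0 w = g" "0 < length w" using w g by (auto simp: hd_conv_nth)
  ultimately show "C \<in> {C. (C, b) \<in> core_edges B H}"
    unfolding core_edges_def mem_Collect_eq prod.case using b g hF h w
    by (intro conjI exI[of _ g] exI[of _ w] exI[of _ "0::nat"] disjI1) simp_all
next
  fix C assume "C \<in> {C. (C, b) \<in> core_edges B H}"
  then obtain g w i where gw: "g \<in> F" "w \<in> F" "w \<noteq> []" "cyclically_reduced w" "g \<cdot> w \<cdot> ginv g \<in> H" "i < length w"
    "w ! i = (True, b) \<and> C = H #>\<^bsub>free_group B\<^esub> (g \<cdot> take i w) \<or>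
     w ! i = (False, b) \<and> C = H #>\<^bsub>free_group B\<^esub> (g \<cdot> take (Suc i) w)"
    unfolding core_edges_def by auto
  \<comment> \<open>Moving the base point along the first \<open>j\<close> letters rotates the
    loop.\<close>
  have rot: "drop j w @ take j w \<in> conjg (g \<cdot> take j w) ` H \<and> cyclically_reduced (drop j w @ take j w) \<and> g \<cdot> take j w \<in> F" for j
  proof -
    have F: "take j w \<in> F" "drop j w \<in> F" using gw(2) append_F[of "take j w" "drop j w"] by simp_all
    have cyc: "cyclically_reduced (drop j w @ take j w)" using cyclically_reduced_rotate[of "take j w" "drop j w"] gw by simp
    then have F': "drop j w @ take j w \<in> F" using F by (auto simp: mem_F cyclically_reduced_def)
    have wj: "w = take j w \<cdot> drop j w" using gw(2) mul_append[of "take j w" "drop j w"] by simp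
    have "conjg (g \<cdot> take j w) (g \<cdot> w \<cdot> ginv g) = ginv (take j w) \<cdot> (take j w \<cdot> drop j w) \<cdot> take j w"
      using gw F by (subst (2) wj) (simp add: conjg_def m_assoc inv_mult_group del: ginv_eq)
    also have "\<dots> = drop j w @ take j w" using F F' by (simp add: mul_append m_assoc del: ginv_eq)
    finally show ?thesis using gw cyc F by (metis image_eqI m_closed)
  qed
  have cr: "crosses (hdset {(True, b)}) (conjg k ` H)" if "k \<in> F" "l \<in> conjg k ` H" "l \<noteq> []" "hd l \<noteq> letter_inv (last l)"
    "hd l = (True, b) \<or> last l = (False, b)" for k l
  proof -
    have L: "subgroup (conjg k ` H) (free_group B)" using conjg_subgroup that H by blast
    have "l \<in> F" using that L subgroup.mem_carrier by metis
    then have "winv l \<in> conjg k ` H" using subgroup.m_inv_closed[OF L that(2)] by simp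
    moreover have "letter_inv (False, b) = (True, b)" "letter_inv (True, b) = (False, b)" by (simp_all add: letter_inv_def)
    moreover have "l \<in> conjg k ` H - {[]}" "winv l \<in> conjg k ` H - {[]}" "hd (winv l) = letter_inv (last l)"
      using that \<open>winv l \<in> conjg k ` H\<close> by auto
    ultimately show ?thesis unfolding crosses_hdset[OF subgroup.subset[OF L]] using that(4,5) by (metis singleton_iff)
  qed
  have ne: "hd l \<noteq> letter_inv (last l)" if "cyclically_reduced l" "l \<noteq> []" for l :: "'b word"
    using that by (auto simp: cyclically_reduced_def)
  from gw(7) show "C \<in> cuts (hdset {(True, b)}) H"
  proof
    assume c: "w ! i = (True, b) \<and> C = H #>\<^bsub>free_group B\<^esub> (g \<cdot> take i w)"
    have "hd (drop i w @ take i w) = (True, b)" using c gw(6) by (simp add: hd_drop_conv_nth)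
    moreover have "drop i w @ take i w \<noteq> []" using gw(6) by simp
    ultimately have "crosses (hdset {(True, b)}) (conjg (g \<cdot> take i w) ` H)" using rot[of i] cr ne by blast
    then show ?thesis using c coset_in_cuts_iff[OF H] rot[of i] by blast
  next
    \<comment> \<open>The edge is traversed backwards, so its source is reached only after letter
      \<open>i\<close>; hence the rotation by \<open>Suc i\<close>, which puts \<open>b^-1\<close>
      last.\<close>
    assume c: "w ! i = (False, b) \<and> C = H #>\<^bsub>free_group B\<^esub> (g \<cdot> take (Suc i) w)"
    have "last (drop (Suc i) w @ take (Suc i) w) = (False, b)" using c gw(6) by (simp add: take_Suc_conv_app_nth)
    moreover have "drop (Suc i) w @ take (Suc i) w \<noteq> []" using gw(6) by auto
    ultimately have "crosses (hdset {(True, b)}) (conjg (g \<cdot> take (Suc i) w) ` H)" using rot[of "Suc i"] cr ne by blast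
    then show ?thesis using c coset_in_cuts_iff[OF H] rot[of "Suc i"] by blast
  qed
qed

lemma mem_core_edges_iff:
  assumes "subgroup H (free_group B)"
  shows "(C, b) \<in> core_edges B H \<longleftrightarrow> b \<in> B \<and> C \<in> cuts (hdset {(True, b)}) H"
proof (cases "b \<in> B")
  case True
  then show ?thesis using core_edges_eq_cuts[OF assms True] by blast
qed (auto simp: core_edges_def)

section \<open>Cut numbers of sequences of subgroups\<close>

definition fg_list :: "'b word set list \<Rightarrow> bool" where
  "fg_list Hs \<longleftrightarrow> (\<forall>H\<in>set Hs. fg_subgroup B H)"

lemma fg_list_nth: "fg_list Hs \<Longrightarrow> i < length Hs \<Longrightarrow> fg_subgroup B (Hs ! i)"
  by (simp add: fg_list_def)

definition cut :: "'b word set list \<Rightarrow> 'b word set \<Rightarrow> nat" where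
  "cut Hs Q = (\<Sum>i<length Hs. card (cuts Q (Hs ! i)))"

lemma n_count_eq_cut: "fg_list Hs \<Longrightarrow> b \<in> B \<Longrightarrow> n_count B Hs b = cut Hs (hdset {(True, b)})"
  unfolding n_count_def cut_def
  by (intro sum.cong refl) (simp add: core_edges_eq_cuts fg_list_nth fg_subgroup_subgroup)

lemma complexity_eq_cut:
  assumes "finite B" "fg_list Hs"
  shows "complexity B Hs = (\<Sum>b\<in>B. cut Hs (hdset {(True, b)}))"
proof -
  have "card (core_edges B H) = (\<Sum>b\<in>B. card (cuts (hdset {(True, b)}) H))" if H: "fg_subgroup B H" for H
  proof -
    have s: "subgroup H (free_group B)" using H by (rule fg_subgroup_subgroup)
    have "core_edges B H = (\<lambda>(b, C). (C, b)) ` (SIGMA b:B. cuts (hdset {(True, b)}) H)"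
      using mem_core_edges_iff[OF s] by force
    moreover have "inj_on (\<lambda>(b, C). (C, b)) (SIGMA b:B. cuts (hdset {(True, b)}) H)" by (auto simp: inj_on_def)
    ultimately have "card (core_edges B H) = card (SIGMA b:B. cuts (hdset {(True, b)}) H)"
      by (simp add: card_image)
    also have "\<dots> = (\<Sum>b\<in>B. card (cuts (hdset {(True, b)}) H))"
      by (rule card_SigmaI) (use assms fg_subgroup_finite_cuts[OF H] in auto)
    finally show ?thesis .
  qed
  then have "complexity B Hs = (\<Sum>i<length Hs. \<Sum>b\<in>B. card (cuts (hdset {(True, b)}) (Hs ! i)))"
    unfolding complexity_def using assms by (intro sum.cong) (auto simp: fg_list_nth)
  then show ?thesis unfolding cut_def by (subst sum.swap) simp
qed

lemma cut_Compl: "fg_list Hs \<Longrightarrow> almost_invariant Q \<Longrightarrow> cut Hs (- Q) = cut Hs Q"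
  unfolding cut_def by (intro sum.cong refl) (simp add: cuts_Compl fg_list_nth fg_subgroup_subgroup)

lemma cut_translate: "fg_list Hs \<Longrightarrow> almost_invariant Q \<Longrightarrow> x \<in> F \<Longrightarrow> cut Hs (translate x Q) = cut Hs Q"
  unfolding cut_def by (intro sum.cong refl) (simp add: card_cuts_translate fg_list_nth fg_subgroup_subgroup)

lemma cut_cong_finite: "fg_list Hs \<Longrightarrow> finite {g\<in>F. (g \<in> P) \<noteq> (g \<in> Q)} \<Longrightarrow> cut Hs P = cut Hs Q"
  unfolding cut_def
  by (intro sum.cong refl arg_cong[of _ _ card] cuts_cong_finite) (auto intro: fg_list_nth fg_subgroup_subgroup)

lemma cut_cong: "fg_list Hs \<Longrightarrow> (\<And>g. g \<in> F \<Longrightarrow> g \<in> P \<longleftrightarrow> g \<in> Q) \<Longrightarrow> cut Hs P = cut Hs Q"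
  by (rule cut_cong_finite) (auto intro: finite_subset[of _ "{}"])

lemma cut_submodular:
  assumes "fg_list Hs" "almost_invariant P" "almost_invariant Q"
  shows "cut Hs (P \<inter> Q) + cut Hs (P \<union> Q) \<le> cut Hs P + cut Hs Q"
  unfolding cut_def sum.distrib[symmetric]
  by (intro sum_mono card_cuts_submodular)
    (use assms fg_list_nth[OF assms(1)] fg_subgroup_subgroup fg_subgroup_finite_cuts in auto)

lemma length_act [simp]: "length (act \<alpha> Hs) = length Hs"
  by (simp add: act_def)

lemma cut_act:
  assumes "fg_list Hs" "\<alpha> \<in> aut B" shows "cut (act \<alpha> Hs) Q = cut Hs (\<alpha> -` Q)"
proof -
  have "\<alpha> \<in> iso (free_group B) (free_group B)" using assms by (simp add: aut_def)
  then show ?thesis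
    unfolding cut_def using assms
    by (intro sum.cong) (auto simp: act_def card_cuts_iso_image fg_list_nth fg_subgroup_subgroup)
qed

lemma mul_letter_left:
  assumes "g \<in> F" "snd y \<in> B"
  shows "[y] \<cdot> g = (if g \<noteq> [] \<and> hd g = letter_inv y then tl g else y # g)"
proof (cases "g \<noteq> [] \<and> hd g = letter_inv y")
  case True
  then obtain u where u: "g = letter_inv y # u" by (cases g) auto
  then show ?thesis using reduce_cancel'[of "[]" "[y]" u] assms append_F[of "[letter_inv y]" u]
    by (simp add: mul_def mem_F reduce_eq_self)
next
  case False
  then have "[y] @ g \<in> F" using assms by (subst append_F) auto
  then show ?thesis using False mul_append[of "[y]" g] by auto
qed

text \<open>The edge labelled \<open>z\<close> at the identity, seen from its other end, bounds the
  complementary half-space. Edges can therefore be counted from either end.\<close>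

lemma translate_hdset_letter_inv:
  assumes g: "g \<in> F" and z: "snd z \<in> B"
  shows "g \<in> translate [z] (hdset {letter_inv z}) \<longleftrightarrow> g \<notin> hdset {z}"
proof -
  have "[letter_inv z] \<cdot> g \<in> hdset {letter_inv z} \<longleftrightarrow> g \<notin> hdset {z}"
  proof (cases "g \<noteq> [] \<and> hd g = z")
    case True
    then obtain u where u: "g = z # u" by (cases g) auto
    then show ?thesis using g z append_F[of "[z]" u] mul_letter_left[of g "letter_inv z"]
      by (auto simp: hdset_def)
  next
    case False
    then have "letter_inv z # g \<in> F" using g z append_F[of "[letter_inv z]" g] by auto
    then show ?thesis using g z False mul_letter_left[of g "letter_inv z"] by (auto simp: hdset_def)
  qed
  then show ?thesis using g z by (simp add: translate_def)
qed

lemma cut_hdset_letter_inv: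
  assumes "fg_list Hs" "snd z \<in> B"
  shows "cut Hs (hdset {letter_inv z}) = cut Hs (hdset {z})"
proof -
  have "cut Hs (hdset {letter_inv z}) = cut Hs (translate [z] (hdset {letter_inv z}))"
    using assms by (simp add: cut_translate)
  also have "\<dots> = cut Hs (- hdset {z})"
    by (rule cut_cong[OF assms(1)]) (simp add: translate_hdset_letter_inv assms(2))
  finally show ?thesis using assms by (simp add: cut_Compl)
qed

section \<open>Axes of conjugates of letters\<close>

lemma conjg_Nil [simp]: "x \<in> F \<Longrightarrow> conjg [] x = x"
  using conjg_one by simp

lemma conjg_letter:
  "g \<in> F \<Longrightarrow> snd z \<in> B \<Longrightarrow> conjg g [z] = [z] \<or> (\<exists>u. u \<noteq> [] \<and> conjg g [z] = u @ [z] @ winv u)"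
proof (induction g)
  case (Cons y g)
  have F: "snd y \<in> B" "g \<in> F" "[y] \<cdot> g = y # g"
    using Cons.prems append_F[of "[y]" g] mul_append[of "[y]" g] by auto
  show ?case
  proof (cases "snd y = snd z")
    case True
    moreover have "[z, z] \<in> F" using Cons.prems by (simp add: mem_F)
    ultimately have "conjg [y] [z] = [z]"
      using F Cons.prems(2) by (auto simp: snd_eq_iff_letter conjg_def mul_letter mul_letter_left)
    then have "conjg (y # g) [z] = conjg g [z]" using conjg_conjg[of "[y]" g "[z]"] F Cons.prems by simp
    then show ?thesis using Cons.IH F Cons.prems by simp
  next
    case False
    then have "hd ([z] @ (y # g)) \<noteq> letter_inv (last (winv (y # g)))" "y \<noteq> letter_inv z"
      by (auto simp del: winv_simps(3))
    then have zg: "[z] @ (y # g) \<in> F" and f: "winv (y # g) @ [z] @ (y # g) \<in> F" using Cons.prems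
      by (auto simp: append_F Cons_F simp del: winv_simps(3))
    have "conjg (y # g) [z] = winv (y # g) \<cdot> ([z] \<cdot> (y # g))"
      unfolding conjg_def using Cons.prems by (simp add: m_assoc del: winv_simps(3))
    also have "\<dots> = winv (y # g) @ [z] @ (y # g)" using mul_append[OF zg] mul_append[OF f] by simp
    finally show ?thesis by (intro disjI2 exI[of _ "winv (y # g)"]) (simp del: winv_simps(3) add: winv_simps(4))
  qed
qed simp

lemma conjg_letter_inv: "g \<in> F \<Longrightarrow> snd z \<in> B \<Longrightarrow> conjg g [letter_inv z] = winv (conjg g [z])"
  using conjg_inv[of g "[z]"] by simp

text \<open>If the conjugate is a reduced word \<open>u z u^-1\<close> with \<open>u\<close>
  nonempty, both of its ends begin with the first letter of \<open>u\<close>. Only the axis through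
  the identity spelled by powers of \<open>z\<close> can be separated.\<close>

lemma axis_hdset:
  assumes g: "g \<in> F" and z: "snd z \<in> B"
    and t: "tends (hdset A) (conjg g [z]) \<noteq> tends (hdset A) (conjg g [letter_inv z])"
  shows "conjg g [z] = [z] \<and> conjg g [letter_inv z] = [letter_inv z] \<and> (z \<in> A) \<noteq> (letter_inv z \<in> A)"
  using conjg_letter[OF g z]
proof
  assume c: "conjg g [z] = [z]"
  then show ?thesis using t z by (simp add: conjg_letter_inv g tends_hdset)
next
  assume "\<exists>u. u \<noteq> [] \<and> conjg g [z] = u @ [z] @ winv u"
  then obtain u where u: "u \<noteq> []" "conjg g [z] = u @ [z] @ winv u" by blast
  have "conjg g [z] \<in> F" using g z by simp
  then have "u @ [z] @ winv u \<in> F" "winv (u @ [z] @ winv u) \<in> F" unfolding u(2) winv_F by simp_all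
  then have "tends (hdset A) (conjg g [z]) \<longleftrightarrow> hd u \<in> A"
    "tends (hdset A) (winv (conjg g [z])) \<longleftrightarrow> hd u \<in> A"
    using u tends_hdset[of "u @ [z] @ winv u"] tends_hdset[of "winv (u @ [z] @ winv u)"] by auto
  then show ?thesis using t conjg_letter_inv[OF g z] by simp
qed

lemma mem_translate_hdset:
  assumes "p \<in> F" "\<And>x. x \<in> A \<Longrightarrow> p \<noteq> [] \<Longrightarrow> x \<noteq> letter_inv (last p)"
  shows "w \<in> translate p (hdset A) \<longleftrightarrow> w \<in> F \<and> (\<exists>x\<in>A. \<exists>v. w = p @ x # v)"
proof
  assume w: "w \<in> translate p (hdset A)"
  then have wF: "w \<in> F" and h: "winv p \<cdot> w \<in> hdset A" using assms by (simp_all add: translate_def)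
  then obtain x v where xv: "winv p \<cdot> w = x # v" "x \<in> A" by (auto simp: hdset_def neq_Nil_conv)
  have xvF: "x # v \<in> F" using h xv by (simp add: hdset_def)
  have "w = p \<cdot> (x # v)" using inv_cancel_left(2)[of p w] assms(1) wF xv by simp
  moreover have "p @ x # v \<in> F" using assms xv xvF append_F[of p "x # v"] by auto
  ultimately show "w \<in> F \<and> (\<exists>x\<in>A. \<exists>v. w = p @ x # v)" using xv(2) mul_append[of p "x # v"] by auto
next
  assume "w \<in> F \<and> (\<exists>x\<in>A. \<exists>v. w = p @ x # v)"
  then obtain x v where w: "w \<in> F" "x \<in> A" "w = p @ x # v" by blast
  then have "x # v \<in> F" using append_F[of p "x # v"] by simp
  moreover have "winv p \<cdot> w = x # v"
    using w mul_append[of p "x # v"] inv_cancel_left(1)[of p "x # v"] assms(1) \<open>x # v \<in> F\<close> by simp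
  ultimately show "w \<in> translate p (hdset A)" using w assms by (simp add: translate_def hdset_def)
qed

end

section \<open>Local minima of the cut function are global\<close>

text \<open>The determinant is a unit, so some term of its Leibniz expansion is nonzero;
  \<open>\<sigma>\<close> is the permutation of that term.\<close>

lemma invertible_matrix_transversal:
  fixes M N :: "'a \<Rightarrow> 'a \<Rightarrow> int"
  assumes "finite S" and inv: "\<And>a c. a \<in> S \<Longrightarrow> c \<in> S \<Longrightarrow> (\<Sum>b\<in>S. M a b * N b c) = (if a = c then 1 else 0)"
  obtains \<sigma> where "bij_betw \<sigma> S S" "\<And>a. a \<in> S \<Longrightarrow> M a (\<sigma> a) \<noteq> 0"
proof -
  define n where "n = card S"
  obtain e where e: "bij_betw e {0..<n} S" using ex_bij_betw_nat_finite[OF assms(1)] n_def by blast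
  define A where "A = mat n n (\<lambda>(i, j). M (e i) (e j))"
  define C where "C = mat n n (\<lambda>(i, j). N (e i) (e j))"
  have eS: "e i \<in> S" if "i < n" for i using e that by (auto simp: bij_betw_def)
  have AC: "A * C = 1\<^sub>m n"
  proof (rule eq_matI)
    fix i j assume ij: "i < dim_row (1\<^sub>m n)" "j < dim_col (1\<^sub>m n)"
    then have "(A * C) $$ (i, j) = (\<Sum>k = 0..<n. M (e i) (e k) * N (e k) (e j))"
      by (simp add: A_def C_def scalar_prod_def)
    also have "\<dots> = (\<Sum>b\<in>S. M (e i) b * N b (e j))"
      using sum.reindex_bij_betw[OF e, of "\<lambda>b. M (e i) b * N b (e j)"] by simp
    also have "\<dots> = (if e i = e j then 1 else 0)" using inv eS ij by simp
    also have "e i = e j \<longleftrightarrow> i = j" using e ij by (auto simp: bij_betw_def inj_on_def)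
    finally show "(A * C) $$ (i, j) = 1\<^sub>m n $$ (i, j)" using ij by simp
  qed (simp_all add: A_def C_def)
  have carr: "A \<in> carrier_mat n n" "C \<in> carrier_mat n n" by (simp_all add: A_def C_def)
  then have "det A * det C = 1" using det_mult[OF carr] AC by simp
  then have "det A \<noteq> 0" by auto
  then obtain p where p: "p permutes {0..<n}" "signof p * (\<Prod>i = 0..<n. A $$ (i, p i)) \<noteq> 0"
    unfolding det_def'[OF carr(1)] by (elim sum.not_neutral_contains_not_neutral) simp
  have nz: "A $$ (i, p i) \<noteq> 0" if "i < n" for i using p(2) that by auto
  have pb: "bij_betw p {0..<n} {0..<n}" using p(1) by (rule permutes_imp_bij)
  define \<sigma> where "\<sigma> = e \<circ> p \<circ> inv_into {0..<n} e"
  have "bij_betw \<sigma> S S"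
    unfolding \<sigma>_def by (intro bij_betw_trans[OF bij_betw_inv_into[OF e]] bij_betw_trans[OF pb e])
  moreover have "M a (\<sigma> a) \<noteq> 0" if aS: "a \<in> S" for a
  proof -
    obtain i where i: "i < n" "a = e i" using e aS by (force simp: bij_betw_def)
    then have "inv_into {0..<n} e a = i" using e by (simp add: bij_betw_def inv_into_f_f)
    moreover have "p i < n" using pb i by (auto simp: bij_betw_def)
    ultimately show ?thesis using nz[OF i(1)] i by (simp add: \<sigma>_def A_def)
  qed
  ultimately show thesis using that by blast
qed

section \<open>Uncrossing against local minimality\<close>

context free_grp
begin

lemma conjg_eq_Nil [simp]: "g \<in> F \<Longrightarrow> x \<in> F \<Longrightarrow> conjg g x = [] \<longleftrightarrow> x = []"
  using conjg_eq_one by simp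

lemma conjg_same [simp]: "g \<in> F \<Longrightarrow> conjg g g = g"
  by (simp add: conjg_def)

context
  fixes Hs :: "'b word set list"
  assumes fg: "fg_list Hs"
    and local_min: "\<And>A z. snd z \<in> B \<Longrightarrow> z \<in> A \<Longrightarrow> letter_inv z \<notin> A \<Longrightarrow> cut Hs (hdset {z}) \<le> cut Hs (hdset A)"
begin

text \<open>Separation puts exactly one of \<open>z\<close> and its inverse into \<open>A\<close>;
  the two cases agree because an edge has the same count from both ends.\<close>

lemma axis_bound_hdset:
  assumes "g \<in> F" "snd z \<in> B" "tends (hdset A) (conjg g [z]) \<noteq> tends (hdset A) (conjg g [letter_inv z])"
  shows "cut Hs (hdset {z}) \<le> cut Hs (hdset A)"
proof (cases "z \<in> A")
  case True
  then show ?thesis using axis_hdset[OF assms] local_min assms by blast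
next
  case False
  then have "cut Hs (hdset {letter_inv z}) \<le> cut Hs (hdset A)"
    using axis_hdset[OF assms] assms by (intro local_min) auto
  then show ?thesis using fg assms by (simp add: cut_hdset_letter_inv)
qed

lemma axis_bound_translate_hdset:
  assumes "g \<in> F" "p \<in> F" "snd z \<in> B"
    "tends (translate p (hdset A)) (conjg g [z]) \<noteq> tends (translate p (hdset A)) (conjg g [letter_inv z])"
  shows "cut Hs (hdset {z}) \<le> cut Hs (hdset A)"
proof (rule axis_bound_hdset[of "g \<cdot> p"])
  show "tends (hdset A) (conjg (g \<cdot> p) [z]) \<noteq> tends (hdset A) (conjg (g \<cdot> p) [letter_inv z])"
    using assms tends_translate[of "conjg g [z]" "hdset A" p] tends_translate[of "conjg g [letter_inv z]" "hdset A" p]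
    by (simp add: conjg_conjg)
qed (use assms in auto)

text \<open>\<open>K\<close> is a finite prefix-closed set of vertices of the Cayley tree outside of
  which \<open>Q\<close> is constant along outward edges. Uncrossing with the cone \<open>Z\<close>
  at a deepest point \<open>p\<close> of \<open>K\<close> makes \<open>Q\<close> constant on that
  cone and removes \<open>p\<close> from \<open>K\<close>, which drives the induction.\<close>

lemma axis_bound:
  assumes "finite K" "K \<subseteq> F" "\<And>w x. w @ [x] \<in> K \<Longrightarrow> w \<in> K" "almost_invariant Q"
    "\<And>w y. w @ [y] \<in> F \<Longrightarrow> w \<notin> K \<Longrightarrow> w \<in> Q \<longleftrightarrow> w @ [y] \<in> Q"
    "g \<in> F" "snd z \<in> B" "tends Q (conjg g [z]) \<noteq> tends Q (conjg g [letter_inv z])"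
  shows "cut Hs (hdset {z}) \<le> cut Hs Q"
  using assms
proof (induction "card K" arbitrary: K Q g z rule: less_induct)
  case less
  note K = less.prems(1-3) and Q = less.prems(4) and resp = less.prems(5) and g = less.prems(6)
    and z = less.prems(7) and sep = less.prems(8)
  have prefix: "p \<in> K" if "p @ v \<in> K" for p v
    using that by (induction v rule: rev_induct) (auto simp flip: append_assoc dest: K(3))
  have cone: "p @ v \<in> Q \<longleftrightarrow> p \<in> Q" if "p \<notin> K" "p @ v \<in> F" for p v
    using that
  proof (induction v rule: rev_induct)
    case (snoc y v)
    then have "(p @ v) @ [y] \<in> F" "p @ v \<notin> K" "p @ v \<in> F" using prefix append_F[of "p @ v" "[y]"] by auto
    then show ?case using resp[of "p @ v" y] snoc by auto
  qed simp
  let ?e = "conjg g [z]" and ?e' = "conjg g [letter_inv z]"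
  have e: "?e \<in> F" "?e \<noteq> []" "?e' \<in> F" "?e' \<noteq> []" using g z conjg_eq_one[of g] by auto
  show ?case
  proof (cases "K \<subseteq> {[]}")
    case True
    define A where "A = {y. [y] \<in> Q}"
    have "{w\<in>F. (w \<in> Q) \<noteq> (w \<in> hdset A)} \<subseteq> {[]}"
    proof
      fix w assume w: "w \<in> {w\<in>F. (w \<in> Q) \<noteq> (w \<in> hdset A)}"
      show "w \<in> {[]}"
      proof (cases w)
        case (Cons y v)
        have "[y] \<notin> K" using True by auto
        then show ?thesis using cone[of "[y]" v] w Cons by (auto simp: hdset_def A_def)
      qed simp
    qed
    then have fin: "finite {w\<in>F. (w \<in> Q) \<noteq> (w \<in> hdset A)}" using finite_subset by blast
    have "tends (hdset A) ?e \<noteq> tends (hdset A) ?e'"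
      using sep tends_cong_finite[OF _ _ fin] e by simp
    then have "cut Hs (hdset {z}) \<le> cut Hs (hdset A)" using axis_bound_hdset g z by blast
    then show ?thesis using cut_cong_finite[OF fg fin] by simp
  next
    case False
    then have "Max (length ` K) \<in> length ` K" using K(1) by (intro Max_in) auto
    then obtain p where p: "p \<in> K" "length p = Max (length ` K)" by auto
    have pmax: "length w \<le> length p" if "w \<in> K" for w using p(2) that K(1) by simp
    have "p \<noteq> []" using pmax False by force
    then obtain p' x where px: "p = p' @ [x]" by (metis rev_exhaust)
    have F: "p \<in> F" "p' \<in> F" "snd x \<in> B" and p'x: "p' \<noteq> [] \<Longrightarrow> x \<noteq> letter_inv (last p')"
      using p K(2) px append_F[of p' "[x]"] by auto
    \<comment> \<open>The cone of all words through \<open>p\<close>, written as a translated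
      half-space so that its cut number is that of the single letter \<open>x\<close>.\<close>
    define Z where "Z = translate p' (hdset {x})"
    have memZ: "w \<in> Z \<longleftrightarrow> w \<in> F \<and> (\<exists>v. w = p @ v)" for w
      unfolding Z_def using mem_translate_hdset[of p' "{x}" w] F p'x px by auto
    have aiZ: "almost_invariant Z" unfolding Z_def using F by (simp add: almost_invariant_translate)
    have cutZ: "cut Hs Z = cut Hs (hdset {x})" unfolding Z_def using fg F by (simp add: cut_translate)
    \<comment> \<open>The directions at \<open>p\<close>, other than the way back, that lie in
      \<open>Q\<close>. Since \<open>p\<close> is deepest, \<open>Q\<close> inside \<open>Z\<close>
      is decided by the first letter after \<open>p\<close>.\<close>
    define A where "A = {y. y \<noteq> letter_inv x \<and> p @ [y] \<in> Q}"
    define A' where "A' = {y. y \<noteq> letter_inv x \<and> p @ [y] \<notin> Q}"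
    have pyQ: "p @ y # v \<in> Q \<longleftrightarrow> p @ [y] \<in> Q" if "p @ y # v \<in> F" for y v
    proof -
      have "p @ [y] \<notin> K" using pmax[of "p @ [y]"] by auto
      then show ?thesis using cone[of "p @ [y]" v] that by simp
    qed
    have yx: "y \<noteq> letter_inv x" if "p @ y # v \<in> F" for y v using that append_F[of p "y # v"] px by auto
    have QZ: "finite {w\<in>F. (w \<in> Q \<inter> Z) \<noteq> (w \<in> translate p (hdset A))}" (is "finite ?D")
    proof -
      have "?D \<subseteq> {p}"
      proof
        fix w assume w: "w \<in> ?D"
        then have "w \<in> Q \<inter> Z \<or> w \<in> translate p (hdset A)" "w \<in> F" by auto
        moreover have tr: "u \<in> translate p (hdset A) \<longleftrightarrow> u \<in> F \<and> (\<exists>y\<in>A. \<exists>v. u = p @ y # v)" for u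
          using mem_translate_hdset[of p A u] F px by (auto simp: A_def)
        ultimately obtain v where v: "w = p @ v" using memZ[of w] by auto
        show "w \<in> {p}"
        proof (cases v)
          case (Cons y v')
          then have "w \<in> Q \<longleftrightarrow> y \<in> A" using pyQ[of y v'] yx[of y v'] \<open>w \<in> F\<close> v by (simp add: A_def)
          then show ?thesis using w v Cons memZ[of w] tr[of w] by auto
        qed (use v in simp)
      qed
      then show ?thesis using finite_subset by blast
    qed
    have ZQ: "finite {w\<in>F. (w \<in> Z - Q) \<noteq> (w \<in> translate p (hdset A'))}" (is "finite ?D")
    proof -
      have "?D \<subseteq> {p}"
      proof
        fix w assume w: "w \<in> ?D"
        then have "w \<in> Z - Q \<or> w \<in> translate p (hdset A')" "w \<in> F" by auto
        moreover have tr: "u \<in> translate p (hdset A') \<longleftrightarrow> u \<in> F \<and> (\<exists>y\<in>A'. \<exists>v. u = p @ y # v)" for u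
          using mem_translate_hdset[of p A' u] F px by (auto simp: A'_def)
        ultimately obtain v where v: "w = p @ v" using memZ[of w] by auto
        show "w \<in> {p}"
        proof (cases v)
          case (Cons y v')
          then have "w \<notin> Q \<longleftrightarrow> y \<in> A'" using pyQ[of y v'] yx[of y v'] \<open>w \<in> F\<close> v by (simp add: A'_def)
          then show ?thesis using w v Cons memZ[of w] tr[of w] by auto
        qed (use v in simp)
      qed
      then show ?thesis using finite_subset by blast
    qed
    have cutA: "cut Hs (Q \<inter> Z) = cut Hs (hdset A)" "cut Hs (Z - Q) = cut Hs (hdset A')"
      using cut_cong_finite[OF fg QZ] cut_cong_finite[OF fg ZQ] F fg by (simp_all add: cut_translate)
    have tA: "tends (Q \<inter> Z) l \<longleftrightarrow> tends (translate p (hdset A)) l"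
      "tends (Z - Q) l \<longleftrightarrow> tends (translate p (hdset A')) l" if "l \<in> F" "l \<noteq> []" for l
      using tends_cong_finite[OF _ _ QZ] tends_cong_finite[OF _ _ ZQ] that by simp_all
    have sub1: "cut Hs (Q \<inter> Z) + cut Hs (Q \<union> Z) \<le> cut Hs Q + cut Hs (hdset {x})"
      using cut_submodular[OF fg Q aiZ] cutZ by simp
    \<comment> \<open>The same inequality with the complement of \<open>Z\<close>; cut numbers do
      not distinguish a set from its complement.\<close>
    have sub2: "cut Hs (Z - Q) + cut Hs (Q - Z) \<le> cut Hs Q + cut Hs (hdset {x})"
    proof -
      have "Q \<union> - Z = - (Z - Q)" by blast
      then have "cut Hs (Q \<union> - Z) = cut Hs (Z - Q)" using cut_Compl[OF fg almost_invariant_Diff[OF aiZ Q]] by metis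
      then show ?thesis
        using cut_submodular[OF fg Q almost_invariant_Compl[OF aiZ]] cutZ
        by (simp add: cut_Compl fg aiZ Diff_eq[of Q Z])
    qed
    have ai1: "almost_invariant (Q \<union> Z)" and ai2: "almost_invariant (Q - Z)"
      using almost_invariant_Un almost_invariant_Diff Q aiZ by blast+
    \<comment> \<open>Both replacements are constant on \<open>Z\<close>, so \<open>p\<close> is no
      longer a branch point.\<close>
    have IH: "cut Hs (hdset {y}) \<le> cut Hs Q'"
      if Q': "Q' = Q \<union> Z \<or> Q' = Q - Z" and h: "h \<in> F" "snd y \<in> B" "tends Q' (conjg h [y]) \<noteq> tends Q' (conjg h [letter_inv y])"
      for Q' h y
    proof (rule less.hyps[of "K - {p}"])
      show "card (K - {p}) < card K" using p K(1) by (meson card_Diff1_less)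
      show "w \<in> K - {p}" if "w @ [x] \<in> K - {p}" for w x using that K(3)[of w x] pmax[of "w @ [x]"] by auto
      show "almost_invariant Q'" using Q' ai1 ai2 by blast
      show "w \<in> Q' \<longleftrightarrow> w @ [y] \<in> Q'" if w: "w @ [y] \<in> F" "w \<notin> K - {p}" for w y
      proof -
        have wF: "w \<in> F" using w append_F[of w] by blast
        have "w \<in> Z \<longleftrightarrow> w @ [y] \<in> Z"
        proof
          assume "w @ [y] \<in> Z"
          then obtain v where v: "w @ [y] = p @ v" using memZ by blast
          show "w \<in> Z"
          proof (cases v rule: rev_cases)
            case Nil
            then have "w \<in> K" using v p(1) K(3)[of w y] by simp
            then have "w = p" using w by blast
            then show ?thesis using v Nil by simp
          next
            case (snoc v' y')
            then show ?thesis using v memZ[of w] wF by auto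
          qed
        next
          assume "w \<in> Z"
          then obtain v where "w = p @ v" using memZ by blast
          then show "w @ [y] \<in> Z" using memZ[of "w @ [y]"] w(1) by auto
        qed
        moreover have "w \<in> Q \<longleftrightarrow> w @ [y] \<in> Q" if "w \<notin> Z"
        proof -
          have "p \<in> Z" using memZ[of p] F(1) by simp
          then have "w \<notin> K" using w(2) that by blast
          then show ?thesis using resp[of w y] w(1) by simp
        qed
        ultimately show ?thesis using Q' by auto
      qed
      show "finite (K - {p})" "K - {p} \<subseteq> F" using K(1,2) by auto
    qed (use h in auto)
    have tz: "tends (translate q S) l \<longleftrightarrow> tends S (conjg q l)" if "l \<in> F" "l \<noteq> []" "q \<in> F" "almost_invariant S" for q S l
      using tends_translate[of l S q] that by simp
    show ?thesis
    proof (cases "tends Z ?e \<and> tends Z ?e'")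
      case False
      \<comment> \<open>The colour of \<open>p @ [x]\<close> is spread over \<open>Z\<close>. Then
        \<open>x\<close> is among the directions of that colour at \<open>p\<close>, and local
        minimality for \<open>x\<close> shows that \<open>Q'\<close> has no larger cut number than
        \<open>Q\<close>.\<close>
      define Q' where "Q' = (if p @ [x] \<in> Q then Q \<union> Z else Q - Z)"
      have le: "cut Hs Q' \<le> cut Hs Q"
      proof (cases "p @ [x] \<in> Q")
        case True
        then have "cut Hs (hdset {x}) \<le> cut Hs (Q \<inter> Z)"
          unfolding cutA using F by (intro local_min) (auto simp: A_def)
        then show ?thesis using sub1 True by (simp add: Q'_def)
      next
        case False
        then have "cut Hs (hdset {x}) \<le> cut Hs (Z - Q)"
          unfolding cutA using F by (intro local_min) (auto simp: A'_def)
        then show ?thesis using sub2 False by (simp add: Q'_def)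
      qed
      text \<open>An end of the axis lying in \<open>Z\<close> while the other one does not is the end of the ray from \<open>p'\<close> through
        \<open>p\<close> labelled by powers of \<open>x\<close>, and \<open>Q'\<close> gives all of \<open>Z\<close> the colour of that end.\<close>
      have px_end: "tends Q l \<longleftrightarrow> p @ [x] \<in> Q" if l: "l \<in> F" "l \<noteq> []" "conjg p' l = [x]" "tends Z l" for l
      proof -
        have "conjg p l = conjg [x] (conjg p' l)" using l F px conjg_conjg[of p' "[x]" l] mul_append[of p' "[x]"] by simp
        also have "\<dots> = [x]" using l F by simp
        finally have "tends (translate p (hdset A)) l \<longleftrightarrow> x \<in> A" using tz[OF l(1,2) F(1)] F by (simp add: tends_hdset)
        then show ?thesis using tA(1)[OF l(1,2)] l(4) by (simp add: tends_Int A_def)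
      qed
      have ends: "tends Q l \<longleftrightarrow> p @ [x] \<in> Q" if l: "l = ?e \<or> l = ?e'" "tends Z l" for l
      proof -
        have "tends Z ?e \<noteq> tends Z ?e'" using False l by auto
        then have t: "tends (hdset {x}) (conjg (g \<cdot> p') [z]) \<noteq> tends (hdset {x}) (conjg (g \<cdot> p') [letter_inv z])"
          unfolding Z_def using tz[of ?e p' "hdset {x}"] tz[of ?e' p' "hdset {x}"] e F g z by (simp add: conjg_conjg)
        have ax: "conjg (g \<cdot> p') [z] = [z]" "conjg (g \<cdot> p') [letter_inv z] = [letter_inv z]"
          using axis_hdset[OF _ z t] g F by auto
        have "conjg p' l = [z] \<or> conjg p' l = [letter_inv z]" using l(1) ax g z F by (auto simp: conjg_conjg)
        moreover have "tends (hdset {x}) (conjg p' l)" using l(2) tz[of l p' "hdset {x}"] e F l(1) unfolding Z_def by auto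
        ultimately have "conjg p' l = [x]" using z by (auto simp: tends_hdset)
        then show ?thesis using px_end l e by blast
      qed
      have "tends Q' l \<longleftrightarrow> tends Q l" if "l = ?e \<or> l = ?e'" for l
      proof -
        have "l \<in> F" "l \<noteq> []" using that e by auto
        then show ?thesis using ends[OF that] tends_Un[of l Q Z] tends_Diff[of l Q Z] Q aiZ by (auto simp: Q'_def)
      qed
      then have "cut Hs (hdset {z}) \<le> cut Hs Q'" using sep g z by (intro IH) (auto simp: Q'_def)
      then show ?thesis using le by simp
    next
      case True
      \<comment> \<open>Both ends lie in \<open>Z\<close>, so the star at \<open>p\<close> alone
        separates the axis, through either colour class.\<close>
      have "tends (Q \<inter> Z) ?e \<noteq> tends (Q \<inter> Z) ?e'" using sep True by (simp add: tends_Int)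
      then have n1: "cut Hs (hdset {z}) \<le> cut Hs (Q \<inter> Z)"
        unfolding cutA using tA e g z F by (intro axis_bound_translate_hdset[of g p]) auto
      have "tends (Z - Q) ?e \<noteq> tends (Z - Q) ?e'" using sep True e Q aiZ by (simp add: tends_Diff)
      then have n2: "cut Hs (hdset {z}) \<le> cut Hs (Z - Q)"
        unfolding cutA using tA e g z F by (intro axis_bound_translate_hdset[of g p]) auto
      show ?thesis
      proof (rule ccontr)
        assume "\<not> ?thesis"
        then have small: "cut Hs (Q \<union> Z) < cut Hs (hdset {x})" "cut Hs (Q - Z) < cut Hs (hdset {x})"
          using n1 n2 sub1 sub2 by linarith+
        \<comment> \<open>The axis of \<open>x\<close> through the edge from \<open>p'\<close> to
          \<open>p\<close> has exactly one end in \<open>Z\<close>, so one of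
          \<open>Q \<union> Z\<close> and \<open>Q - Z\<close> separates it. Both have a cut number
          below that of \<open>x\<close>, against the induction hypothesis.\<close>
        let ?q = "winv p'"
        let ?f = "conjg ?q [x]" and ?f' = "conjg ?q [letter_inv x]"
        have f: "?f \<in> F" "?f \<noteq> []" "?f' \<in> F" "?f' \<noteq> []" using F conjg_eq_one[of ?q] by auto
        have "conjg p' ?f = [x]" "conjg p' ?f' = [letter_inv x]"
          using F conjg_cancel(2)[of p'] by auto
        then have Zf: "tends Z ?f" "\<not> tends Z ?f'"
          unfolding Z_def using tz[of ?f p' "hdset {x}"] tz[of ?f' p' "hdset {x}"] f F by (auto simp: tends_hdset)
        show False
        proof (cases "tends Q ?f'")
          case True
          then have "cut Hs (hdset {x}) \<le> cut Hs (Q - Z)"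
            using Zf f F Q aiZ by (intro IH[of _ ?q]) (auto simp: tends_Diff)
          then show ?thesis using small by simp
        next
          case False
          then have "cut Hs (hdset {x}) \<le> cut Hs (Q \<union> Z)"
            using Zf f F Q aiZ by (intro IH[of _ ?q]) (auto simp: tends_Un)
          then show ?thesis using small by simp
        qed
      qed
    qed
  qed
qed

text \<open>A ball containing the finite coboundary of \<open>Q\<close> serves as
  \<open>K\<close>.\<close>

lemma axis_bound_almost_invariant:
  assumes "finite B" "almost_invariant Q" "g \<in> F" "snd z \<in> B"
    "tends Q (conjg g [z]) \<noteq> tends Q (conjg g [letter_inv z])"
  shows "cut Hs (hdset {z}) \<le> cut Hs Q"
proof -
  define D where "D = (\<Union>y\<in>{y. snd y \<in> B}. {w\<in>F. (w \<in> Q) \<noteq> (w \<cdot> [y] \<in> Q)})"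
  have "{y :: 'b letter. snd y \<in> B} = UNIV \<times> B" by auto
  then have finL: "finite {y :: 'b letter. snd y \<in> B}" using assms(1) by simp
  have "finite D" unfolding D_def using finL assms(2) by (auto simp: almost_invariant_def)
  then obtain R where R: "\<And>w. w \<in> D \<Longrightarrow> length w \<le> R"
    using finite_nat_set_iff_bounded_le[of "length ` D"] by auto
  define K where "K = {w\<in>F. length w \<le> R}"
  have "K \<subseteq> {w. set w \<subseteq> {y. snd y \<in> B} \<and> length w \<le> R}" by (auto simp: K_def mem_F)
  then have "finite K" using finite_lists_length_le[OF finL] finite_subset by blast
  then show ?thesis
  proof (rule axis_bound)
    show "w \<in> Q \<longleftrightarrow> w @ [y] \<in> Q" if w: "w @ [y] \<in> F" "w \<notin> K" for w y
    proof -
      have "w \<in> F" "snd y \<in> B" using w append_F[of w "[y]"] by auto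
      moreover have "w \<notin> D" using w R \<open>w \<in> F\<close> by (auto simp: K_def)
      ultimately have "w \<in> Q \<longleftrightarrow> w \<cdot> [y] \<in> Q" unfolding D_def by blast
      then show ?thesis using mul_append[OF w(1)] by simp
    qed
  qed (use assms append_F in \<open>auto simp: K_def\<close>)
qed

end


section \<open>Automorphisms acting on sequences\<close>

lemma aut_hom: "\<alpha> \<in> aut B \<Longrightarrow> group_hom (free_group B) (free_group B) \<alpha>"
  by unfold_locales (simp add: aut_def iso_def)

lemma aut_simps:
  assumes "\<alpha> \<in> aut B"
  shows "u \<in> F \<Longrightarrow> \<alpha> u \<in> F" "u \<in> F \<Longrightarrow> v \<in> F \<Longrightarrow> \<alpha> (u \<cdot> v) = \<alpha> u \<cdot> \<alpha> v" "\<alpha> [] = []"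
    "u \<in> F \<Longrightarrow> \<alpha> (winv u) = winv (\<alpha> u)" "u \<in> F \<Longrightarrow> v \<in> F \<Longrightarrow> \<alpha> u = \<alpha> v \<longleftrightarrow> u = v"
    "u \<in> F \<Longrightarrow> g \<in> F \<Longrightarrow> \<alpha> (conjg g u) = conjg (\<alpha> g) (\<alpha> u)"
proof -
  interpret \<alpha>: group_hom "free_group B" "free_group B" \<alpha> using aut_hom[OF assms] .
  show 1: "u \<in> F \<Longrightarrow> \<alpha> u \<in> F" for u by simp
  show "\<alpha> [] = []" using \<alpha>.hom_one by simp
  show 2: "u \<in> F \<Longrightarrow> v \<in> F \<Longrightarrow> \<alpha> (u \<cdot> v) = \<alpha> u \<cdot> \<alpha> v" for u v by simp
  show 3: "u \<in> F \<Longrightarrow> \<alpha> (winv u) = winv (\<alpha> u)" for u using \<alpha>.hom_inv[of u] by simp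
  show "u \<in> F \<Longrightarrow> v \<in> F \<Longrightarrow> \<alpha> u = \<alpha> v \<longleftrightarrow> u = v"
    using assms by (auto simp: aut_def iso_def bij_betw_def inj_on_def)
  show "u \<in> F \<Longrightarrow> g \<in> F \<Longrightarrow> \<alpha> (conjg g u) = conjg (\<alpha> g) (\<alpha> u)"
    by (simp add: conjg_def 2 3 1)
qed

lemma aut_surj: "\<alpha> \<in> aut B \<Longrightarrow> \<alpha> ` F = F"
  by (simp add: aut_def iso_def bij_betw_def)

lemma aut_comp: "\<alpha> \<in> aut B \<Longrightarrow> \<beta> \<in> aut B \<Longrightarrow> \<alpha> \<circ> \<beta> \<in> aut B"
  unfolding aut_def by (rule iso_set_trans)

lemma aut_inverse:
  assumes "\<alpha> \<in> aut B"
  shows "\<exists>\<beta>\<in>aut B. (\<forall>w\<in>F. \<beta> (\<alpha> w) = w) \<and> (\<forall>w\<in>F. \<alpha> (\<beta> w) = w)"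
proof (intro bexI[of _ "inv_into F \<alpha>"] conjI ballI)
  have iso: "\<alpha> \<in> iso (free_group B) (free_group B)" using assms by (simp add: aut_def)
  then have bij: "bij_betw \<alpha> F F" by (simp add: iso_def)
  show "inv_into F \<alpha> \<in> aut B" unfolding aut_def by (rule iso_set_sym[OF iso])
  show "inv_into F \<alpha> (\<alpha> w) = w" "\<alpha> (inv_into F \<alpha> w) = w" if "w \<in> F" for w
    using bij that by (simp_all add: bij_betw_def inv_into_f_f f_inv_into_f)
qed

lemma fg_subgroup_image:
  assumes "\<alpha> \<in> aut B" "fg_subgroup B H" shows "fg_subgroup B (\<alpha> ` H)"
proof -
  interpret \<alpha>: group_hom "free_group B" "free_group B" \<alpha> using aut_hom[OF assms(1)] .
  obtain S where S: "finite S" "S \<subseteq> F" "H = generate (free_group B) S"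
    using assms by (auto simp: fg_subgroup_def)
  have "\<alpha> ` H = generate (free_group B) (\<alpha> ` S)" using \<alpha>.generate_img[OF S(2)] S(3) by simp
  moreover have "subgroup (\<alpha> ` H) (free_group B)"
    using assms(2) \<alpha>.subgroup_img_is_subgroup by (simp add: fg_subgroup_def)
  ultimately show ?thesis unfolding fg_subgroup_def using S by (auto intro!: exI[of _ "\<alpha> ` S"])
qed

lemma fg_list_act: "\<alpha> \<in> aut B \<Longrightarrow> fg_list Hs \<Longrightarrow> fg_list (act \<alpha> Hs)"
  by (auto simp: fg_list_def act_def fg_subgroup_image)

lemma act_comp: "act \<alpha> (act \<beta> Hs) = act (\<alpha> \<circ> \<beta>) Hs"
  by (simp add: act_def image_comp)

lemma fg_list_subset: "fg_list Hs \<Longrightarrow> H \<in> set Hs \<Longrightarrow> H \<subseteq> F"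
  unfolding fg_list_def by (meson fg_subgroup_subgroup subgroup.subset)

lemma act_cong: "fg_list Hs \<Longrightarrow> (\<And>w. w \<in> F \<Longrightarrow> \<alpha> w = \<beta> w) \<Longrightarrow> act \<alpha> Hs = act \<beta> Hs"
  unfolding act_def using fg_list_subset by (intro map_cong image_cong) blast+

lemma act_id: "fg_list Hs \<Longrightarrow> (\<And>w. w \<in> F \<Longrightarrow> \<alpha> w = w) \<Longrightarrow> act \<alpha> Hs = Hs"
  using act_cong[of Hs \<alpha> id] by (simp add: act_def)

subsection \<open>Exponent sums\<close>

definition expo :: "'b \<Rightarrow> 'b word \<Rightarrow> int" where
  "expo b w = (\<Sum>x\<leftarrow>w. if snd x = b then if fst x then 1 else - 1 else 0)"

lemma expo_simps [simp]:
  "expo b [] = 0" "expo b (u @ v) = expo b u + expo b v"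
  "expo b (x # w) = (if snd x = b then if fst x then 1 else - 1 else 0) + expo b w"
  by (simp_all add: expo_def)

lemma expo_winv [simp]: "expo b (winv w) = - expo b w"
  by (induction w) (auto simp: letter_inv_def)

lemma expo_mul: "u \<in> F \<Longrightarrow> v \<in> F \<Longrightarrow> expo b (u \<cdot> v) = expo b u + expo b v"
proof -
  assume "u \<in> F" "v \<in> F"
  then obtain p s q where "u = p @ s" "v = winv s @ q" "u \<cdot> v = p @ q" using mul_cancel by blast
  then show ?thesis by simp
qed

lemma expo_aut:
  assumes "finite B" "\<beta> \<in> aut B"
  shows "w \<in> F \<Longrightarrow> expo c (\<beta> w) = (\<Sum>b\<in>B. expo b w * expo c (\<beta> [(True, b)]))"
proof (induction w)
  case Nil
  then show ?case using aut_simps(3)[OF assms(2)] by simp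
next
  case (Cons x w)
  have F: "w \<in> F" "snd x \<in> B" "[x] \<cdot> w = x # w" using Cons.prems Cons_F mul_append[of "[x]" w] by auto
  then have "\<beta> (x # w) = \<beta> [x] \<cdot> \<beta> w" using aut_simps(2)[OF assms(2), of "[x]" w] by simp
  then have "expo c (\<beta> (x # w)) = expo c (\<beta> [x]) + expo c (\<beta> w)"
    using F aut_simps(1)[OF assms(2)] by (simp add: expo_mul)
  moreover have "expo c (\<beta> [x]) = (\<Sum>b\<in>B. expo b [x] * expo c (\<beta> [(True, b)]))"
  proof -
    have "expo c (\<beta> [x]) = expo (snd x) [x] * expo c (\<beta> [(True, snd x)])"
    proof (cases "fst x")
      case True
      then obtain b where "x = (True, b)" by (cases x) auto
      then show ?thesis by simp
    next
      case False
      then have "[x] = winv [(True, snd x)]" by (cases x) (auto simp: letter_inv_def)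
      then have "\<beta> [x] = winv (\<beta> [(True, snd x)])"
        using aut_simps(4)[OF assms(2), of "[(True, snd x)]"] F by simp
      then show ?thesis using False by simp
    qed
    also have "\<dots> = (\<Sum>b\<in>B. if b = snd x then expo b [x] * expo c (\<beta> [(True, b)]) else 0)"
      using assms(1) F by (simp add: sum.delta)
    also have "\<dots> = (\<Sum>b\<in>B. expo b [x] * expo c (\<beta> [(True, b)]))"
      by (intro sum.cong) auto
    finally show ?thesis .
  qed
  ultimately show ?case using Cons.IH F by (simp add: sum.distrib distrib_right)
qed

text \<open>The exponent sums of the images form the matrix of \<open>\<alpha>\<close> on the
  abelianization; the inverse automorphism supplies its inverse matrix.\<close>

lemma aut_transversal:
  assumes "finite B" "\<alpha> \<in> aut B"
  shows "\<exists>\<sigma>. bij_betw \<sigma> B B \<and> (\<forall>b\<in>B. expo (\<sigma> b) (\<alpha> [(True, b)]) \<noteq> 0)"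
proof -
  obtain \<beta> where \<beta>: "\<beta> \<in> aut B" "\<forall>w\<in>F. \<beta> (\<alpha> w) = w" using aut_inverse[OF assms(2)] by blast
  have "(\<Sum>b\<in>B. expo b (\<alpha> [(True, a)]) * expo c (\<beta> [(True, b)])) = (if a = c then 1 else 0)" if "a \<in> B" "c \<in> B" for a c
    using expo_aut[OF assms(1) \<beta>(1), of "\<alpha> [(True, a)]" c] \<beta>(2) aut_simps(1)[OF assms(2)] that
    by (cases "a = c") simp_all
  then show ?thesis
    by (rule invertible_matrix_transversal[OF assms(1), of "\<lambda>a b. expo b (\<alpha> [(True, a)])" "\<lambda>b c. expo c (\<beta> [(True, b)])"]) blast+
qed

lemma conjg_rotate:
  assumes "cyclically_reduced (u @ v)" "u @ v \<in> F" shows "conjg u (u @ v) = v @ u" "v @ u \<in> F"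
proof -
  have F: "u \<in> F" "v \<in> F" using assms append_F by blast+
  show vu: "v @ u \<in> F" using cyclically_reduced_rotate[OF assms(1)] F by (auto simp: mem_F cyclically_reduced_def)
  show "conjg u (u @ v) = v @ u"
    unfolding conjg_def mul_append[OF assms(2), symmetric] mul_append[OF vu, symmetric]
    using F by (simp add: m_assoc del: ginv_eq)
qed

lemma conjg_decomp:
  assumes "u @ v @ winv u \<in> F" shows "conjg u (u @ v @ winv u) = v" "u \<in> F" "v \<in> F"
proof -
  show F: "u \<in> F" "v \<in> F" using assms append_F[of u "v @ winv u"] append_F[of v] by auto
  have "u @ v @ winv u = u \<cdot> (v \<cdot> winv u)" using assms append_F[of u "v @ winv u"] by (simp add: mul_append)
  then show "conjg u (u @ v @ winv u) = v" using F
    by (simp add: conjg_def m_assoc del: ginv_eq)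
qed

text \<open>Conjugation preserves exponent sums, so the label \<open>b\<close> still occurs in the
  cyclically reduced core. Rotating the core to that occurrence puts an edge labelled
  \<open>b\<close> of its axis at the identity.\<close>

lemma expo_nonzero_crossing:
  assumes "w \<in> F" "expo b w \<noteq> 0"
  shows "\<exists>k\<in>F. tends (hdset {(True, b)}) (conjg k w) \<noteq> tends (hdset {(True, b)}) (winv (conjg k w))"
proof -
  have "w \<noteq> []" using assms by auto
  then obtain u v where uv: "w = u @ v @ winv u" "v \<noteq> []" "cyclically_reduced v"
    using cyclically_reduced_decomp[of w] assms by (auto simp: mem_F)
  have F: "u \<in> F" "v \<in> F" "conjg u w = v" using conjg_decomp[of u v] assms uv by auto
  have "expo b v \<noteq> 0" using assms uv by simp
  then have "\<exists>x\<in>set v. snd x = b" by (induction v) (auto split: if_splits)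
  then obtain x v1 v2 where x: "snd x = b" "v = v1 @ x # v2" by (metis split_list)
  have t: "tends (hdset {(True, b)}) l \<noteq> tends (hdset {(True, b)}) (winv l)"
    if "l \<in> F" "l \<noteq> []" "cyclically_reduced l" "hd l = (True, b) \<or> last l = (False, b)" for l
  proof -
    have "last l \<noteq> letter_inv (hd l)" using that by (auto simp: cyclically_reduced_def)
    moreover have "hd (winv l) = (True, b) \<longleftrightarrow> last l = (False, b)"
      using that by (cases "last l") (auto simp: letter_inv_def)
    moreover have "tends (hdset {(True, b)}) l \<longleftrightarrow> hd l = (True, b)"
      "tends (hdset {(True, b)}) (winv l) \<longleftrightarrow> hd (winv l) = (True, b)"
      using that by (simp_all add: tends_hdset del: hd_winv)
    moreover have "letter_inv (True, b) = (False, b)" by (simp add: letter_inv_def)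
    ultimately show ?thesis using that(4) by (cases "hd l = (True, b)") simp_all
  qed
  show ?thesis
  proof (cases "fst x")
    case True
    then have xb: "x = (True, b)" using x by (cases x) auto
    have r: "conjg v1 v = (x # v2) @ v1" "(x # v2) @ v1 \<in> F" "v1 \<in> F"
      using conjg_rotate[of v1 "x # v2"] uv F x append_F[of v1] by auto
    then have "conjg (u \<cdot> v1) w = (x # v2) @ v1" using F assms(1) conjg_conjg[of u v1 w] by simp
    then show ?thesis
      using t[OF r(2)] cyclically_reduced_rotate[of v1 "x # v2"] uv x xb F r by (intro bexI[of _ "u \<cdot> v1"]) auto
  next
    case False
    then have xb: "x = (False, b)" using x by (cases x) auto
    \<comment> \<open>The occurrence is \<open>b^-1\<close>; it is rotated to the end, so that the
      inverse word begins with \<open>b\<close>.\<close>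
    have r: "conjg (v1 @ [x]) v = v2 @ v1 @ [x]" "v2 @ v1 @ [x] \<in> F" "v1 @ [x] \<in> F"
      using conjg_rotate[of "v1 @ [x]" "v2"] uv F x append_F[of "v1 @ [x]" v2] by auto
    then have "conjg (u \<cdot> (v1 @ [x])) w = v2 @ v1 @ [x]" using F assms(1) conjg_conjg[of u "v1 @ [x]" w] by simp
    then show ?thesis
      using t[OF r(2)] cyclically_reduced_rotate[of "v1 @ [x]" v2] uv x xb F r by (intro bexI[of _ "u \<cdot> (v1 @ [x])"]) auto
  qed
qed

text \<open>If no half-space improved on a letter, each \<open>b\<close> would be bounded by the
  pulled-back half-space of its partner \<open>\<sigma> b\<close>, since that set separates an axis
  of \<open>b\<close>. Summing over the permutation compares the complexities.\<close>

theorem reducing_half_space: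
  assumes "finite B" "fg_list Hs" "\<alpha> \<in> aut B" "complexity B (act \<alpha> Hs) < complexity B Hs"
  shows "\<exists>A z. snd z \<in> B \<and> z \<in> A \<and> letter_inv z \<notin> A \<and> cut Hs (hdset A) < cut Hs (hdset {z})"
proof (rule ccontr)
  assume "\<not> ?thesis"
  then have lm: "cut Hs (hdset {z}) \<le> cut Hs (hdset A)" if "snd z \<in> B" "z \<in> A" "letter_inv z \<notin> A" for A z
    using that by (meson not_le)
  obtain \<sigma> where \<sigma>: "bij_betw \<sigma> B B" "\<And>b. b \<in> B \<Longrightarrow> expo (\<sigma> b) (\<alpha> [(True, b)]) \<noteq> 0"
    using aut_transversal[OF assms(1,3)] by blast
  have iso: "\<alpha> \<in> iso (free_group B) (free_group B)" using assms by (simp add: aut_def)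
  have le: "cut Hs (hdset {(True, b)}) \<le> cut (act \<alpha> Hs) (hdset {(True, \<sigma> b)})" if b: "b \<in> B" for b
  proof -
    let ?P = "hdset {(True, \<sigma> b)}" and ?z = "(True, b)"
    have zF: "[?z] \<in> F" "\<alpha> [?z] \<in> F" using b aut_simps(1)[OF assms(3)] by auto
    obtain k where k: "k \<in> F" "tends ?P (conjg k (\<alpha> [?z])) \<noteq> tends ?P (winv (conjg k (\<alpha> [?z])))"
      using expo_nonzero_crossing[OF zF(2) \<sigma>(2)[OF b]] by blast
    obtain g where g: "g \<in> F" "k = \<alpha> g" using k(1) aut_surj[OF assms(3)] by blast
    have "tends (\<alpha> -` ?P) (conjg g [?z]) \<longleftrightarrow> tends ?P (conjg k (\<alpha> [?z]))"
      using tends_vimage[OF iso] g zF aut_simps(6)[OF assms(3)] by simp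
    moreover have "tends (\<alpha> -` ?P) (conjg g [letter_inv ?z]) \<longleftrightarrow> tends ?P (winv (conjg k (\<alpha> [?z])))"
      using tends_vimage[OF iso] g b zF aut_simps[OF assms(3)] by (simp add: conjg_letter_inv)
    ultimately have "cut Hs (hdset {?z}) \<le> cut Hs (\<alpha> -` ?P)"
      using k(2) g b almost_invariant_vimage[OF _ iso]
      by (intro axis_bound_almost_invariant[OF assms(2) lm assms(1), of _ g]) auto
    then show ?thesis using cut_act[OF assms(2,3)] by simp
  qed
  have "complexity B Hs \<le> (\<Sum>b\<in>B. cut (act \<alpha> Hs) (hdset {(True, \<sigma> b)}))"
    unfolding complexity_eq_cut[OF assms(1,2)] by (intro sum_mono le)
  also have "\<dots> = complexity B (act \<alpha> Hs)"
    unfolding complexity_eq_cut[OF assms(1) fg_list_act[OF assms(3,2)]]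
    using sum.reindex_bij_betw[OF \<sigma>(1), of "\<lambda>b. cut (act \<alpha> Hs) (hdset {(True, b)})"] by simp
  finally show False using assms(4) by simp
qed

end

section \<open>Whitehead automorphisms\<close>

context free_grp
begin

section \<open>Homomorphisms determined on letters\<close>

lemma mul_letter_eq_Nil:
  assumes "u \<in> F" "snd y \<in> B" shows "u \<cdot> [y] = [] \<longleftrightarrow> u = [letter_inv y]"
proof -
  have "u \<cdot> [y] = [] \<longleftrightarrow> [y] = winv u" using mul_eq_Nil assms by simp
  also have "\<dots> \<longleftrightarrow> u = winv [y]" by (metis winv_simps(4))
  finally show ?thesis by simp
qed

definition extend :: "('b letter \<Rightarrow> 'b word) \<Rightarrow> 'b word \<Rightarrow> 'b word" where
  "extend f w = foldr (\<lambda>x r. f x \<cdot> r) w []"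

lemma extend_simps [simp]: "extend f [] = []" "extend f (x # w) = f x \<cdot> extend f w"
  by (simp_all add: extend_def)

context
  fixes f :: "'b letter \<Rightarrow> 'b word"
  assumes f: "\<And>x. snd x \<in> B \<Longrightarrow> f x \<in> F" "\<And>x. snd x \<in> B \<Longrightarrow> f (letter_inv x) = winv (f x)"
begin

lemma extend_closed: "snd ` set w \<subseteq> B \<Longrightarrow> extend f w \<in> F"
  by (induction w) (auto simp: f)

lemma extend_append: "snd ` set u \<subseteq> B \<Longrightarrow> snd ` set v \<subseteq> B \<Longrightarrow> extend f (u @ v) = extend f u \<cdot> extend f v"
  by (induction u) (simp_all add: extend_closed f m_assoc)

lemma extend_winv: "snd ` set w \<subseteq> B \<Longrightarrow> extend f (winv w) = winv (extend f w)"
proof (induction w)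
  case (Cons x w)
  then have "extend f (winv (x # w)) = winv (extend f w) \<cdot> winv (f x)"
    using extend_append[of "winv w" "[letter_inv x]"] by (simp add: f)
  also have "\<dots> = winv (f x \<cdot> extend f w)"
    using inv_mult_group[of "f x" "extend f w"] Cons.prems extend_closed[of w] f by simp
  finally show ?case by simp
qed simp

lemma extend_mul: "u \<in> F \<Longrightarrow> v \<in> F \<Longrightarrow> extend f (u \<cdot> v) = extend f u \<cdot> extend f v"
proof -
  assume "u \<in> F" "v \<in> F"
  then obtain p s q where psq: "u = p @ s" "v = winv s @ q" "u \<cdot> v = p @ q" "p @ q \<in> F" using mul_cancel by blast
  have B: "snd ` set p \<subseteq> B" "snd ` set q \<subseteq> B" "snd ` set s \<subseteq> B"
    using psq \<open>u \<in> F\<close> by (auto simp: mem_F)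
  have E: "extend f p \<in> F" "extend f q \<in> F" "extend f s \<in> F" using B extend_closed by auto
  have "extend f u \<cdot> extend f v = (extend f p \<cdot> extend f s) \<cdot> (winv (extend f s) \<cdot> extend f q)"
    using psq B extend_append[of p s] extend_append[of "winv s" q] extend_winv[of s] by simp
  also have "\<dots> = extend f p \<cdot> (extend f s \<cdot> (ginv (extend f s) \<cdot> extend f q))"
    using E by (simp add: m_assoc)
  also have "\<dots> = extend f p \<cdot> extend f q"
    using E by (simp del: ginv_eq)
  finally show ?thesis using psq B extend_append by simp
qed

lemma extend_hom: "extend f \<in> hom (free_group B) (free_group B)"
proof (rule homI)
  show "extend f w \<in> F" if "w \<in> F" for w using that by (intro extend_closed) (simp add: mem_F)
qed (rule extend_mul)

end

lemma hom_eqI: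
  assumes "h \<in> hom (free_group B) (free_group B)" "k \<in> hom (free_group B) (free_group B)"
    "\<And>y. snd y \<in> B \<Longrightarrow> h [y] = k [y]"
  shows "w \<in> F \<Longrightarrow> h w = k w"
proof (induction w)
  case Nil
  then show ?case using hom_one[OF assms(1) group_F group_F] hom_one[OF assms(2) group_F group_F] by simp
next
  case (Cons y w)
  then have F: "[y] \<in> F" "w \<in> F" "y # w = [y] \<cdot> w" using Cons_F mul_append[of "[y]" w] by auto
  then show ?case using hom_mult[OF assms(1) F(1,2)] hom_mult[OF assms(2) F(1,2)] Cons.IH assms(3)[of y] by simp
qed

text \<open>The Whitehead automorphism with multiplier \<open>a\<close>: \<open>A\<close> collects
  the letters whose image acquires \<open>a\<close> in front, and the multiplier itself is
  fixed.\<close>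

definition whitehead_letter :: "'b letter \<Rightarrow> 'b letter set \<Rightarrow> 'b letter \<Rightarrow> 'b word" where
  "whitehead_letter a A y = (if snd y = snd a then [y] else
     (if y \<in> A then [a] else []) \<cdot> [y] \<cdot> (if letter_inv y \<in> A then [letter_inv a] else []))"

definition whitehead :: "'b letter \<Rightarrow> 'b letter set \<Rightarrow> 'b word \<Rightarrow> 'b word" where
  "whitehead a A = extend (whitehead_letter a A)"

context
  fixes a :: "'b letter" and A :: "'b letter set"
  assumes a: "snd a \<in> B"
begin

lemma whitehead_letter_F: "snd y \<in> B \<Longrightarrow> whitehead_letter a A y \<in> F"
  using a by (simp add: whitehead_letter_def)

lemma whitehead_letter_inv: "snd y \<in> B \<Longrightarrow> whitehead_letter a A (letter_inv y) = winv (whitehead_letter a A y)"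
proof (cases "snd y = snd a")
  case False
  assume y: "snd y \<in> B"
  define s t where "s = (if y \<in> A then [a] else [])" and "t = (if letter_inv y \<in> A then [letter_inv a] else [])"
  have F: "s \<in> F" "t \<in> F" "[y] \<in> F" using a y by (auto simp: s_def t_def)
  have "winv (s \<cdot> [y] \<cdot> t) = winv t \<cdot> winv [y] \<cdot> winv s"
    using inv_mult_group[of "s \<cdot> [y]" t] inv_mult_group[of s "[y]"] F by (simp add: m_assoc)
  moreover have "winv t = (if letter_inv y \<in> A then [a] else [])" "winv s = (if y \<in> A then [letter_inv a] else [])"
    by (simp_all add: s_def t_def)
  ultimately show ?thesis using False by (simp add: whitehead_letter_def s_def t_def)
qed (simp add: whitehead_letter_def)

lemma whitehead_hom: "whitehead a A \<in> hom (free_group B) (free_group B)"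
  unfolding whitehead_def by (rule extend_hom) (simp_all add: whitehead_letter_F whitehead_letter_inv)

lemma whitehead_single: "snd y \<in> B \<Longrightarrow> whitehead a A [y] = whitehead_letter a A y"
  by (simp add: whitehead_def whitehead_letter_F)

end

lemma whitehead_inverse:
  assumes a: "snd a \<in> B" shows "w \<in> F \<Longrightarrow> whitehead (letter_inv a) A (whitehead a A w) = w"
proof -
  have a': "snd (letter_inv a) \<in> B" using a by simp
  let ?h = "whitehead (letter_inv a) A"
  have h: "?h \<in> hom (free_group B) (free_group B)" by (rule whitehead_hom[OF a'])
  have fixa: "?h [a] = [a]" "?h [letter_inv a] = [letter_inv a]"
    using a whitehead_single[OF a'] by (simp_all add: whitehead_letter_def)
  have "(?h \<circ> whitehead a A) w = id w" if "w \<in> F" for w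
  proof (rule hom_eqI[OF _ _ _ that])
    show "?h \<circ> whitehead a A \<in> hom (free_group B) (free_group B)"
      using whitehead_hom[OF a, of A] h by (auto simp: hom_def Pi_def)
    show "id \<in> hom (free_group B) (free_group B)" by (simp add: hom_def)
    fix y :: "'b letter" assume y: "snd y \<in> B"
    show "(?h \<circ> whitehead a A) [y] = id [y]"
    proof (cases "snd y = snd a")
      case True
      then show ?thesis using y a fixa by (auto simp: whitehead_single whitehead_letter_def snd_eq_iff_letter)
    next
      case False
      define s t where "s = (if y \<in> A then [a] else [])" and "t = (if letter_inv y \<in> A then [letter_inv a] else [])"
      have F: "s \<in> F" "t \<in> F" "[y] \<in> F" using a y by (auto simp: s_def t_def)
      have hs: "?h s = s" "?h t = t" using fixa by (auto simp: s_def t_def whitehead_def)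
      have wt: "winv s = (if y \<in> A then [letter_inv a] else [])" "winv t = (if letter_inv y \<in> A then [a] else [])"
        by (simp_all add: s_def t_def)
      have "?h [y] = winv s \<cdot> [y] \<cdot> winv t"
        using False y wt by (simp add: whitehead_single[OF a'] whitehead_letter_def)
      moreover have "whitehead a A [y] = s \<cdot> [y] \<cdot> t"
        using False y a by (simp add: whitehead_single whitehead_letter_def s_def t_def)
      ultimately have "?h (whitehead a A [y]) = s \<cdot> (ginv s \<cdot> [y] \<cdot> ginv t) \<cdot> t"
        using F hs hom_mult[OF h] by simp
      also have "\<dots> = [y]" using F by (simp add: m_assoc del: ginv_eq)
      finally show ?thesis by simp
    qed
  qed
  then show "w \<in> F \<Longrightarrow> ?h (whitehead a A w) = w" by simp
qed

lemma whitehead_aut: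
  assumes "snd a \<in> B" shows "whitehead a A \<in> aut B"
proof -
  have cl: "whitehead c A w \<in> F" if "w \<in> F" "snd c \<in> B" for c w
    using hom_in_carrier[OF whitehead_hom[OF that(2)] that(1)] .
  have "bij_betw (whitehead a A) F F"
    using assms cl[of _ a] cl[of _ "letter_inv a"] whitehead_inverse[of a] whitehead_inverse[of "letter_inv a"]
    by (intro bij_betw_byWitness[where f' = "whitehead (letter_inv a) A"]) auto
  then show ?thesis using whitehead_hom[OF assms] by (simp add: aut_def iso_def)
qed

text \<open>Both sides are compared through their coboundaries in the Cayley graph: multiplying by the image of a letter
  crosses a half-space only at the trivial element.\<close>

lemma whitehead_hdset_multiplier:
  assumes a: "snd a \<in> B" "a \<in> A" "letter_inv a \<notin> A" and w: "w \<in> F"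
  shows "whitehead a A w \<in> hdset {a} \<longleftrightarrow> w \<in> hdset A"
proof -
  let ?t = "whitehead a A"
  note t = aut_simps[OF whitehead_aut[OF a(1), of A]]
  have "w \<in> ?t -` hdset {a} \<longleftrightarrow> w \<in> hdset A"
  proof (rule eq_on_F_by_letters[OF _ _ w])
    show "[] \<in> ?t -` hdset {a} \<longleftrightarrow> [] \<in> hdset A" using t(3) by (simp add: hdset_def)
    fix g and y :: "'b letter" assume g: "g \<in> F" and y: "snd y \<in> B"
    let ?h = "?t g"
    have h: "?h \<in> F" using t g by simp
    have nil: "?t v = [] \<longleftrightarrow> v = []" if "v \<in> F" for v using t(5)[OF that Nil_F] t(3) by simp
    have ta: "?t [a] = [a]" using a by (simp add: whitehead_single whitehead_letter_def)
    have gy: "g \<cdot> [y] = [] \<longleftrightarrow> g = [letter_inv y]" using g y by (rule mul_letter_eq_Nil)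
    have tm: "?t (g \<cdot> [y]) = ?h \<cdot> ?t [y]" using t g y by simp
    have "(?h \<in> hdset {a}) \<noteq> (?h \<cdot> ?t [y] \<in> hdset {a}) \<longleftrightarrow> g = [] \<and> y \<in> A \<or> g = [letter_inv y] \<and> letter_inv y \<in> A"
    proof (cases "snd y = snd a")
      case True
      then have ya: "y = a \<or> y = letter_inv a" by (simp add: snd_eq_iff_letter)
      have "?t [y] = [y]" using True a y by (simp add: whitehead_single whitehead_letter_def)
      moreover have "?h = [a] \<longleftrightarrow> g = [a]" using t(5)[OF g, of "[a]"] ta a by simp
      ultimately show ?thesis using hdset_coboundary[OF h y, of "{a}"] ya a nil[OF g] by auto
    next
      case False
      define s r where "s = (if y \<in> A then [a] else [])" and "r = (if letter_inv y \<in> A then [letter_inv a] else [])"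
      have F: "s \<in> F" "r \<in> F" using a by (auto simp: s_def r_def)
      have ty: "?t [y] = s \<cdot> [y] \<cdot> r" using False y a by (simp add: whitehead_single whitehead_letter_def s_def r_def)
      let ?h1 = "?h \<cdot> s" let ?h2 = "?h1 \<cdot> [y]"
      have hF: "?h1 \<in> F" "?h2 \<in> F" using h F y by auto
      have h3: "?h2 \<cdot> r = ?t (g \<cdot> [y])" using tm ty h F y by (simp add: m_assoc)
      have 1: "(?h \<in> hdset {a}) \<noteq> (?h1 \<in> hdset {a}) \<longleftrightarrow> y \<in> A \<and> g = []"
        using hdset_coboundary[OF h a(1), of "{a}"] h nil[OF g] by (auto simp: s_def)
      have 2: "?h1 \<in> hdset {a} \<longleftrightarrow> ?h2 \<in> hdset {a}"
        using hdset_coboundary[OF hF(1) y, of "{a}"] False by auto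
      have 3: "(?h2 \<in> hdset {a}) \<noteq> (?h2 \<cdot> r \<in> hdset {a}) \<longleftrightarrow> letter_inv y \<in> A \<and> g = [letter_inv y]"
      proof (cases "letter_inv y \<in> A")
        case True
        then have r: "r = [letter_inv a]" by (simp add: r_def)
        have "(?h2 \<in> hdset {a}) \<noteq> (?h2 \<cdot> r \<in> hdset {a}) \<longleftrightarrow> ?h2 = [a]"
          unfolding r using hdset_coboundary[OF hF(2), of "letter_inv a" "{a}"] a by simp
        also have "\<dots> \<longleftrightarrow> ?h2 \<cdot> r = []"
          unfolding r using mul_letter_eq_Nil[OF hF(2), of "letter_inv a"] a by simp
        also have "\<dots> \<longleftrightarrow> g \<cdot> [y] = []" unfolding h3 using nil[of "g \<cdot> [y]"] g y by simp
        finally show ?thesis using True gy by simp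
      qed (use hF in \<open>simp add: r_def\<close>)
      have "?h \<cdot> ?t [y] = ?h2 \<cdot> r" using tm h3 by simp
      then show ?thesis using 1 2 3 by auto
    qed
    then show "((g \<in> ?t -` hdset {a}) \<noteq> (g \<cdot> [y] \<in> ?t -` hdset {a})) \<longleftrightarrow> ((g \<in> hdset A) \<noteq> (g \<cdot> [y] \<in> hdset A))"
      using hdset_coboundary[OF g y, of A] tm by simp
  qed
  then show ?thesis by simp
qed

text \<open>The image of a letter \<open>b\<close> of \<open>A\<close> starts with
  \<open>a b\<close>, so the preimage of the half-space is based at \<open>a^-1\<close> instead of
  the identity. It is merely translated, and its cut number stays.\<close>

lemma whitehead_hdset_other:
  assumes a: "snd a \<in> B" and b: "snd b \<in> B" "snd b \<noteq> snd a" and w: "w \<in> F"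
  shows "whitehead a A w \<in> hdset {b} \<longleftrightarrow> w \<in> translate (if b \<in> A then [letter_inv a] else []) (hdset {b})"
proof -
  let ?t = "whitehead a A"
  define c where "c = (if b \<in> A then [letter_inv a] else [])"
  have c: "c \<in> F" using a by (simp add: c_def)
  note t = aut_simps[OF whitehead_aut[OF a(1), of A]]
  have "w \<in> ?t -` hdset {b} \<longleftrightarrow> w \<in> translate c (hdset {b})"
  proof (rule eq_on_F_by_letters[OF _ _ w])
    show "[] \<in> ?t -` hdset {b} \<longleftrightarrow> [] \<in> translate c (hdset {b})"
      using t(3) b by (auto simp: hdset_def translate_def c_def a)
    fix g and y :: "'b letter" assume g: "g \<in> F" and y: "snd y \<in> B"
    let ?h = "?t g"
    have h: "?h \<in> F" using t g by simp
    have ta: "?t [a] = [a]" "?t [letter_inv a] = [letter_inv a]" using a by (simp_all add: whitehead_single whitehead_letter_def)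
    have tc: "?t c = c" using ta t(3) by (simp add: c_def)
    have tm: "?t (g \<cdot> [y]) = ?h \<cdot> ?t [y]" using t g y by simp
    let ?k = "winv c \<cdot> g"
    have k: "?k \<in> F" using c g by simp
    have "?k = [] \<longleftrightarrow> g = c" using mul_eq_Nil[of "winv c" g] c g by auto
    moreover have "?k = [letter_inv y] \<longleftrightarrow> g \<cdot> [y] = c"
    proof -
      have "?k = [letter_inv y] \<longleftrightarrow> ?k \<cdot> [y] = []" using mul_letter_eq_Nil[OF k y] by simp
      also have "\<dots> \<longleftrightarrow> winv c \<cdot> (g \<cdot> [y]) = []" using c g y by (simp add: m_assoc)
      also have "\<dots> \<longleftrightarrow> g \<cdot> [y] = c" using mul_eq_Nil[of "winv c" "g \<cdot> [y]"] c g y by simp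
      finally show ?thesis .
    qed
    ultimately have rhs: "(g \<in> translate c (hdset {b})) \<noteq> (g \<cdot> [y] \<in> translate c (hdset {b}))
        \<longleftrightarrow> g = c \<and> y = b \<or> g \<cdot> [y] = c \<and> letter_inv y = b"
      using hdset_coboundary[OF k y, of "{b}"] c g y by (simp add: translate_def m_assoc)
    have "(?h \<in> hdset {b}) \<noteq> (?h \<cdot> ?t [y] \<in> hdset {b}) \<longleftrightarrow> g = c \<and> y = b \<or> g \<cdot> [y] = c \<and> letter_inv y = b"
    proof (cases "snd y = snd a")
      case True
      have "?t [y] = [y]" using True a y by (simp add: whitehead_single whitehead_letter_def)
      moreover have "y \<noteq> b" "letter_inv y \<noteq> b" using True b by auto
      ultimately show ?thesis using hdset_coboundary[OF h y, of "{b}"] by auto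
    next
      case False
      define s r where "s = (if y \<in> A then [a] else [])" and "r = (if letter_inv y \<in> A then [letter_inv a] else [])"
      have F: "s \<in> F" "r \<in> F" using a by (auto simp: s_def r_def)
      have ty: "?t [y] = s \<cdot> [y] \<cdot> r" using False y a by (simp add: whitehead_single whitehead_letter_def s_def r_def)
      let ?h1 = "?h \<cdot> s" let ?h2 = "?h1 \<cdot> [y]"
      have hF: "?h1 \<in> F" "?h2 \<in> F" using h F y by auto
      have h3: "?h2 \<cdot> r = ?t (g \<cdot> [y])" using tm ty h F y by (simp add: m_assoc)
      have 1: "?h \<in> hdset {b} \<longleftrightarrow> ?h1 \<in> hdset {b}"
        using hdset_coboundary[OF h a(1), of "{b}"] h b by (auto simp: s_def)
      have 3: "?h2 \<in> hdset {b} \<longleftrightarrow> ?h2 \<cdot> r \<in> hdset {b}"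
        using hdset_coboundary[OF hF(2), of "letter_inv a" "{b}"] hF b a by (auto simp: r_def)
      have 2: "(?h1 \<in> hdset {b}) \<noteq> (?h2 \<in> hdset {b}) \<longleftrightarrow> ?h1 = [] \<and> y = b \<or> ?h2 = [] \<and> letter_inv y = b"
        using hdset_coboundary[OF hF(1) y, of "{b}"] mul_letter_eq_Nil[OF hF(1) y] by simp
      have A1: "?h1 = [] \<longleftrightarrow> g = c" if "y = b"
      proof -
        have sc: "s = winv c" using that by (simp add: s_def c_def)
        then have "?h1 = [] \<longleftrightarrow> ?h = c" using mul_eq_Nil[OF h F(1)] by (metis winv_simps(4))
        then show ?thesis using t(5)[OF g c] tc by simp
      qed
      have A2: "?h2 = [] \<longleftrightarrow> g \<cdot> [y] = c" if "letter_inv y = b"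
      proof -
        have rc: "r = c" using that by (simp add: r_def c_def)
        have "?h2 = [] \<longleftrightarrow> ?h2 \<cdot> r = r" using hF F r_cancel_one[of r ?h2] by simp
        then show ?thesis using h3 rc tc t(5)[of "g \<cdot> [y]" c] g y c by simp
      qed
      have "?h \<cdot> ?t [y] = ?h2 \<cdot> r" using tm h3 by simp
      then show ?thesis using 1 2 3 A1 A2 by auto
    qed
    then show "((g \<in> ?t -` hdset {b}) \<noteq> (g \<cdot> [y] \<in> ?t -` hdset {b})) \<longleftrightarrow>
        ((g \<in> translate c (hdset {b})) \<noteq> (g \<cdot> [y] \<in> translate c (hdset {b})))"
      using rhs tm by simp
  qed
  then show ?thesis by (simp add: c_def)
qed

lemma cut_whitehead_multiplier:
  assumes "fg_list Hs" "snd a \<in> B" "a \<in> A" "letter_inv a \<notin> A"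
  shows "cut (act (whitehead a A) Hs) (hdset {a}) = cut Hs (hdset A)"
  using cut_act[OF assms(1) whitehead_aut[OF assms(2), of A]] whitehead_hdset_multiplier[OF assms(2-4)]
  by (simp add: cut_cong[OF assms(1), of "whitehead a A -` hdset {a}" "hdset A"])

lemma cut_whitehead_other:
  assumes "fg_list Hs" "snd a \<in> B" "snd b \<in> B" "snd b \<noteq> snd a"
  shows "cut (act (whitehead a A) Hs) (hdset {b}) = cut Hs (hdset {b})"
proof -
  let ?c = "if b \<in> A then [letter_inv a] else []"
  have "cut (act (whitehead a A) Hs) (hdset {b}) = cut Hs (whitehead a A -` hdset {b})"
    using cut_act[OF assms(1) whitehead_aut[OF assms(2), of A]] .
  also have "\<dots> = cut Hs (translate ?c (hdset {b}))"
    by (rule cut_cong[OF assms(1)]) (use whitehead_hdset_other[OF assms(2-4)] in simp)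
  also have "\<dots> = cut Hs (hdset {b})" using assms by (intro cut_translate) auto
  finally show ?thesis .
qed

text \<open>Only the edges labelled by the multiplier change in number, from the cut number of
  \<open>hdset {a}\<close> to that of \<open>hdset A\<close>. The additive form avoids truncated
  subtraction.\<close>

lemma complexity_whitehead:
  assumes "finite B" "fg_list Hs" "snd a \<in> B" "a \<in> A" "letter_inv a \<notin> A"
  shows "complexity B (act (whitehead a A) Hs) + cut Hs (hdset {a}) = complexity B Hs + cut Hs (hdset A)"
proof -
  let ?Hs = "act (whitehead a A) Hs"
  have fg': "fg_list ?Hs" using fg_list_act whitehead_aut assms by blast
  have pos: "cut Ks (hdset {(True, snd a)}) = cut Ks (hdset {a})" if "fg_list Ks" for Ks
    using cut_hdset_letter_inv[OF that assms(3)] by (cases a; cases "fst a") (auto simp: letter_inv_def)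
  have split: "complexity B Ks = cut Ks (hdset {a}) + (\<Sum>b\<in>B - {snd a}. cut Ks (hdset {(True, b)}))" if "fg_list Ks" for Ks
    unfolding complexity_eq_cut[OF assms(1) that] using sum.remove[OF assms(1,3), of "\<lambda>b. cut Ks (hdset {(True, b)})"] pos[OF that] by simp
  have "(\<Sum>b\<in>B - {snd a}. cut ?Hs (hdset {(True, b)})) = (\<Sum>b\<in>B - {snd a}. cut Hs (hdset {(True, b)}))"
    using assms by (intro sum.cong refl cut_whitehead_other) auto
  then show ?thesis using split[OF fg'] split[OF assms(2)] cut_whitehead_multiplier[OF assms(2-5)] by simp
qed

end

section \<open>Cyclic subgroups\<close>

lemma concat_replicate_Suc: "concat (replicate (Suc n) v) = concat (replicate n v) @ v"
  by (induction n) auto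

context free_grp
begin

lemma int_pow_nonneg: "k \<ge> 0 \<Longrightarrow> w [^]\<^bsub>free_group B\<^esub> (k::int) = w ^^^ nat k"
  by (subst int_pow_def2, subst if_not_P) simp_all

lemma int_pow_negative: "k < 0 \<Longrightarrow> w [^]\<^bsub>free_group B\<^esub> (k::int) = ginv (w ^^^ nat (- k))"
  by (subst int_pow_def2, subst if_P) simp_all

abbreviation cyc :: "'b word \<Rightarrow> 'b word set" where
  "cyc w \<equiv> generate (free_group B) {w}"

lemma cyc_eq: "w \<in> F \<Longrightarrow> cyc w = {w [^]\<^bsub>free_group B\<^esub> (k::int) | k. k \<in> UNIV}"
  by (rule generate_pow)

lemma subgroup_cyc: "w \<in> F \<Longrightarrow> subgroup (cyc w) (free_group B)"
  by (rule generate_is_subgroup) simp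

lemma fg_subgroup_cyc: "w \<in> F \<Longrightarrow> fg_subgroup B (cyc w)"
  unfolding fg_subgroup_def using subgroup_cyc by blast

lemma mem_cyc [simp]: "w \<in> cyc w"
  by (rule generate.incl) simp

lemma image_cyc: "\<alpha> \<in> aut B \<Longrightarrow> w \<in> F \<Longrightarrow> \<alpha> ` cyc w = cyc (\<alpha> w)"
  using group_hom.generate_img[OF aut_hom, of \<alpha> "{w}"] by simp

lemma conjg_aut: "g \<in> F \<Longrightarrow> conjg g \<in> aut B"
  unfolding aut_def by (rule conjg_iso)

lemma hd_mem_cyc:
  assumes "l \<in> F" "l \<noteq> []" "m \<in> cyc l" "m \<noteq> []"
  shows "hd m = hd l \<or> hd m = hd (winv l)"
proof -
  obtain k :: int where k: "m = l [^]\<^bsub>free_group B\<^esub> k" using assms cyc_eq by auto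
  have "k \<noteq> 0" using k assms by (intro notI) simp
  show ?thesis
  proof (cases "k > 0")
    case True
    then have "m = l ^^^ nat k" unfolding k by (intro int_pow_nonneg) simp
    moreover have "nat k > 0" using True by simp
    ultimately show ?thesis using hd_pow[OF assms(1,2)] by metis
  next
    case False
    then have "m = ginv (l ^^^ nat (- k))" unfolding k using \<open>k \<noteq> 0\<close> by (intro int_pow_negative) simp
    also have "\<dots> = ginv l ^^^ nat (- k)" by (rule nat_pow_inv[OF assms(1), symmetric])
    also have "ginv l = winv l" using assms(1) by simp
    finally have "m = winv l ^^^ nat (- k)" .
    moreover have "nat (- k) > 0" "winv l \<in> F" "winv l \<noteq> []" using False \<open>k \<noteq> 0\<close> assms by simp_all
    ultimately show ?thesis using hd_pow by metis
  qed
qed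

text \<open>An axis has only two ends, so only their first letters occur; these differ exactly when
  the axis passes through the base.\<close>

lemma crosses_cyc:
  assumes v: "v \<in> F" "v \<noteq> []" and g: "g \<in> F"
  shows "crosses (hdset {y}) (conjg g ` cyc v) \<longleftrightarrow>
    hd (conjg g v) \<noteq> hd (winv (conjg g v)) \<and> y \<in> {hd (conjg g v), hd (winv (conjg g v))}"
proof -
  let ?l = "conjg g v"
  have L: "conjg g ` cyc v = cyc ?l" using image_cyc[OF conjg_aut] g v by simp
  have l: "?l \<in> F" "?l \<noteq> []" using v g by auto
  have w: "winv ?l \<in> cyc ?l" using subgroup.m_inv_closed[OF subgroup_cyc[OF l(1)] mem_cyc] l by simp
  have sub: "cyc ?l \<subseteq> F" using subgroup.subset[OF subgroup_cyc[OF l(1)]] .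
  show ?thesis unfolding L crosses_hdset[OF sub]
  proof
    assume "\<exists>m\<in>cyc ?l - {[]}. \<exists>m'\<in>cyc ?l - {[]}. hd m \<in> {y} \<and> hd m' \<notin> {y}"
    then obtain m m' where m: "m \<in> cyc ?l" "m \<noteq> []" "m' \<in> cyc ?l" "m' \<noteq> []" "hd m = y" "hd m' \<noteq> y" by auto
    show "hd ?l \<noteq> hd (winv ?l) \<and> y \<in> {hd ?l, hd (winv ?l)}"
      using hd_mem_cyc[OF l m(1,2)] hd_mem_cyc[OF l m(3,4)] m(5,6) by (auto simp del: hd_winv)
  next
    assume "hd ?l \<noteq> hd (winv ?l) \<and> y \<in> {hd ?l, hd (winv ?l)}"
    moreover have "?l \<in> cyc ?l - {[]}" "winv ?l \<in> cyc ?l - {[]}" using l w by auto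
    ultimately show "\<exists>m\<in>cyc ?l - {[]}. \<exists>m'\<in>cyc ?l - {[]}. hd m \<in> {y} \<and> hd m' \<notin> {y}"
      by (metis insert_iff singletonD)
  qed
qed

lemma coset_mul_left:
  assumes "subgroup H (free_group B)" "h \<in> H" "g \<in> F"
  shows "H #>\<^bsub>free_group B\<^esub> (h \<cdot> g) = H #>\<^bsub>free_group B\<^esub> g"
  using assms by (subst r_coset_eq_iff) (auto simp: subgroup.mem_carrier m_assoc simp del: ginv_eq)

lemma cyc_conjg_coset:
  assumes v: "v \<in> F" and F: "y \<in> F" "g \<in> F" "p \<in> F"
    and eq: "cyc (conjg y v) #>\<^bsub>free_group B\<^esub> g = cyc (conjg y v) #>\<^bsub>free_group B\<^esub> p"
  shows "cyc v #>\<^bsub>free_group B\<^esub> (y \<cdot> g) = cyc v #>\<^bsub>free_group B\<^esub> (y \<cdot> p)"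
proof -
  have s: "subgroup (cyc v) (free_group B)" "subgroup (cyc (conjg y v)) (free_group B)"
    using v F by (simp_all add: subgroup_cyc)
  have "g \<cdot> ginv p \<in> conjg y ` cyc v"
    using r_coset_eq_iff[OF s(2) F(2,3)] eq image_cyc[OF conjg_aut, of y v] v F by simp
  then obtain h where h: "h \<in> cyc v" "g \<cdot> ginv p = conjg y h" by blast
  have hF: "h \<in> F" using h s subgroup.mem_carrier by metis
  have "(y \<cdot> g) \<cdot> ginv (y \<cdot> p) = y \<cdot> (g \<cdot> ginv p) \<cdot> ginv y"
    using F by (simp add: inv_mult_group m_assoc del: ginv_eq)
  also have "\<dots> = h" unfolding h(2) using F hF by (simp add: conjg_def m_assoc del: ginv_eq)
  finally show ?thesis using h(1) r_coset_eq_iff[OF s(1), of "y \<cdot> g" "y \<cdot> p"] F by simp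
qed

text \<open>The core graph of \<open>cyc v\<close> is a circle labelled by \<open>v\<close>. Each
  letter of \<open>g\<close> moves forward along it, moves backward, or leaves it; after leaving,
  the conjugate and its inverse start with the same letter, which the hypothesis excludes.\<close>

lemma conjg_cyclically_reduced:
  assumes "v \<in> F" "v \<noteq> []" "cyclically_reduced v" "g \<in> F" "hd (conjg g v) \<noteq> hd (winv (conjg g v))"
  shows "\<exists>p q. v = p @ q \<and> conjg g v = q @ p \<and> cyc v #>\<^bsub>free_group B\<^esub> g = cyc v #>\<^bsub>free_group B\<^esub> p"
  using assms
proof (induction g arbitrary: v)
  case Nil
  then show ?case by (intro exI[of _ "[]"] exI[of _ v]) simp
next
  case (Cons y g)
  have F: "snd y \<in> B" "[y] \<in> F" "g \<in> F" "[y] \<cdot> g = y # g" using Cons.prems(4) Cons_F mul_append[of "[y]" g] by auto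
  have cc: "conjg (y # g) v = conjg g (conjg [y] v)" using conjg_conjg[of "[y]" g v] F Cons.prems by simp
  have sv: "subgroup (cyc v) (free_group B)" using Cons.prems by (simp add: subgroup_cyc)
  have step: "\<exists>p q. conjg [y] v = p @ q \<and> conjg (y # g) v = q @ p \<and>
       cyc v #>\<^bsub>free_group B\<^esub> (y # g) = cyc v #>\<^bsub>free_group B\<^esub> ([y] \<cdot> p) \<and> p \<in> F"
    if cr: "cyclically_reduced (conjg [y] v)"
  proof -
    have "conjg [y] v \<in> F" "conjg [y] v \<noteq> []" using F Cons.prems by auto
    then obtain p q where pq: "conjg [y] v = p @ q" "conjg g (conjg [y] v) = q @ p"
      "cyc (conjg [y] v) #>\<^bsub>free_group B\<^esub> g = cyc (conjg [y] v) #>\<^bsub>free_group B\<^esub> p"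
      using Cons.IH[of "conjg [y] v"] cr Cons.prems(5) cc F by auto
    have "p \<in> F" using \<open>conjg [y] v \<in> F\<close> pq append_F by metis
    then show ?thesis using cyc_conjg_coset[OF Cons.prems(1) F(2,3) _ pq(3)] pq cc F by auto
  qed
  consider "y = hd v" | "y \<noteq> hd v" "y = letter_inv (last v)" | "y \<noteq> hd v" "y \<noteq> letter_inv (last v)" by blast
  then show ?case
  proof cases
    case 1
    then obtain v' where v: "v = [y] @ v'" using Cons.prems(2) by (cases v) auto
    have rot: "conjg [y] v = v' @ [y]" "cyclically_reduced (v' @ [y])"
      using conjg_rotate[of "[y]" v'] cyclically_reduced_rotate[of "[y]" v'] Cons.prems v by auto
    then obtain p q where pq: "v' @ [y] = p @ q" "conjg (y # g) v = q @ p" "p \<in> F"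
      "cyc v #>\<^bsub>free_group B\<^esub> (y # g) = cyc v #>\<^bsub>free_group B\<^esub> ([y] \<cdot> p)" using step by auto
    show ?thesis
    proof (cases q rule: rev_cases)
      \<comment> \<open>\<open>p\<close> runs once around the rotated circle, so the coset is that
        of \<open>[y]\<close> alone.\<close>
      case Nil
      have p: "p = v' @ [y]" using pq(1) Nil by simp
      then have "p = v' \<cdot> [y]" using mul_append[of v' "[y]"] pq(3) by simp
      moreover have "v = [y] \<cdot> v'" using v mul_append[of "[y]" v'] Cons.prems(1) by simp
      moreover have "v' \<in> F" using p pq(3) append_F by blast
      ultimately have "[y] \<cdot> p = v \<cdot> [y]" using F(2) m_assoc[of "[y]" v' "[y]"] by metis
      then have "cyc v #>\<^bsub>free_group B\<^esub> ([y] \<cdot> p) = cyc v #>\<^bsub>free_group B\<^esub> [y]"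
        using coset_mul_left[OF sv mem_cyc F(2)] by simp
      then show ?thesis using pq Nil v by (intro exI[of _ "[y]"] exI[of _ v']) simp
    next
      case (snoc q' z)
      then have e: "v' = p @ q'" "z = y" using pq(1) by (simp_all flip: append_assoc)
      then have "[y] \<cdot> p = y # p" using v Cons.prems(1) append_F[of "y # p" q'] mul_append[of "[y]" p] by simp
      then show ?thesis using pq snoc e v by (intro exI[of _ "y # p"] exI[of _ q']) simp
    qed
  next
    case 2
    define t where "t = last v"
    obtain v' where v: "v = v' @ [t]" using Cons.prems(2) t_def by (metis append_butlast_last_id)
    have yt: "y = letter_inv t" using 2 t_def by simp
    have tF: "[t] \<in> F" "v' \<in> F" using Cons.prems(1) v append_F by blast+
    have rot: "conjg v' v = [t] @ v'" "[t] @ v' \<in> F" "cyclically_reduced ([t] @ v')"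
      using conjg_rotate[of v' "[t]"] cyclically_reduced_rotate[of v' "[t]"] Cons.prems v by auto
    have "conjg [y] v = [t] \<cdot> v \<cdot> ginv [t]" using yt tF by (simp add: conjg_def)
    also have "\<dots> = [t] \<cdot> (v' \<cdot> [t]) \<cdot> ginv [t]" using v mul_append[of v' "[t]"] Cons.prems(1) by simp
    also have "\<dots> = [t] \<cdot> v'" using tF by (simp add: m_assoc del: ginv_eq)
    also have "\<dots> = [t] @ v'" using rot mul_append by blast
    finally have c: "conjg [y] v = t # v'" by simp
    then obtain p q where pq: "t # v' = p @ q" "conjg (y # g) v = q @ p" "p \<in> F"
      "cyc v #>\<^bsub>free_group B\<^esub> (y # g) = cyc v #>\<^bsub>free_group B\<^esub> ([y] \<cdot> p)" using step rot(3) by auto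
    show ?thesis
    proof (cases p)
      \<comment> \<open>One backward step from the base arrives at the vertex of \<open>v'\<close>,
        the last one before the circle closes.\<close>
      case Nil
      have "v \<cdot> [y] = v'" using v yt Cons.prems(1) F mul_letter[of v y] by simp
      then have "cyc v #>\<^bsub>free_group B\<^esub> [y] = cyc v #>\<^bsub>free_group B\<^esub> v'"
        using coset_mul_left[OF sv mem_cyc F(2)] by simp
      then show ?thesis using pq Nil v F by (intro exI[of _ v'] exI[of _ "[t]"]) simp
    next
      case (Cons z p')
      then have e: "z = t" "v' = p' @ q" using pq(1) by simp_all
      have "[y] \<cdot> p = p'" using Cons e pq(3) yt F mul_letter_left[of p y] by simp
      then show ?thesis using pq Cons e v by (intro exI[of _ p'] exI[of _ "q @ [t]"]) simp
    qed
  next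
    case 3
    have "v @ (y # g) \<in> F" using Cons.prems 3 by (subst append_F) auto
    moreover then have "winv (y # g) @ (v @ (y # g)) \<in> F" using Cons.prems 3
      by (subst append_F) (auto simp del: winv_simps(3))
    ultimately have "conjg (y # g) v = winv (y # g) @ v @ (y # g)"
      using Cons.prems mul_append[of v "y # g"] mul_append[of "winv (y # g)" "v @ (y # g)"]
      by (simp add: conjg_def m_assoc del: winv_simps(3))
    then show ?thesis using Cons.prems(5) by (auto simp del: winv_simps(3))
  qed
qed

lemma pow_cyclically_reduced:
  assumes "v \<in> F" "cyclically_reduced v"
  shows "v ^^^ n = concat (replicate n v)"
proof (induction n)
  case (Suc n)
  have e: "concat (replicate n v) @ v = concat (replicate (Suc n) v)"
    by (rule concat_replicate_Suc[symmetric])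
  have "v ^^^ Suc n = reduce (concat (replicate n v) @ v)" using Suc by (simp add: mul_def)
  then show ?case using e reduced_concat_replicate[OF assms(2), of "Suc n"] by (metis reduce_eq_self)
qed simp

lemma length_pow_mul_take:
  assumes "v \<in> F" "cyclically_reduced v"
  shows "length (v ^^^ n \<cdot> take j v) = n * length v + min j (length v)"
proof -
  have "concat (replicate (Suc n) v) = (concat (replicate n v) @ take j v) @ drop j v"
    unfolding concat_replicate_Suc by simp
  then have "reduced (concat (replicate n v) @ take j v)"
    using reduced_concat_replicate[OF assms(2), of "Suc n"] reduced_append by metis
  then have "v ^^^ n \<cdot> take j v = concat (replicate n v) @ take j v"
    using pow_cyclically_reduced[OF assms] by (simp add: mul_def reduce_eq_self)
  then show ?thesis by (simp add: length_concat sum_list_replicate min.commute)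
qed

text \<open>Coinciding vertices differ by a power of \<open>v\<close>. Powers of \<open>v\<close>
  and prefixes of \<open>v\<close> concatenate without cancellation, so comparing lengths forces the
  exponent 0.\<close>

lemma inj_on_cyc_cosets:
  assumes v: "v \<in> F" "cyclically_reduced v"
  shows "inj_on (\<lambda>j. cyc v #>\<^bsub>free_group B\<^esub> take j v) {..<length v}"
proof (rule inj_onI)
  fix i j assume ij: "i \<in> {..<length v}" "j \<in> {..<length v}" "cyc v #>\<^bsub>free_group B\<^esub> take i v = cyc v #>\<^bsub>free_group B\<^esub> take j v"
  have tF: "take n v \<in> F" for n using v append_F[of "take n v" "drop n v"] by simp
  have s: "subgroup (cyc v) (free_group B)" using v by (simp add: subgroup_cyc)
  have "take i v \<cdot> ginv (take j v) \<in> cyc v" using r_coset_eq_iff[OF s tF tF] ij(3) by blast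
  then obtain k :: int where k: "take i v \<cdot> ginv (take j v) = v [^]\<^bsub>free_group B\<^esub> k" using cyc_eq[OF v(1)] by blast
  then have e: "take i v = v [^]\<^bsub>free_group B\<^esub> k \<cdot> take j v"
    using tF[of i] tF[of j] v by (metis inv_solve_right' int_pow_closed)
  show "i = j"
  proof (cases "k \<ge> 0")
    case True
    then have "take i v = v ^^^ nat k \<cdot> take j v" using e int_pow_nonneg[of k v] by (simp only:)
    then have "length (take i v) = nat k * length v + j"
      using length_pow_mul_take[OF v, of "nat k" j] ij by (simp del: length_take)
    then show ?thesis using ij by (cases "nat k") auto
  next
    case False
    then have "take i v = ginv (v ^^^ nat (- k)) \<cdot> take j v" using e int_pow_negative[of k v] by (simp only: not_le)
    then have "take j v = v ^^^ nat (- k) \<cdot> take i v" using tF[of j] v by (simp del: ginv_eq pow_nat)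
    then have "length (take j v) = nat (- k) * length v + i"
      using length_pow_mul_take[OF v, of "nat (- k)" i] ij by (simp del: length_take pow_nat)
    then show ?thesis using ij False by (cases "nat (- k)") auto
  qed
qed

text \<open>Each of the \<open>length v\<close> vertices of the circle has two outgoing directions,
  the first letters of the rotated word and of its inverse. Counting oriented edges this way counts
  every edge twice.\<close>

lemma card_core_edges_cyc:
  assumes "finite B" and v: "v \<in> F" "v \<noteq> []" "cyclically_reduced v"
  shows "card (core_edges B (cyc v)) = length v"
proof -
  let ?H = "cyc v" and ?n = "length v"
  have fg: "fg_list [?H]" using fg_subgroup_cyc[OF v(1)] by (simp add: fg_list_def)
  have s: "subgroup ?H (free_group B)" using v by (simp add: subgroup_cyc)
  let ?L = "{y :: 'b letter. snd y \<in> B}"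
  have Leq: "?L = Pair True ` B \<union> Pair False ` B" by (auto simp: image_iff split: prod.splits)
  have finL: "finite ?L" using Leq assms(1) by simp
  have cut1: "cut [?H] Q = card (cuts Q ?H)" for Q by (simp add: cut_def)
  have "card (core_edges B ?H) = (\<Sum>b\<in>B. card (cuts (hdset {(True, b)}) ?H))"
    using complexity_eq_cut[OF assms(1) fg] by (simp add: complexity_def cut1)
  moreover have "card (cuts (hdset {(False, b)}) ?H) = card (cuts (hdset {(True, b)}) ?H)" if "b \<in> B" for b
    using cut_hdset_letter_inv[OF fg, of "(True, b)"] that by (simp add: cut1 letter_inv_def)
  ultimately have "2 * card (core_edges B ?H) = (\<Sum>b\<in>B. card (cuts (hdset {(True, b)}) ?H)) + (\<Sum>b\<in>B. card (cuts (hdset {(False, b)}) ?H))"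
    by simp
  also have "\<dots> = (\<Sum>y\<in>?L. card (cuts (hdset {y}) ?H))"
    unfolding Leq using assms(1) by (subst sum.union_disjoint) (auto simp: sum.reindex inj_on_def)
  also have "\<dots> = card (SIGMA y:?L. cuts (hdset {y}) ?H)"
    by (rule card_SigmaI[symmetric]) (use finL fg_subgroup_finite_cuts[OF fg_subgroup_cyc[OF v(1)]] in auto)
  also have "(SIGMA y:?L. cuts (hdset {y}) ?H) = 
     (\<lambda>(j, b). (if b then hd (drop j v @ take j v) else hd (winv (drop j v @ take j v)), ?H #>\<^bsub>free_group B\<^esub> take j v)) ` ({..<?n} \<times> UNIV)"
    (is "_ = ?f ` _")
  proof (intro equalityI subsetI)
    fix e assume "e \<in> (SIGMA y:?L. cuts (hdset {y}) ?H)"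
    then obtain y C where e: "e = (y, C)" "snd y \<in> B" "C \<in> cuts (hdset {y}) ?H" by auto
    then obtain g where g: "g \<in> F" "C = ?H #>\<^bsub>free_group B\<^esub> g" "crosses (hdset {y}) (conjg g ` ?H)" by (auto simp: cuts_def)
    then have h: "hd (conjg g v) \<noteq> hd (winv (conjg g v))" "y \<in> {hd (conjg g v), hd (winv (conjg g v))}"
      using crosses_cyc[OF v(1,2) g(1), of y] by auto
    obtain p q where pq: "v = p @ q" "conjg g v = q @ p" "C = ?H #>\<^bsub>free_group B\<^esub> p"
      using conjg_cyclically_reduced[OF v g(1) h(1)] g(2) by auto
    have "\<exists>j<?n. conjg g v = drop j v @ take j v \<and> C = ?H #>\<^bsub>free_group B\<^esub> take j v"
    \<comment> \<open>Only positions below \<open>length v\<close> are allowed; the full prefix is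
      the base vertex again.\<close>
    proof (cases "q = []")
      case True
      then have "C = ?H #>\<^bsub>free_group B\<^esub> (v \<cdot> [])" using pq v by simp
      then have "C = ?H #>\<^bsub>free_group B\<^esub> []" using coset_mul_left[OF s mem_cyc, of "[]"] by simp
      then show ?thesis using pq True v by (intro exI[of _ 0]) simp
    qed (use pq in \<open>auto intro!: exI[of _ "length p"]\<close>)
    then obtain j where "j < ?n" "conjg g v = drop j v @ take j v" "C = ?H #>\<^bsub>free_group B\<^esub> take j v" by blast
    then show "e \<in> ?f ` ({..<?n} \<times> UNIV)"
      using h(2) e by (intro image_eqI[of _ _ "(j, y = hd (conjg g v))"]) auto
  next
    fix e assume "e \<in> ?f ` ({..<?n} \<times> UNIV)"
    then obtain j b where j: "j < ?n" and e: "e = ?f (j, b)" by auto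
    let ?l = "drop j v @ take j v"
    have tF: "take j v \<in> F" using v append_F[of "take j v" "drop j v"] by simp
    have c: "conjg (take j v) v = ?l" "?l \<in> F" "cyclically_reduced ?l"
      using conjg_rotate[of "take j v" "drop j v"] cyclically_reduced_rotate[of "take j v" "drop j v"] v by auto
    have ne: "?l \<noteq> []" using j by auto
    have h: "hd ?l \<noteq> hd (winv ?l)" using c(3) ne unfolding cyclically_reduced_def hd_winv[OF ne] by (metis letter_inv_inv)
    have wF: "winv ?l \<in> F" "winv ?l \<noteq> []" unfolding winv_F winv_simps(6) using c ne by blast+
    have inB: "snd (hd w) \<in> B" if "w \<in> F" "w \<noteq> []" for w using that by (cases w) (auto simp: Cons_F)
    let ?y = "if b then hd ?l else hd (winv ?l)"
    have "crosses (hdset {?y}) (conjg (take j v) ` ?H)"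
      using crosses_cyc[OF v(1,2) tF, of ?y] c(1) h by simp
    then have "?H #>\<^bsub>free_group B\<^esub> take j v \<in> cuts (hdset {?y}) ?H" using coset_in_cuts_iff[OF s tF] by simp
    moreover have "snd ?y \<in> B" using inB[OF c(2) ne] inB[OF wF] by simp
    ultimately show "e \<in> (SIGMA y:?L. cuts (hdset {y}) ?H)" using e by simp
  qed
  also have "card (?f ` ({..<?n} \<times> UNIV)) = card ({..<?n} \<times> (UNIV :: bool set))"
  proof (rule card_image, rule inj_onI)
    fix s t assume st: "s \<in> {..<?n} \<times> UNIV" "t \<in> {..<?n} \<times> UNIV" "?f s = ?f t"
    obtain i b j c where s: "s = (i, b)" and t: "t = (j, c)" by (cases s, cases t)
    have ij: "i < ?n" "j < ?n" using st s t by auto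
    have y: "(if b then hd (drop i v @ take i v) else hd (winv (drop i v @ take i v))) =
          (if c then hd (drop j v @ take j v) else hd (winv (drop j v @ take j v)))"
      and C: "?H #>\<^bsub>free_group B\<^esub> take i v = ?H #>\<^bsub>free_group B\<^esub> take j v"
      using st(3) s t by (auto simp del: winv_simps hd_winv)
    have "i = j" using inj_onD[OF inj_on_cyc_cosets[OF v(1,3)] C] ij by simp
    moreover have "hd (drop j v @ take j v) \<noteq> hd (winv (drop j v @ take j v))"
    proof -
      have ne: "drop j v @ take j v \<noteq> []" using ij by auto
      show ?thesis unfolding hd_winv[OF ne] using cyclically_reduced_rotate[of "take j v" "drop j v"] v ne
        unfolding cyclically_reduced_def by (metis append_take_drop_id letter_inv_inv)
    qed
    ultimately show "s = t" using y s t by (auto split: if_splits simp del: winv_simps hd_winv)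
  qed
  also have "\<dots> = 2 * ?n" by (simp add: card_cartesian_product)
  finally show ?thesis by simp
qed

lemma card_core_edges_conjg:
  assumes "finite B" "fg_subgroup B H" "g \<in> F"
  shows "card (core_edges B (conjg g ` H)) = card (core_edges B H)"
proof -
  have "fg_list [H]" "fg_list [conjg g ` H]"
    using assms fg_subgroup_image[OF conjg_aut] by (simp_all add: fg_list_def)
  then show ?thesis
    using complexity_eq_cut[OF assms(1), of "[H]"] complexity_eq_cut[OF assms(1), of "[conjg g ` H]"] assms
    by (simp add: complexity_def cut_def card_cuts_conjg fg_subgroup_subgroup)
qed

end

section \<open>Descent towards a minimal representative\<close>

context free_grp
begin

section \<open>Cyclic length as an edge count\<close>

abbreviation edges :: "'b word set \<Rightarrow> nat" where
  "edges H \<equiv> card (core_edges B H)"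

lemma edges_cyc_conjg: "finite B \<Longrightarrow> w \<in> F \<Longrightarrow> g \<in> F \<Longrightarrow> edges (cyc (conjg g w)) = edges (cyc w)"
  using card_core_edges_conjg[OF _ fg_subgroup_cyc, of w g] image_cyc[OF conjg_aut, of g w] by simp

lemma edges_cyc_decomp:
  assumes "finite B" "w \<in> F" "w \<noteq> []"
  shows "\<exists>g\<in>F. \<exists>v\<in>F. v \<noteq> [] \<and> w = conjg g v \<and> edges (cyc w) = length v"
proof -
  obtain u v where uv: "w = u @ v @ winv u" "v \<noteq> []" "cyclically_reduced v"
    using cyclically_reduced_decomp[of w] assms by (auto simp: mem_F)
  have F: "u \<in> F" "v \<in> F" "conjg u w = v" using conjg_decomp[of u v] assms(2) uv(1) by auto
  then have w: "w = conjg (winv u) v" using conjg_cancel(1)[OF F(1) assms(2)] by simp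
  then have "edges (cyc w) = length v"
    using edges_cyc_conjg[OF assms(1) F(2), of "winv u"] card_core_edges_cyc[OF assms(1) F(2) uv(2,3)] F by simp
  then show ?thesis using F uv(2) w by (intro bexI[of _ "winv u"] bexI[of _ v]) simp_all
qed

abbreviation ipow (infixr "^^^^" 75) where "w ^^^^ k \<equiv> w [^]\<^bsub>free_group B\<^esub> (k::int)"

lemma expo_int_pow: "w \<in> F \<Longrightarrow> expo b (w ^^^^ k) = k * expo b w"
proof -
  assume w: "w \<in> F"
  have n: "expo b (w ^^^ n) = int n * expo b w" for n
    by (induction n) (simp_all add: expo_mul w distrib_right)
  show ?thesis
  proof (cases "k \<ge> 0")
    case True
    then show ?thesis using n[of "nat k"] by (simp only: int_pow_nonneg) simp
  next
    case False
    then have "expo b (w ^^^^ k) = - expo b (w ^^^ nat (- k))"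
      using w by (simp add: int_pow_negative del: pow_nat)
    also have "\<dots> = k * expo b w" using n[of "nat (- k)"] False by (simp del: pow_nat)
    finally show ?thesis .
  qed
qed

text \<open>Stripping powers of \<open>x\<close> from the left of \<open>v\<close> and powers of \<open>y\<close> from its right does not change the conjugacy
  class of \<open>x v y v\<^sup>-\<^sup>1\<close>; what remains is cyclically reduced of length \<open>2 + 2 |v|\<close>.\<close>

lemma edges_product_of_conjugates:
  assumes "finite B" "snd x \<in> B" "snd y \<in> B" "snd x \<noteq> snd y"
  shows "v \<in> F \<Longrightarrow> edges (cyc ([x] \<cdot> (v \<cdot> [y] \<cdot> winv v))) \<ge> 2 \<and>
    (edges (cyc ([x] \<cdot> (v \<cdot> [y] \<cdot> winv v))) \<le> 2 \<longrightarrow> (\<exists>i j. v = [x] ^^^^ i \<cdot> [y] ^^^^ j))"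
proof (induction v rule: length_induct)
  case (1 v)
  have xy: "[x] \<in> F" "[y] \<in> F" using assms by auto
  have pow1: "\<exists>i::int. [z] = [c] ^^^^ i" if "snd z = snd c" "snd c \<in> B" for z c :: "'b letter"
  proof (cases "z = c")
    case True
    then show ?thesis using that by (intro exI[of _ 1]) simp
  next
    case False
    then have "[z] = [c] ^^^^ (- 1)" using that int_pow_neg[of "[c]" 1] by (simp add: snd_eq_iff_letter)
    then show ?thesis by blast
  qed
  consider "v = []" | "v \<noteq> []" "snd (hd v) = snd x" | "v \<noteq> []" "snd (hd v) \<noteq> snd x" "snd (last v) = snd y"
    | "v \<noteq> []" "snd (hd v) \<noteq> snd x" "snd (last v) \<noteq> snd y" by blast
  then show ?case
  proof cases
    case 1
    have w: "[x, y] \<in> F" "cyclically_reduced [x, y]"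
      using assms by (auto simp: Cons_F cyclically_reduced_def snd_eq_iff_letter)
    then have "[x] \<cdot> (v \<cdot> [y] \<cdot> winv v) = [x, y]" using 1 xy mul_append[of "[x]" "[y]"] by simp
    moreover have "edges (cyc [x, y]) = 2" using card_core_edges_cyc[OF assms(1) w(1) _ w(2)] by simp
    moreover have "v = [x] ^^^^ 0 \<cdot> [y] ^^^^ 0" using 1 by simp
    ultimately show ?thesis by (metis order_refl)
  next
    case 2
    then obtain z u where v: "v = z # u" "snd z = snd x" by (cases v) auto
    have F: "u \<in> F" "[z] \<in> F" "[z] \<cdot> u = v" using "1.prems" v Cons_F mul_append[of "[z]" u] by auto
    have zx: "conjg [z] [x] = [x]"
    proof -
      have "z = x \<or> z = letter_inv x" using v by (simp add: snd_eq_iff_letter)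
      moreover have "conjg (ginv [x]) (conjg [x] [x]) = [x]" by (rule conjg_cancel(1)[OF xy(1) xy(1)])
      ultimately show ?thesis using xy by auto
    qed
    have "conjg [z] ([x] \<cdot> (v \<cdot> [y] \<cdot> winv v)) = conjg [z] [x] \<cdot> conjg [z] (v \<cdot> [y] \<cdot> ginv v)"
      using F xy "1.prems" by (simp add: conjg_mult)
    also have "conjg [z] (v \<cdot> [y] \<cdot> ginv v) = u \<cdot> [y] \<cdot> ginv u"
      unfolding F(3)[symmetric] using F(1,2) xy by (simp add: conjg_def inv_mult_group m_assoc del: ginv_eq)
    finally have "edges (cyc ([x] \<cdot> (u \<cdot> [y] \<cdot> winv u))) = edges (cyc ([x] \<cdot> (v \<cdot> [y] \<cdot> winv v)))"
      using edges_cyc_conjg[OF assms(1), of "[x] \<cdot> (v \<cdot> [y] \<cdot> winv v)" "[z]"] zx F xy "1.prems" by simp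
    moreover have "\<exists>i j. v = [x] ^^^^ i \<cdot> [y] ^^^^ j" if "u = [x] ^^^^ i \<cdot> [y] ^^^^ j" for i j
    proof -
      obtain k where k: "[z] = [x] ^^^^ k" using pow1 v assms(2) by blast
      have "v = [x] ^^^^ k \<cdot> ([x] ^^^^ i \<cdot> [y] ^^^^ j)" using F(3) k that by simp
      also have "\<dots> = [x] ^^^^ (k + i) \<cdot> [y] ^^^^ j" using xy by (simp add: int_pow_mult m_assoc)
      finally show ?thesis by blast
    qed
    moreover have "length u < length v" using v by simp
    ultimately show ?thesis using "1.IH" F(1) by metis
  next
    case 3
    then obtain z u where v: "v = u @ [z]" "snd z = snd y" by (cases v rule: rev_cases) auto
    have F: "u \<in> F" "[z] \<in> F" "u \<cdot> [z] = v" using "1.prems" v append_F[of u "[z]"] mul_append[of u "[z]"] by auto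
    have zy: "[z] \<cdot> [y] \<cdot> ginv [z] = [y]"
    proof -
      have "z = y \<or> z = letter_inv y" using v by (simp add: snd_eq_iff_letter)
      moreover have "[y] \<cdot> [y] \<cdot> ginv [y] = [y]" "ginv [y] \<cdot> [y] \<cdot> [y] = [y]"
        using xy by (simp_all add: m_assoc del: ginv_eq)
      ultimately show ?thesis using xy by auto
    qed
    have "v \<cdot> [y] \<cdot> ginv v = u \<cdot> ([z] \<cdot> [y] \<cdot> ginv [z]) \<cdot> ginv u"
      unfolding F(3)[symmetric] using F(1,2) xy by (simp add: inv_mult_group m_assoc del: ginv_eq)
    then have "v \<cdot> [y] \<cdot> winv v = u \<cdot> [y] \<cdot> winv u" unfolding zy using F "1.prems" by simp
    moreover have "\<exists>i j. v = [x] ^^^^ i \<cdot> [y] ^^^^ j" if "u = [x] ^^^^ i \<cdot> [y] ^^^^ j" for i j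
    proof -
      obtain k where k: "[z] = [y] ^^^^ k" using pow1 v assms(3) by blast
      have "v = ([x] ^^^^ i \<cdot> [y] ^^^^ j) \<cdot> [y] ^^^^ k" using F(3) k that by simp
      also have "\<dots> = [x] ^^^^ i \<cdot> [y] ^^^^ (j + k)" using xy by (simp add: int_pow_mult m_assoc)
      finally show ?thesis by blast
    qed
    moreover have "length u < length v" using v by simp
    ultimately show ?thesis using "1.IH" F(1) by metis
  next
    case 4
    let ?w = "[x] @ v @ [y] @ winv v"
    have a: "[y] @ winv v \<in> F" using "1.prems" 4 xy by (subst append_F) auto
    have b: "v @ [y] @ winv v \<in> F" using a "1.prems" 4 by (subst append_F) auto
    have w: "?w \<in> F" using b xy 4 by (subst append_F) auto
    have "last ?w = letter_inv (hd v)" using 4 by simp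
    then have cr: "cyclically_reduced ?w" using w 4 by (auto simp: cyclically_reduced_def mem_F)
    have "[x] \<cdot> (v \<cdot> [y] \<cdot> winv v) = [x] \<cdot> (v \<cdot> ([y] \<cdot> winv v))" using xy "1.prems" by (simp add: m_assoc)
    also have "\<dots> = ?w" using mul_append[OF a] mul_append[OF b] mul_append[OF w] by simp
    finally have "edges (cyc ([x] \<cdot> (v \<cdot> [y] \<cdot> winv v))) = length ?w"
      using card_core_edges_cyc[OF assms(1) w _ cr] by simp
    moreover have "length v > 0" using 4 by simp
    ultimately show ?thesis by simp
  qed
qed

definition signed_permutation :: "('b word \<Rightarrow> 'b word) \<Rightarrow> bool" where
  "signed_permutation \<gamma> \<longleftrightarrow> (\<exists>g\<in>F. \<exists>\<pi>. bij_betw (snd \<circ> \<pi>) B B \<and> (\<forall>b\<in>B. \<gamma> [(True, b)] = conjg g [\<pi> b]))"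

lemma edges_cyc_aut_pos: "finite B \<Longrightarrow> \<gamma> \<in> aut B \<Longrightarrow> w \<in> F \<Longrightarrow> w \<noteq> [] \<Longrightarrow> edges (cyc (\<gamma> w)) \<ge> 1"
proof -
  assume a: "finite B" "\<gamma> \<in> aut B" "w \<in> F" "w \<noteq> []"
  have "\<gamma> w \<in> F" "\<gamma> w \<noteq> []" using aut_simps[OF a(2)] a by (auto, metis Nil_F)
  then obtain v :: "'b word" where "v \<noteq> []" "edges (cyc (\<gamma> w)) = length v" using edges_cyc_decomp[OF a(1)] by blast
  then show ?thesis by (cases v) auto
qed

lemma complexity_sum_list: "complexity B Hs = (\<Sum>H\<leftarrow>Hs. edges H)"
  by (simp add: complexity_def sum_list_sum_nth lessThan_atLeast0)

lemma complexity_append: "complexity B (Hs @ Ks) = complexity B Hs + complexity B Ks"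
  by (simp add: complexity_sum_list)

lemma complexity_concat_replicate: "complexity B (concat (replicate n Hs)) = n * complexity B Hs"
  by (induction n) (simp_all add: complexity_append, simp add: complexity_sum_list)

lemma act_append: "act \<alpha> (Hs @ Ks) = act \<alpha> Hs @ act \<alpha> Ks"
  by (simp add: act_def)

lemma act_concat_replicate: "act \<alpha> (concat (replicate n Hs)) = concat (replicate n (act \<alpha> Hs))"
  by (simp add: act_def map_concat)

lemma conjg_int_pow_self: "x \<in> F \<Longrightarrow> conjg (x ^^^^ i) x = x"
proof -
  assume x: "x \<in> F"
  have "x \<cdot> x ^^^^ i = x ^^^^ i \<cdot> x" using int_pow_mult[OF x, of 1 i] int_pow_mult[OF x, of i 1] x by (simp add: add.commute)
  then show ?thesis using x by (simp add: conjg_def m_assoc del: ginv_eq)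
qed

section \<open>Recognizing signed permutations by cyclic lengths\<close>

context
  fixes \<gamma>
  assumes fin: "finite B" and \<gamma>: "\<gamma> \<in> aut B"
    and one: "\<And>b. b \<in> B \<Longrightarrow> edges (cyc (\<gamma> [(True, b)])) = 1"
begin

text \<open>A cyclic group with one core edge is generated by a conjugate of a letter. The
  transversal of the exponent matrix shows that distinct generators go to distinct labels.\<close>

lemma aut_letters:
  "\<exists>\<pi>. bij_betw (snd \<circ> \<pi>) B B \<and> (\<forall>b\<in>B. \<exists>g\<in>F. \<gamma> [(True, b)] = conjg g [\<pi> b])"
proof -
  obtain \<sigma> where \<sigma>: "bij_betw \<sigma> B B" "\<forall>b\<in>B. expo (\<sigma> b) (\<gamma> [(True, b)]) \<noteq> 0"
    using aut_transversal[OF fin \<gamma>] by blast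
  have "\<exists>x. snd x = \<sigma> b \<and> (\<exists>g\<in>F. \<gamma> [(True, b)] = conjg g [x])" if b: "b \<in> B" for b
  proof -
    have "\<gamma> [(True, b)] \<in> F" using aut_simps(1)[OF \<gamma>] b by simp
    moreover have "\<gamma> [(True, b)] \<noteq> []" using \<sigma>(2) b by auto
    ultimately obtain g v where gv: "g \<in> F" "v \<in> F" "\<gamma> [(True, b)] = conjg g v" "edges (cyc (\<gamma> [(True, b)])) = length v"
      using edges_cyc_decomp[OF fin] by blast
    then obtain x where x: "v = [x]" using one[OF b] by (auto simp: length_Suc_conv)
    have "expo (\<sigma> b) (conjg g [x]) = expo (\<sigma> b) [x]" using gv x by (simp add: conjg_def expo_mul)
    then have "snd x = \<sigma> b" using \<sigma>(2) b gv(3) x by (auto split: if_splits)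
    then show ?thesis using gv x by blast
  qed
  then obtain \<pi> where \<pi>: "\<And>b. b \<in> B \<Longrightarrow> snd (\<pi> b) = \<sigma> b \<and> (\<exists>g\<in>F. \<gamma> [(True, b)] = conjg g [\<pi> b])" by metis
  then have "bij_betw (snd \<circ> \<pi>) B B" using \<sigma>(1) bij_betw_cong[of B "snd \<circ> \<pi>" \<sigma> B] by simp
  then show ?thesis using \<pi> by blast
qed

text \<open>The product is conjugate to \<open>x v y v^-1\<close> with \<open>v = g h^-1\<close>, so
  its cyclic length tells whether the two conjugators agree up to powers of \<open>x\<close> and
  \<open>y\<close>.\<close>

lemma edges_pair:
  assumes "b \<in> B" "c \<in> B" "snd x \<in> B" "snd y \<in> B" "snd x \<noteq> snd y" "g \<in> F" "h \<in> F"
    "\<gamma> [(True, b)] = conjg g [x]" "\<gamma> [(True, c)] = conjg h [y]"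
  shows "edges (cyc (\<gamma> [(True, b), (True, c)])) \<ge> 2"
    and "edges (cyc (\<gamma> [(True, b), (True, c)])) \<le> 2 \<Longrightarrow> \<exists>i j. g \<cdot> winv h = [x] ^^^^ i \<cdot> [y] ^^^^ j"
proof -
  have xy: "[x] \<in> F" "[y] \<in> F" using assms by auto
  let ?v = "g \<cdot> winv h" let ?w = "[x] \<cdot> (?v \<cdot> [y] \<cdot> winv ?v)"
  have bc: "[(True, b), (True, c)] \<in> F" using assms by (simp add: Cons_F letter_inv_def)
  have "\<gamma> [(True, b), (True, c)] = conjg g [x] \<cdot> conjg h [y]"
    using aut_simps(2)[OF \<gamma>, of "[(True, b)]" "[(True, c)]"] mul_append[of "[(True, b)]" "[(True, c)]"] bc assms by simp
  also have "\<dots> = conjg g ([x] \<cdot> (?v \<cdot> [y] \<cdot> ginv ?v))"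
    using assms(6,7) xy by (simp add: conjg_def inv_mult_group m_assoc del: ginv_eq flip: ginv_eq[OF assms(7)])
  finally have "\<gamma> [(True, b), (True, c)] = conjg g ?w" using assms(6,7) by simp
  then have "edges (cyc (\<gamma> [(True, b), (True, c)])) = edges (cyc ?w)"
    using edges_cyc_conjg[OF fin, of ?w g] assms(6,7) xy by simp
  then show "edges (cyc (\<gamma> [(True, b), (True, c)])) \<ge> 2"
    "edges (cyc (\<gamma> [(True, b), (True, c)])) \<le> 2 \<Longrightarrow> \<exists>i j. g \<cdot> winv h = [x] ^^^^ i \<cdot> [y] ^^^^ j"
    using edges_product_of_conjugates[OF fin assms(3-5), of ?v] assms(6,7) by simp_all
qed

text \<open>Any two conjugators agree up to powers of the two letters, and such powers can be
  absorbed since they commute with those letters. Two generators fix a common conjugator; any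
  further one is compared with both.\<close>

lemma signed_permutation_of_edges:
  assumes two: "\<And>b c. b \<in> B \<Longrightarrow> c \<in> B \<Longrightarrow> b \<noteq> c \<Longrightarrow> edges (cyc (\<gamma> [(True, b), (True, c)])) \<le> 2"
  shows "signed_permutation \<gamma>"
proof -
  obtain \<pi> where bij: "bij_betw (snd \<circ> \<pi>) B B" and \<pi>: "\<And>b. b \<in> B \<Longrightarrow> \<exists>g\<in>F. \<gamma> [(True, b)] = conjg g [\<pi> b]"
    using aut_letters by blast
  have \<pi>B: "snd (\<pi> b) \<in> B" if "b \<in> B" for b using bij that by (auto simp: bij_betw_def)
  have \<pi>F: "[\<pi> b] \<in> F" if "b \<in> B" for b using \<pi>B that by simp
  have ne: "snd (\<pi> b) \<noteq> snd (\<pi> c)" if "b \<in> B" "c \<in> B" "b \<noteq> c" for b c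
    using bij that by (auto simp: bij_betw_def inj_on_def)
  have shift: "\<gamma> [(True, b)] = conjg ([\<pi> b] ^^^^ i \<cdot> g) [\<pi> b]" if "b \<in> B" "g \<in> F" "\<gamma> [(True, b)] = conjg g [\<pi> b]" for b g i
    using that \<pi>F[OF that(1)] conjg_conjg[of "[\<pi> b] ^^^^ i" g "[\<pi> b]"] conjg_int_pow_self[of "[\<pi> b]" i] by simp
  have pair: "\<exists>i j. g \<cdot> winv h = [\<pi> b] ^^^^ i \<cdot> [\<pi> c] ^^^^ j"
    if "b \<in> B" "c \<in> B" "b \<noteq> c" "g \<in> F" "h \<in> F" "\<gamma> [(True, b)] = conjg g [\<pi> b]" "\<gamma> [(True, c)] = conjg h [\<pi> c]" for b c g h
    using edges_pair(2)[of b c "\<pi> b" "\<pi> c" g h] two that \<pi>B ne by simp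
  have swap: "k = u \<cdot> h" if "k \<in> F" "h \<in> F" "u \<in> F" "k \<cdot> winv h = u" for k h u
    using that by (metis ginv_eq inv_solve_right')
  have "\<exists>k\<in>F. \<forall>b\<in>B. \<gamma> [(True, b)] = conjg k [\<pi> b]"
  proof (cases "\<exists>b\<in>B. \<exists>c\<in>B. b \<noteq> c")
    case False
    then have "B = {} \<or> (\<exists>b. B = {b})" by blast
    then show ?thesis using \<pi> Nil_F by blast
  next
    case True
    then obtain b c where bc: "b \<in> B" "c \<in> B" "b \<noteq> c" by blast
    obtain g where g: "g \<in> F" "\<gamma> [(True, b)] = conjg g [\<pi> b]" using \<pi> bc by blast
    obtain h where h: "h \<in> F" "\<gamma> [(True, c)] = conjg h [\<pi> c]" using \<pi> bc by blast
    obtain i j where ij: "g \<cdot> winv h = [\<pi> b] ^^^^ i \<cdot> [\<pi> c] ^^^^ j" using pair[OF bc g(1) h(1) g(2) h(2)] by blast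
    \<comment> \<open>Absorbing one power on each side gives a conjugator valid for both
      \<open>b\<close> and \<open>c\<close>.\<close>
    define k where "k = [\<pi> c] ^^^^ j \<cdot> h"
    have kF: "k \<in> F" using \<pi>F bc h by (simp add: k_def)
    have kc: "\<gamma> [(True, c)] = conjg k [\<pi> c]" unfolding k_def by (rule shift[OF bc(2) h])
    have "g = [\<pi> b] ^^^^ i \<cdot> k" using swap[OF g(1) h(1) _ ij] \<pi>F bc h by (simp add: k_def m_assoc)
    then have "k = [\<pi> b] ^^^^ (- i) \<cdot> g"
      using \<pi>F[OF bc(1)] kF by (simp add: int_pow_neg del: ginv_eq)
    then have kb: "\<gamma> [(True, b)] = conjg k [\<pi> b]" using shift[OF bc(1) g, of "- i"] by simp
    have "\<gamma> [(True, d)] = conjg k [\<pi> d]" if d: "d \<in> B" "d \<noteq> b" "d \<noteq> c" for d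
    proof -
      obtain h where h: "h \<in> F" "\<gamma> [(True, d)] = conjg h [\<pi> d]" using \<pi> d by blast
      obtain i j where ij: "k \<cdot> winv h = [\<pi> b] ^^^^ i \<cdot> [\<pi> d] ^^^^ j" using pair[OF bc(1) d(1) _ kF h(1) kb h(2)] d by blast
      obtain i' j' where ij': "k \<cdot> winv h = [\<pi> c] ^^^^ i' \<cdot> [\<pi> d] ^^^^ j'" using pair[OF bc(2) d(1) _ kF h(1) kc h(2)] d by blast
      \<comment> \<open>The element \<open>k h^-1\<close> has two expressions, and the label of
        \<open>\<pi> b\<close> occurs in only one of them, so its exponent \<open>i\<close>
        vanishes.\<close>
      have "expo (snd (\<pi> b)) ([\<pi> b] ^^^^ i \<cdot> [\<pi> d] ^^^^ j) = expo (snd (\<pi> b)) ([\<pi> c] ^^^^ i' \<cdot> [\<pi> d] ^^^^ j')"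
        using ij ij' by simp
      then have "i = 0"
        using \<pi>F[OF bc(1)] \<pi>F[OF bc(2)] \<pi>F[OF d(1)] ne[OF bc(1) d(1)] ne[OF bc] d
        by (auto simp: expo_mul expo_int_pow split: if_splits)
      then have "k = [\<pi> d] ^^^^ j \<cdot> h" using swap[OF kF h(1) _ ij] \<pi>F d by simp
      then show ?thesis using shift[OF d(1) h] by simp
    qed
    then show ?thesis using kb kc kF by (metis (full_types))
  qed
  then show ?thesis unfolding signed_permutation_def using bij by blast
qed

end

text \<open>Generators have one core edge and products of two distinct generators have two. One edge
  is the least possible for a generator; two is the least for a product once the generators go to
  conjugates of letters, so the generators must be settled first.\<close>

lemma test_list:
  assumes fin: "finite B"
  shows "\<exists>W. fg_list W \<and> (\<forall>\<gamma>\<in>aut B. complexity B (act \<gamma> W) \<le> complexity B W \<longrightarrow> signed_permutation \<gamma>)"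
proof -
  obtain bs where bs: "set bs = B" "distinct bs" using finite_distinct_list[OF fin] by blast
  define ps where "ps = filter (\<lambda>(b, c). b \<noteq> c) (List.product bs bs)"
  have ps: "set ps = {(b, c). b \<in> B \<and> c \<in> B \<and> b \<noteq> c}" "distinct ps"
    using bs by (auto simp: ps_def distinct_product)
  define W1 where "W1 = map (\<lambda>b. cyc [(True, b)]) bs"
  define W2 where "W2 = map (\<lambda>(b, c). cyc [(True, b), (True, c)]) ps"
  \<comment> \<open>One surplus edge on a generator, repeated \<open>N\<close> times, has to
    outweigh the total \<open>2 * length ps\<close> of all pairs; hence the extra 1.\<close>
  define N where "N = 2 * length ps + 1"
  define W where "W = concat (replicate N W1) @ W2"
  have F1: "[(True, b)] \<in> F" if "b \<in> B" for b using that by simp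
  have F2: "[(True, b), (True, c)] \<in> F" if "b \<in> B" "c \<in> B" for b c using that by (simp add: Cons_F letter_inv_def)
  have act1: "complexity B (act \<gamma> W1) = (\<Sum>b\<in>B. edges (cyc (\<gamma> [(True, b)])))" if "\<gamma> \<in> aut B" for \<gamma>
    unfolding complexity_sum_list act_def W1_def
    using bs image_cyc[OF that F1] by (simp add: sum_list_distinct_conv_sum_set o_def)
  have act2: "complexity B (act \<gamma> W2) = (\<Sum>(b, c)\<in>set ps. edges (cyc (\<gamma> [(True, b), (True, c)])))" if "\<gamma> \<in> aut B" for \<gamma>
  proof -
    have "complexity B (act \<gamma> W2) = (\<Sum>p\<in>set ps. edges (\<gamma> ` (case p of (b, c) \<Rightarrow> cyc [(True, b), (True, c)])))"
      unfolding complexity_sum_list act_def W2_def using ps by (simp add: sum_list_distinct_conv_sum_set o_def)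
    also have "\<dots> = (\<Sum>(b, c)\<in>set ps. edges (cyc (\<gamma> [(True, b), (True, c)])))"
      using image_cyc[OF that F2] ps by (intro sum.cong) auto
    finally show ?thesis .
  qed
  have actW: "complexity B (act \<gamma> W) = N * complexity B (act \<gamma> W1) + complexity B (act \<gamma> W2)" for \<gamma>
    by (simp add: W_def act_append act_concat_replicate complexity_append complexity_concat_replicate)
  have fg1: "fg_list W1" using bs fg_subgroup_cyc F1 by (auto simp: fg_list_def W1_def)
  have fg2: "fg_list W2" using ps fg_subgroup_cyc F2 by (auto simp: fg_list_def W2_def)
  have fgW: "fg_list W" using fg1 fg2 by (auto simp: fg_list_def W_def)
  have id: "id \<in> aut B" by (simp add: aut_def id_iso)
  have actid: "act id Hs = Hs" for Hs :: "'b word set list" by (simp add: act_def)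
  have "complexity B W1 = card B"
    using act1[OF id] card_core_edges_cyc[OF fin F1] by (simp add: actid cyclically_reduced_def)
  moreover have "complexity B W2 = 2 * length ps"
  proof -
    have "edges (cyc [(True, b), (True, c)]) = 2" if "b \<in> B" "c \<in> B" for b c
      using card_core_edges_cyc[OF fin F2[OF that]] by (simp add: cyclically_reduced_def letter_inv_def)
    then have "(\<Sum>(b, c)\<in>set ps. edges (cyc [(True, b), (True, c)])) = (\<Sum>p\<in>set ps. 2)"
      using ps by (intro sum.cong) auto
    then have "complexity B W2 = (\<Sum>p\<in>set ps. 2)" using act2[OF id] by (simp add: actid)
    then show ?thesis using distinct_card[OF ps(2)] by simp
  qed
  ultimately have cW: "complexity B W = N * card B + 2 * length ps" using actW[of id] by (simp add: actid)
  have "signed_permutation \<gamma>" if \<gamma>: "\<gamma> \<in> aut B" and le: "complexity B (act \<gamma> W) \<le> complexity B W" for \<gamma>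
  proof -
    have ge1: "edges (cyc (\<gamma> [(True, b)])) \<ge> 1" if "b \<in> B" for b
      using edges_cyc_aut_pos[OF fin \<gamma> F1[OF that]] by simp
    have one: "edges (cyc (\<gamma> [(True, b)])) = 1" if b: "b \<in> B" for b
    proof (rule ccontr)
      assume "edges (cyc (\<gamma> [(True, b)])) \<noteq> 1"
      then have "edges (cyc (\<gamma> [(True, b)])) > 1" using ge1[OF b] by simp
      then have "(\<Sum>b\<in>B. 1) < (\<Sum>b\<in>B. edges (cyc (\<gamma> [(True, b)])))"
        using b ge1 fin by (intro sum_strict_mono_ex1) auto
      then have "N * (card B + 1) \<le> N * complexity B (act \<gamma> W1)" using act1[OF \<gamma>] by (intro mult_le_mono2) simp
      then show False using le actW[of \<gamma>] cW by (simp add: N_def)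
    qed
    have "\<exists>\<pi>. bij_betw (snd \<circ> \<pi>) B B \<and> (\<forall>b\<in>B. \<exists>g\<in>F. \<gamma> [(True, b)] = conjg g [\<pi> b])"
      by (rule aut_letters[OF fin \<gamma> one])
    then obtain \<pi> where bij: "bij_betw (snd \<circ> \<pi>) B B" and \<pi>: "\<forall>b\<in>B. \<exists>g\<in>F. \<gamma> [(True, b)] = conjg g [\<pi> b]" by blast
    have ge2: "edges (cyc (\<gamma> [(True, b), (True, c)])) \<ge> 2" if bc: "b \<in> B" "c \<in> B" "b \<noteq> c" for b c
    proof -
      obtain g where g: "g \<in> F" "\<gamma> [(True, b)] = conjg g [\<pi> b]" using \<pi> bc by blast
      obtain h where h: "h \<in> F" "\<gamma> [(True, c)] = conjg h [\<pi> c]" using \<pi> bc by blast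
      have \<pi>bc: "snd (\<pi> b) \<in> B" "snd (\<pi> c) \<in> B" "snd (\<pi> b) \<noteq> snd (\<pi> c)"
        using bij bc by (auto simp: bij_betw_def inj_on_def)
      show ?thesis
        by (rule edges_pair(1)[where x = "\<pi> b" and y = "\<pi> c" and g = g and h = h]; fact fin \<gamma> one bc \<pi>bc g h)
    qed
    have two: "edges (cyc (\<gamma> [(True, b), (True, c)])) \<le> 2" if bc: "b \<in> B" "c \<in> B" "b \<noteq> c" for b c
    proof (rule ccontr)
      assume "\<not> ?thesis"
      then have "\<exists>p\<in>set ps. 2 < (case p of (b, c) \<Rightarrow> edges (cyc (\<gamma> [(True, b), (True, c)])))"
        using bc ps by (intro bexI[of _ "(b, c)"]) auto
      then have "(\<Sum>p\<in>set ps. 2) < (\<Sum>(b, c)\<in>set ps. edges (cyc (\<gamma> [(True, b), (True, c)])))"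
        using ge2 ps by (intro sum_strict_mono_ex1[OF finite_set]) auto
      then have "2 * length ps < complexity B (act \<gamma> W2)" using act2[OF \<gamma>] distinct_card[OF ps(2)] by simp
      moreover have "complexity B (act \<gamma> W1) = card B" using act1[OF \<gamma>] one by simp
      ultimately show False using le actW[of \<gamma>] cW by simp
    qed
    show ?thesis using signed_permutation_of_edges[OF fin \<gamma> one two] .
  qed
  then show ?thesis using fgW by blast
qed

text \<open>The local-to-global principle is applied to many copies of \<open>Y\<close> followed by
  the test sequence, so that one combined complexity encodes a lexicographic pair.\<close>

theorem whitehead_descent:
  assumes fin: "finite B" and fg: "fg_list Y" and W: "fg_list W" "\<And>\<gamma>. \<gamma> \<in> aut B \<Longrightarrow> complexity B (act \<gamma> W) \<le> complexity B W \<Longrightarrow> signed_permutation \<gamma>"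
    and min: "\<And>\<alpha>. \<alpha> \<in> aut B \<Longrightarrow> complexity B Y \<le> complexity B (act \<alpha> Y)" and \<gamma>: "\<gamma> \<in> aut B"
  shows "signed_permutation \<gamma> \<or> (\<exists>a A. snd a \<in> B \<and> a \<in> A \<and> letter_inv a \<notin> A \<and>
    (complexity B (act (whitehead a A \<circ> \<gamma>) Y) < complexity B (act \<gamma> Y) \<or>
     complexity B (act (whitehead a A \<circ> \<gamma>) Y) = complexity B (act \<gamma> Y) \<and>
     complexity B (act (whitehead a A \<circ> \<gamma>) W) < complexity B (act \<gamma> W)))"
proof -
  \<comment> \<open>Larger than the test complexity at \<open>\<gamma>\<close>, so that a strict
    drop of the combined complexity cannot hide an increase for \<open>Y\<close>.\<close>
  define N where "N = complexity B (act \<gamma> W) + 1"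
  define K where "K = concat (replicate N Y) @ W"
  have fgK: "fg_list K" using fg W by (auto simp: K_def fg_list_def)
  have act: "complexity B (act \<alpha> K) = N * complexity B (act \<alpha> Y) + complexity B (act \<alpha> W)" for \<alpha>
    by (simp add: K_def act_append act_concat_replicate complexity_append complexity_concat_replicate)
  have cK: "complexity B K = N * complexity B Y + complexity B W"
    by (simp add: K_def complexity_append complexity_concat_replicate)
  show ?thesis
  proof (cases "complexity B (act \<gamma> K) \<le> complexity B K")
    \<comment> \<open>Since \<open>Y\<close> is minimal, its share cannot have decreased, so the
      test part already satisfies its bound.\<close>
    case True
    then have "N * complexity B (act \<gamma> Y) + complexity B (act \<gamma> W) \<le> N * complexity B Y + complexity B W"
      using act cK by simp
    moreover have "N * complexity B Y \<le> N * complexity B (act \<gamma> Y)" using min[OF \<gamma>] by simp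
    ultimately show ?thesis using W(2)[OF \<gamma>] by linarith
  next
    case False
    obtain \<beta> where \<beta>: "\<beta> \<in> aut B" "\<forall>w\<in>F. \<beta> (\<gamma> w) = w" using aut_inverse[OF \<gamma>] by blast
    have "act \<beta> (act \<gamma> K) = K" unfolding act_comp by (rule act_id[OF fgK]) (use \<beta> in simp)
    then have "complexity B (act \<beta> (act \<gamma> K)) < complexity B (act \<gamma> K)" using False by simp
    then obtain A a where a: "snd a \<in> B" "a \<in> A" "letter_inv a \<notin> A" "cut (act \<gamma> K) (hdset A) < cut (act \<gamma> K) (hdset {a})"
      using reducing_half_space[OF fin fg_list_act[OF \<gamma> fgK] \<beta>(1)] by blast
    then have "complexity B (act (whitehead a A) (act \<gamma> K)) < complexity B (act \<gamma> K)"
      using complexity_whitehead[OF fin fg_list_act[OF \<gamma> fgK] a(1-3)] by linarith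
    then have lt: "N * complexity B (act (whitehead a A \<circ> \<gamma>) Y) + complexity B (act (whitehead a A \<circ> \<gamma>) W)
        < N * complexity B (act \<gamma> Y) + complexity B (act \<gamma> W)"
      unfolding act_comp act .
    have "complexity B (act (whitehead a A \<circ> \<gamma>) Y) \<le> complexity B (act \<gamma> Y)"
    proof (rule ccontr)
      assume "\<not> ?thesis"
      then have "N * (complexity B (act \<gamma> Y) + 1) \<le> N * complexity B (act (whitehead a A \<circ> \<gamma>) Y)" by (intro mult_le_mono2) simp
      then show False using lt by (simp add: N_def)
    qed
    moreover have "complexity B (act (whitehead a A \<circ> \<gamma>) W) < complexity B (act \<gamma> W)"
      if "complexity B (act (whitehead a A \<circ> \<gamma>) Y) = complexity B (act \<gamma> Y)" using lt that by simp
    ultimately show ?thesis using a by (metis le_neq_implies_less)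
  qed
qed

end

section \<open>Cleavings in terms of subgroups\<close>

context free_grp
begin

definition words_over :: "'b set \<Rightarrow> 'b word set" where
  "words_over D = {w\<in>F. snd ` set w \<subseteq> D}"

text \<open>A subgroup splits along \<open>D\<close> if it is generated by its elements over \<open>D\<close> and its elements over the complement
  of \<open>D\<close>: the places where a word changes sides are returns to the base point.\<close>

definition splits :: "'b set \<Rightarrow> 'b word set \<Rightarrow> bool" where
  "splits D L \<longleftrightarrow> (\<forall>u v. u @ v \<in> L \<longrightarrow> u \<noteq> [] \<longrightarrow> v \<noteq> [] \<longrightarrow> (snd (last u) \<in> D) \<noteq> (snd (hd v) \<in> D) \<longrightarrow> u \<in> L)"

definition heads :: "'b word set \<Rightarrow> 'b letter set" where
  "heads L = hd ` (L - {[]})"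

text \<open>Two distinct first letters occur in \<open>L\<close> iff the base vertex \<open>L\<close> of its covering graph lies in the core.\<close>

definition core_based :: "'b word set \<Rightarrow> bool" where
  "core_based L \<longleftrightarrow> (\<exists>x\<in>heads L. \<exists>y\<in>heads L. x \<noteq> y)"

section \<open>Directions at the vertices of the covering graph\<close>

lemma crosses_heads: "L \<subseteq> F \<Longrightarrow> crosses (hdset A) L \<longleftrightarrow> (\<exists>x\<in>heads L. \<exists>y\<in>heads L. x \<in> A \<and> y \<notin> A)"
  by (auto simp: crosses_hdset heads_def)

lemma crosses_letter: "L \<subseteq> F \<Longrightarrow> crosses (hdset {y}) L \<longleftrightarrow> y \<in> heads L \<and> core_based L"
  unfolding crosses_heads core_based_def by (metis singleton_iff)

lemma heads_B: "L \<subseteq> F \<Longrightarrow> y \<in> heads L \<Longrightarrow> snd y \<in> B"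
proof -
  assume "L \<subseteq> F" "y \<in> heads L"
  then obtain l where "l \<in> F" "l \<noteq> []" "y = hd l" by (auto simp: heads_def)
  then show ?thesis by (cases l) (auto simp: Cons_F)
qed

text \<open>A factor shorter than \<open>w\<close> cancels only inside \<open>w\<close> and never
  reaches its first letter.\<close>

lemma mul_keep_prefix:
  assumes "u @ w \<in> F" "q \<in> F" "length q < length w"
  shows "\<exists>r. (u @ w) \<cdot> q = u @ hd w # r"
proof -
  obtain p s r where psr: "u @ w = p @ s" "q = winv s @ r" "(u @ w) \<cdot> q = p @ r"
    using mul_cancel[OF assms(1,2)] by blast
  have "length s < length w" using assms(3) psr(2) by simp
  then obtain t where t: "p = u @ t" "w = t @ s" "t \<noteq> []"
    using psr(1) by (auto simp: append_eq_append_conv2)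
  then show ?thesis using psr(3) by (cases t) auto
qed

lemma pow_ne: "m \<in> F \<Longrightarrow> m \<noteq> [] \<Longrightarrow> n > 0 \<Longrightarrow> m ^^^ n \<noteq> []"
  using length_pow[of m n] by auto

lemma subgroup_pow: "subgroup L (free_group B) \<Longrightarrow> l \<in> L \<Longrightarrow> l ^^^ n \<in> L"
  by (induction n) (simp_all add: subgroup.m_closed subgroup.one_closed[of L "free_group B", simplified])

text \<open>Walk along \<open>g\<close>, run around a loop that leaves by \<open>y\<close> often
  enough that the way back cannot cancel it, then return along \<open>g^-1\<close>.\<close>

lemma prefix_of_head:
  assumes L: "subgroup L (free_group B)" and g: "g \<in> F" and y: "y \<in> heads (conjg g ` L)" "g \<noteq> [] \<Longrightarrow> y \<noteq> letter_inv (last g)"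
  shows "\<exists>v. g @ y # v \<in> L"
proof -
  obtain l where l: "l \<in> L" "conjg g l \<noteq> []" "y = hd (conjg g l)" using y(1) by (auto simp: heads_def)
  have lF: "l \<in> F" using l L subgroup.mem_carrier by metis
  \<comment> \<open>The power has length at least \<open>n\<close>, one more than the return
    path.\<close>
  define m n where "m = conjg g l" and "n = length g + 1"
  have m: "m \<in> F" "m \<noteq> []" using l lF g by (auto simp: m_def)
  have mn: "hd (m ^^^ n) = y" "m ^^^ n \<noteq> []" "length g < length (m ^^^ n)"
    using hd_pow[OF m, of n] pow_ne[OF m, of n] length_pow[OF m, of n] l m_def n_def by auto
  have gm: "g @ m ^^^ n \<in> F" using g m mn y(2) by (subst append_F) auto
  have "(g @ m ^^^ n) \<cdot> winv g = g \<cdot> conjg g (l ^^^ n) \<cdot> ginv g"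
    using mul_append[OF gm] conjg_pow[OF g lF, of n] g by (simp add: m_def)
  also have "\<dots> = l ^^^ n" using g lF by (simp add: conjg_def m_assoc del: ginv_eq)
  finally have "(g @ m ^^^ n) \<cdot> winv g \<in> L" using subgroup_pow[OF L l(1)] by simp
  moreover obtain r where "(g @ m ^^^ n) \<cdot> winv g = g @ y # r" using mul_keep_prefix[OF gm, of "winv g"] g mn by auto
  ultimately show ?thesis by metis
qed

text \<open>One of the two directions lies on the opposite side from the last letter of
  \<open>g\<close>. Continuing there completes \<open>g\<close> to an element of \<open>L\<close>
  that changes sides at \<open>g\<close>, so the splitting puts \<open>g\<close> into
  \<open>L\<close>.\<close>

lemma both_sides:
  assumes L: "subgroup L (free_group B)" and s: "splits D L" and g: "g \<in> F"
    and x: "x \<in> heads (conjg g ` L)" "snd x \<in> D" and y: "y \<in> heads (conjg g ` L)" "snd y \<notin> D"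
  shows "g \<in> L"
proof (cases "g = []")
  case True
  then show ?thesis using subgroup.one_closed[OF L] by simp
next
  case False
  obtain z where z: "z \<in> heads (conjg g ` L)" "(snd (last g) \<in> D) \<noteq> (snd z \<in> D)" using x y by blast
  then obtain v where "g @ z # v \<in> L" using prefix_of_head[OF L g, of z] by fastforce
  then show ?thesis using s False z unfolding splits_def by (metis list.discI list.sel(1))
qed

text \<open>Two directions at the base leave one that does not cancel against the path back to it. A
  power longer than \<open>u\<close> of an element in that direction keeps the wanted first letter
  at the vertex of \<open>u\<close> visible.\<close>

lemma heads_at_prefix:
  assumes L: "subgroup L (free_group B)" and cb: "core_based L" and uv: "u @ v \<in> L"
  shows "u \<noteq> [] \<Longrightarrow> letter_inv (last u) \<in> heads (conjg u ` L)" and "v \<noteq> [] \<Longrightarrow> hd v \<in> heads (conjg u ` L)"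
proof -
  have uvF: "u @ v \<in> F" using uv L subgroup.mem_carrier by metis
  then have F: "u \<in> F" "v \<in> F" using append_F by blast+
  have pick: "\<exists>k\<in>L. k \<in> F \<and> k \<noteq> [] \<and> hd k \<noteq> x" for x
    using cb L subgroup.mem_carrier unfolding core_based_def heads_def by (smt (verit) DiffD1 DiffD2 imageE singletonI)
  define n where "n = length u + 1"
  show "letter_inv (last u) \<in> heads (conjg u ` L)" if ne: "u \<noteq> []"
  proof -
    obtain k where k: "k \<in> L" "k \<in> F" "k \<noteq> []" "hd k \<noteq> hd u" using pick by blast
    have kn: "hd (k ^^^ n) = hd k" "k ^^^ n \<noteq> []" "length u < length (k ^^^ n)"
      using hd_pow[OF k(2,3), of n] pow_ne[OF k(2,3), of n] length_pow[OF k(2,3), of n] n_def by auto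
    have w: "winv u @ k ^^^ n \<in> F" using F k kn ne by (subst append_F) auto
    obtain r where r: "(winv u @ k ^^^ n) \<cdot> u = winv u @ hd (k ^^^ n) # r" using mul_keep_prefix[OF w F(1)] kn by auto
    have "conjg u (k ^^^ n) = winv u @ hd (k ^^^ n) # r" using r mul_append[OF w] F by (simp add: conjg_def)
    then have "winv u @ hd (k ^^^ n) # r \<in> conjg u ` L" using subgroup_pow[OF L k(1), of n] by (metis imageI)
    then show ?thesis using ne unfolding heads_def
      by (intro image_eqI[of _ _ "winv u @ hd (k ^^^ n) # r"]) auto
  qed
  show "hd v \<in> heads (conjg u ` L)" if ne: "v \<noteq> []"
  proof -
    obtain k where k: "k \<in> L" "k \<in> F" "k \<noteq> []" "hd k \<noteq> letter_inv (last v)" using pick by blast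
    have kn: "hd (k ^^^ n) = hd k" "k ^^^ n \<noteq> []" "length u < length (k ^^^ n)"
      using hd_pow[OF k(2,3), of n] pow_ne[OF k(2,3), of n] length_pow[OF k(2,3), of n] n_def by auto
    have w: "v @ k ^^^ n \<in> F" using F k kn ne by (subst append_F) auto
    obtain r where r: "(v @ k ^^^ n) \<cdot> u = v @ hd (k ^^^ n) # r" using mul_keep_prefix[OF w F(1)] kn by auto
    have "conjg u ((u @ v) \<cdot> k ^^^ n) = ginv u \<cdot> (u \<cdot> v \<cdot> k ^^^ n) \<cdot> u"
      using mul_append[OF uvF] by (simp add: conjg_def)
    also have "\<dots> = v \<cdot> k ^^^ n \<cdot> u" using F k by (simp add: m_assoc del: ginv_eq)
    also have "\<dots> = v @ hd (k ^^^ n) # r" using r mul_append[OF w] by simp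
    finally have "conjg u ((u @ v) \<cdot> k ^^^ n) = v @ hd (k ^^^ n) # r" .
    then have "v @ hd (k ^^^ n) # r \<in> conjg u ` L"
      using subgroup.m_closed[OF L uv subgroup_pow[OF L k(1), of n]] by (metis imageI)
    then show ?thesis using ne unfolding heads_def
      by (intro image_eqI[of _ _ "v @ hd (k ^^^ n) # r"]) auto
  qed
qed

lemma core_based_at_prefix:
  assumes L: "subgroup L (free_group B)" and cb: "core_based L" and uv: "u @ v \<in> L" "v \<noteq> []"
  shows "core_based (conjg u ` L)"
proof (cases "u = []")
  case True
  then show ?thesis using cb L by (simp add: conjg_image_one[simplified] subgroup.subset)
next
  case False
  have "u @ v \<in> F" using uv L subgroup.mem_carrier by metis
  then have "hd v \<noteq> letter_inv (last u)" using append_F[of u v] False uv by blast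
  then show ?thesis using heads_at_prefix[OF L cb uv(1)] False uv(2) unfolding core_based_def by blast
qed

lemma crosses_at_prefix:
  assumes "subgroup L (free_group B)" "core_based L" "u @ v \<in> L" "v \<noteq> []"
  shows "crosses (hdset {hd v}) (conjg u ` L)"
proof -
  have "u @ v \<in> F" using subgroup.mem_carrier[OF assms(1,3)] .
  then have "u \<in> F" using append_F by blast
  then have "conjg u ` L \<subseteq> F" using subgroup.subset[OF assms(1)] by simp
  then show ?thesis using crosses_letter[of "conjg u ` L"] heads_at_prefix(2)[OF assms(1-3)] core_based_at_prefix[OF assms] assms(4) by blast
qed

text \<open>The same edge seen from its other endpoint, where it carries the inverse letter.\<close>

lemma crosses_letter_inv:
  assumes "L \<subseteq> F" "snd z \<in> B"
  shows "crosses (hdset {letter_inv z}) (conjg [z] ` L) \<longleftrightarrow> crosses (hdset {z}) L"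
proof -
  have "crosses (hdset {letter_inv z}) (conjg [z] ` L) \<longleftrightarrow> crosses (translate [z] (hdset {letter_inv z})) L"
    using crosses_translate[OF assms(1) almost_invariant_hdset, of "[z]"] assms(2) by simp
  also have "\<dots> \<longleftrightarrow> crosses (- hdset {z}) L"
  proof -
    have "tends (translate [z] (hdset {letter_inv z})) l \<longleftrightarrow> tends (- hdset {z}) l" if "l \<in> L - {[]}" for l
    proof (rule tends_cong_finite)
      have "{g\<in>F. (g \<in> translate [z] (hdset {letter_inv z})) \<noteq> (g \<in> - hdset {z})} = {}"
        using translate_hdset_letter_inv[OF _ assms(2)] by blast
      then show "finite {g\<in>F. (g \<in> translate [z] (hdset {letter_inv z})) \<noteq> (g \<in> - hdset {z})}" by (simp only: finite.emptyI)
    qed (use that assms in auto)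
    then show ?thesis unfolding crosses_def by simp
  qed
  also have "\<dots> \<longleftrightarrow> crosses (hdset {z}) L" using crosses_Compl[OF assms(1)] by simp
  finally show ?thesis .
qed

subsection \<open>The core graph\<close>

abbreviation coset :: "'b word set \<Rightarrow> 'b word \<Rightarrow> 'b word set" where
  "coset H g \<equiv> H #>\<^bsub>free_group B\<^esub> g"

definition part :: "'b set \<Rightarrow> 'b word set \<Rightarrow> ('b word set \<times> 'b) set" where
  "part D H = {e \<in> core_edges B H. snd e \<in> D}"

lemma mem_part:
  assumes "subgroup H (free_group B)" "g \<in> F"
  shows "(coset H g, b) \<in> part D H \<longleftrightarrow> b \<in> D \<and> b \<in> B \<and> crosses (hdset {(True, b)}) (conjg g ` H)"
  unfolding part_def using mem_core_edges_iff[OF assms(1)] coset_in_cuts_iff[OF assms] by auto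

lemma core_edge_coset: "subgroup H (free_group B) \<Longrightarrow> e \<in> core_edges B H \<Longrightarrow> \<exists>g\<in>F. e = (coset H g, snd e)"
  using mem_core_edges_iff[of H "fst e" "snd e"] by (cases e) (auto simp: cuts_def)

lemma edge_tgt_coset: "subgroup H (free_group B) \<Longrightarrow> g \<in> F \<Longrightarrow> b \<in> B \<Longrightarrow> edge_tgt B (coset H g, b) = coset H (g \<cdot> [(True, b)])"
  by (simp add: edge_tgt_def gen_def coset_mult_assoc subgroup.subset)

text \<open>The adjacency relation inside \<open>graph_connected\<close>.\<close>

definition links :: "('b word set \<times> 'b) set \<Rightarrow> ('b word set \<times> 'b word set) set" where
  "links E = {(fst e, edge_tgt B e) | e. e \<in> E} \<union> {(edge_tgt B e, fst e) | e. e \<in> E}"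

lemma links_step:
  assumes H: "subgroup H (free_group B)" and k: "k \<in> F" and z: "snd z \<in> B" "snd z \<in> D"
    and cr: "crosses (hdset {z}) (conjg k ` H)"
  shows "(coset H k, coset H (k \<cdot> [z])) \<in> links (part D H)"
proof (cases "fst z")
  case True
  then have zz: "z = (True, snd z)" by (cases z) auto
  then have "(coset H k, snd z) \<in> part D H" using mem_part[OF H k] z cr by metis
  moreover have "edge_tgt B (coset H k, snd z) = coset H (k \<cdot> [z])" using edge_tgt_coset[OF H k z(1)] zz by metis
  ultimately show ?thesis unfolding links_def by force
next
  case False
  then have zz: "z = letter_inv (True, snd z)" by (cases z) (auto simp: letter_inv_def)
  let ?y = "(True, snd z)"
  have kz: "k \<cdot> [z] \<in> F" using k z by simp
  have sub: "conjg k ` H \<subseteq> F" using conjg_F k H subgroup.subset by metis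
  have "crosses (hdset {letter_inv z}) (conjg [z] ` conjg k ` H)" using crosses_letter_inv[OF sub z(1)] cr by simp
  moreover have "letter_inv z = ?y" using zz by (metis letter_inv_inv)
  ultimately have "crosses (hdset {?y}) (conjg (k \<cdot> [z]) ` H)"
    using conjg_image_image[of k "[z]" H] k z H subgroup.subset by (metis single_F)
  then have "(coset H (k \<cdot> [z]), snd z) \<in> part D H" using mem_part[OF H kz] z by simp
  moreover have "edge_tgt B (coset H (k \<cdot> [z]), snd z) = coset H k"
  proof -
    have "k \<cdot> [z] \<cdot> [?y] = k \<cdot> ([z] \<cdot> winv [z])" using k z zz \<open>letter_inv z = ?y\<close> by (simp add: m_assoc)
    then show ?thesis using edge_tgt_coset[OF H kz z(1)] k z by (simp del: winv_simps)
  qed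
  ultimately show ?thesis unfolding links_def by force
qed

text \<open>Positive letters account for outgoing edges, negative ones for incoming edges.\<close>

lemma verts_part_iff:
  assumes H: "subgroup H (free_group B)" and g: "g \<in> F" and D: "D \<subseteq> B"
  shows "coset H g \<in> verts B (part D H) \<longleftrightarrow> (\<exists>y. snd y \<in> D \<and> crosses (hdset {y}) (conjg g ` H))"
proof
  assume "coset H g \<in> verts B (part D H)"
  then consider e where "e \<in> part D H" "coset H g = fst e" | e where "e \<in> part D H" "coset H g = edge_tgt B e"
    unfolding verts_def by blast
  then show "\<exists>y. snd y \<in> D \<and> crosses (hdset {y}) (conjg g ` H)"
  proof cases
    case 1
    then show ?thesis using mem_part[OF H g, of "snd e" D] by (metis prod.collapse snd_conv)
  next
    case 2
    then obtain k where k: "k \<in> F" "e = (coset H k, snd e)" using core_edge_coset[OF H] unfolding part_def by blast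
    have b: "snd e \<in> B" "snd e \<in> D" "crosses (hdset {(True, snd e)}) (conjg k ` H)"
      using mem_part[OF H k(1), of "snd e" D] 2 k(2) by auto
    let ?z = "(True, snd e)"
    have "coset H g = coset H (k \<cdot> [?z])" using edge_tgt_coset[OF H k(1) b(1)] 2(2) k(2) by metis
    then have "conjg g ` H = conjg [?z] ` conjg k ` H"
      using conjg_image_coset[OF H g, of "k \<cdot> [?z]"] conjg_image_image[of k "[?z]" H] k b H subgroup.subset[OF H] by simp
    moreover have "conjg k ` H \<subseteq> F" using conjg_F k H subgroup.subset by metis
    ultimately have "crosses (hdset {letter_inv ?z}) (conjg g ` H)" using crosses_letter_inv[of "conjg k ` H" ?z] b by simp
    then show ?thesis using b(2) by (metis snd_conv snd_letter_inv)
  qed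
next
  assume "\<exists>y. snd y \<in> D \<and> crosses (hdset {y}) (conjg g ` H)"
  then obtain y where y: "snd y \<in> D" "crosses (hdset {y}) (conjg g ` H)" by blast
  then have "(coset H g, coset H (g \<cdot> [y])) \<in> links (part D H)" using links_step[OF H g] D by blast
  then show "coset H g \<in> verts B (part D H)" unfolding links_def verts_def by force
qed

lemma vert_coset:
  assumes H: "subgroup H (free_group B)" and x: "x \<in> verts B (part D H)"
  shows "\<exists>g\<in>F. x = coset H g"
proof -
  obtain e where e: "e \<in> core_edges B H" "x = fst e \<or> x = edge_tgt B e" using x by (auto simp: verts_def part_def)
  then obtain g where g: "g \<in> F" "e = (coset H g, snd e)" using core_edge_coset[OF H] by blast
  have "snd e \<in> B" using e by (auto simp: core_edges_def)
  then have "edge_tgt B e = coset H (g \<cdot> [(True, snd e)])" "g \<cdot> [(True, snd e)] \<in> F"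
    using edge_tgt_coset[OF H g(1)] g by (metis, simp)
  then show ?thesis using e g by (metis fst_conv)
qed

lemma sym_links: "sym (links E)"
  by (auto simp: links_def sym_def)

text \<open>A path from the base to a vertex of the part is cut at its last change of sides. The
  splitting turns the initial piece into a loop, and the remaining piece stays within the
  part.\<close>

lemma part_connected:
  assumes H: "subgroup H (free_group B)" and g: "g \<in> F" and D: "D \<subseteq> B"
    and cb: "core_based (conjg g ` H)" and sp: "splits D (conjg g ` H)" and x: "x \<in> verts B (part D H)"
  shows "(coset H g, x) \<in> (links (part D H))\<^sup>*"
proof -
  let ?L = "conjg g ` H"
  have L: "subgroup ?L (free_group B)" using conjg_subgroup g H by blast
  have Lsub: "?L \<subseteq> F" using subgroup.subset[OF L] .
  obtain k where k: "k \<in> F" "x = coset H k" using vert_coset[OF H x] by blast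
  define u where "u = winv g \<cdot> k"
  have uF: "u \<in> F" and gu: "g \<cdot> u = k" using g k inv_cancel_left(2)[of g k] by (simp_all add: u_def)
  have conjg_gu: "conjg p ` ?L = conjg (g \<cdot> p) ` H" if "p \<in> F" for p
    using conjg_image_image[OF g that] H subgroup.subset by blast
  have coset_L: "coset H (g \<cdot> p) = coset H g" if pL: "p \<in> ?L" for p
  proof -
    obtain h where h: "h \<in> H" "p = conjg g h" using pL by blast
    have "h \<in> F" using h H subgroup.mem_carrier by metis
    then have "g \<cdot> p = h \<cdot> g" using h g by (simp add: conjg_def m_assoc del: ginv_eq)
    then show ?thesis using coset_mul_left[OF H h(1) g] by simp
  qed
  have uL: "conjg u ` ?L \<subseteq> F" using uF Lsub by simp
  obtain y where y: "snd y \<in> D" "y \<in> heads (conjg u ` ?L)" "core_based (conjg u ` ?L)"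
    using verts_part_iff[OF H k(1) D] x k(2) crosses_letter[OF uL] conjg_gu[OF uF] gu by auto
  show ?thesis
  proof (cases "u \<in> ?L")
    case True
    then show ?thesis using coset_L[OF True] gu k by simp
  next
    case False
    then have une: "u \<noteq> []" using subgroup.one_closed[OF L] by auto
    obtain y' where y': "y' \<in> heads (conjg u ` ?L)" "y' \<noteq> letter_inv (last u)"
      using y(3) unfolding core_based_def by metis
    obtain w where w: "u @ y' # w \<in> ?L" using prefix_of_head[OF L uF y'] by blast
    \<comment> \<open>If the path arrived from the other side, the vertex would have directions on
      both sides and would be the base itself.\<close>
    have lu: "snd (last u) \<in> D"
    proof (rule ccontr)
      assume "snd (last u) \<notin> D"
      then have "u \<in> ?L" using both_sides[OF L sp uF y(2,1) heads_at_prefix(1)[OF L cb w une]] by simp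
      then show False using False by simp
    qed
    \<comment> \<open>The maximal final segment over \<open>D\<close>; what precedes it is empty or
      ends outside \<open>D\<close>, and so lies in \<open>L\<close>.\<close>
    define u2 where "u2 = rev (takeWhile (\<lambda>z. snd z \<in> D) (rev u))"
    define u1 where "u1 = rev (dropWhile (\<lambda>z. snd z \<in> D) (rev u))"
    have u12: "u = u1 @ u2" unfolding u1_def u2_def by (metis rev_append rev_rev_ident takeWhile_dropWhile_id)
    have u2D: "snd z \<in> D" if "z \<in> set u2" for z using that by (auto simp: u2_def dest: set_takeWhileD)
    have u2ne: "u2 \<noteq> []" using une lu by (cases u rule: rev_cases) (auto simp: u2_def)
    have u1L: "u1 \<in> ?L"
    proof (cases "u1 = []")
      case True
      then show ?thesis using subgroup.one_closed[OF L] by simp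
    next
      case False
      then have "snd (last u1) \<notin> D" unfolding u1_def by (metis hd_dropWhile last_rev rev_is_Nil_conv)
      moreover have "snd (hd u2) \<in> D" using u2D u2ne by simp
      moreover have "u1 @ (u2 @ y' # w) \<in> ?L" using w u12 by simp
      ultimately show ?thesis using sp False u2ne unfolding splits_def by (metis append_is_Nil_conv hd_append2)
    qed
    have "p = p1 @ p2 \<Longrightarrow> p = u2 \<Longrightarrow> (coset H g, coset H (g \<cdot> (u1 @ p1))) \<in> (links (part D H))\<^sup>*" for p p1 p2
    proof (induction p1 arbitrary: p2 rule: rev_induct)
      case Nil
      then show ?case using coset_L[OF u1L] by simp
    next
      case (snoc z p1)
      let ?q = "u1 @ p1"
      have qz: "?q @ (z # p2 @ y' # w) \<in> ?L" using w u12 snoc.prems by simp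
      then have qF: "?q \<in> F" "?q @ [z] \<in> F"
        using Lsub append_F[of ?q "z # p2 @ y' # w"] append_F[of "?q @ [z]" "p2 @ y' # w"] by auto
      have zB: "snd z \<in> B" "snd z \<in> D" using qF append_F[of ?q "[z]"] u2D snoc.prems by auto
      have "crosses (hdset {z}) (conjg (g \<cdot> ?q) ` H)"
        using crosses_at_prefix[OF L cb qz] conjg_gu[OF qF(1)] by simp
      then have "(coset H (g \<cdot> ?q), coset H (g \<cdot> ?q \<cdot> [z])) \<in> links (part D H)"
        using links_step[OF H _ zB, of "g \<cdot> ?q"] g qF by simp
      moreover have "g \<cdot> ?q \<cdot> [z] = g \<cdot> (u1 @ p1 @ [z])"
        using g qF zB mul_append[OF qF(2)] by (simp add: m_assoc)
      moreover have "(coset H g, coset H (g \<cdot> ?q)) \<in> (links (part D H))\<^sup>*" using snoc by simp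
      ultimately show ?case by (metis rtrancl.rtrancl_into_rtrancl)
    qed
    then have "(coset H g, coset H (g \<cdot> (u1 @ u2))) \<in> (links (part D H))\<^sup>*" by simp
    then show ?thesis using u12 gu k by simp
  qed
qed


text \<open>Describes the vertex \<open>H k\<close> from the new base \<open>H g\<close>, from which
  it is reached by the path \<open>g^-1 k\<close>.\<close>

lemma coset_rep:
  assumes H: "subgroup H (free_group B)" and g: "g \<in> F" and k: "k \<in> F"
  shows "winv g \<cdot> k \<in> F" "conjg (winv g \<cdot> k) ` conjg g ` H = conjg k ` H"
    "winv g \<cdot> k \<in> conjg g ` H \<longleftrightarrow> coset H k = coset H g"
proof -
  let ?u = "winv g \<cdot> k"
  show u: "?u \<in> F" using g k by simp
  have gu: "g \<cdot> ?u = k" using inv_cancel_left(2)[OF g k] g by simp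
  show "conjg ?u ` conjg g ` H = conjg k ` H" using conjg_image_image[OF g u subgroup.subset[OF H]] gu by simp
  have "coset H k = coset H g \<longleftrightarrow> k \<cdot> ginv g \<in> H" by (rule r_coset_eq_iff[OF H k g])
  also have "\<dots> \<longleftrightarrow> ?u \<in> conjg g ` H"
  proof
    assume "k \<cdot> ginv g \<in> H"
    moreover have "conjg g (k \<cdot> ginv g) = ginv g \<cdot> k" using g k by (simp add: conjg_def m_assoc del: ginv_eq)
    ultimately show "?u \<in> conjg g ` H" using g by (metis ginv_eq imageI)
  next
    assume "?u \<in> conjg g ` H"
    then obtain h where h: "h \<in> H" "?u = conjg g h" by blast
    have hF: "h \<in> F" using subgroup.mem_carrier[OF H h(1)] .
    have "k \<cdot> ginv g = g \<cdot> conjg g h \<cdot> ginv g" using gu h(2) by simp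
    also have "\<dots> = h" using g hF by (simp add: conjg_def m_assoc del: ginv_eq)
    finally show "k \<cdot> ginv g \<in> H" using h(1) by simp
  qed
  finally show "?u \<in> conjg g ` H \<longleftrightarrow> coset H k = coset H g" by blast
qed

lemma splits_swap:
  assumes "L \<subseteq> F" "X' \<union> Y' = B" "X' \<inter> Y' = {}" "splits X' L" shows "splits Y' L"
proof -
  have "snd z \<in> Y' \<longleftrightarrow> snd z \<notin> X'" if "z \<in> set w" "w \<in> L" for z w
    using that assms(1-3) by (auto simp: mem_F subset_iff image_iff)
  then have "snd (last u) \<in> Y' \<longleftrightarrow> snd (last u) \<notin> X'" "snd (hd v) \<in> Y' \<longleftrightarrow> snd (hd v) \<notin> X'"
    if "u @ v \<in> L" "u \<noteq> []" "v \<noteq> []" for u v using that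
    by (metis UnI1 UnI2 last_in_set hd_in_set set_append)+
  then show ?thesis using assms(4) unfolding splits_def by metis
qed

lemma core_edges_part: "core_edges B H = part B H"
  by (auto simp: part_def core_edges_def)

text \<open>With the base at the wedge vertex, a loop changes sides only at a vertex of both parts,
  that is at the base, so the prefix is a loop. Conversely a vertex of both parts is the base by
  \<open>both_sides\<close>, and \<open>part_connected\<close> joins each part to it.\<close>

lemma wedge_split_iff:
  assumes H: "subgroup H (free_group B)" and XY: "P \<union> R = B" "P \<inter> R = {}"
  shows "wedge_split B (core_edges B H) P R \<longleftrightarrow> (\<exists>g\<in>F. core_based (conjg g ` H) \<and> splits P (conjg g ` H))"
proof -
  have PB: "P \<subseteq> B" "R \<subseteq> B" using XY by auto
  have ws: "wedge_split B (core_edges B H) P R \<longleftrightarrow> (\<exists>v\<in>verts B (part B H).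
     (verts B (part P H) \<union> {v}) \<inter> (verts B (part R H) \<union> {v}) = {v} \<and>
     graph_connected B (verts B (part P H) \<union> {v}) (part P H) \<and> graph_connected B (verts B (part R H) \<union> {v}) (part R H))"
  proof -
    have "core_edges B H = part P H \<union> part R H" using XY by (auto simp: part_def core_edges_def)
    then show ?thesis unfolding wedge_split_def Let_def part_def[symmetric] core_edges_part[symmetric] by simp
  qed
  show ?thesis
  proof
    assume "wedge_split B (core_edges B H) P R"
    then obtain v where v: "v \<in> verts B (part B H)"
      "(verts B (part P H) \<union> {v}) \<inter> (verts B (part R H) \<union> {v}) = {v}" unfolding ws by blast
    obtain g where g: "g \<in> F" "v = coset H g" using vert_coset[OF H v(1)] by blast
    let ?L = "conjg g ` H"
    have L: "subgroup ?L (free_group B)" using conjg_subgroup[OF g(1) H] .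
    have Lsub: "?L \<subseteq> F" using subgroup.subset[OF L] .
    have cb: "core_based ?L" using verts_part_iff[OF H g(1), of B] v(1) g(2) crosses_letter[OF Lsub] by auto
    have "splits P ?L" unfolding splits_def
    proof (intro allI impI)
      fix u w assume uw: "u @ w \<in> ?L" "u \<noteq> []" "w \<noteq> []" "(snd (last u) \<in> P) \<noteq> (snd (hd w) \<in> P)"
      have uwF: "u @ w \<in> F" using uw Lsub by blast
      then have F: "u \<in> F" "w \<in> F" using append_F by blast+
      have gu: "g \<cdot> u \<in> F" "winv g \<cdot> (g \<cdot> u) = u" using g F inv_cancel_left(1)[OF g(1) F(1)] by simp_all
      have cu: "conjg (g \<cdot> u) ` H = conjg u ` ?L" using coset_rep(2)[OF H g(1) gu(1)] gu(2) by simp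
      have sub: "conjg u ` ?L \<subseteq> F" using F Lsub by simp
      have cbu: "core_based (conjg u ` ?L)" using core_based_at_prefix[OF L cb uw(1,3)] .
      have h: "letter_inv (last u) \<in> heads (conjg u ` ?L)" "hd w \<in> heads (conjg u ` ?L)"
        using heads_at_prefix[OF L cb uw(1)] uw by blast+
      have "snd (hd w) \<in> B" "snd (last u) \<in> B" using heads_B[OF sub h(1)] heads_B[OF sub h(2)] by simp_all
      then have side: "snd (last u) \<in> P \<and> snd (hd w) \<in> R \<or> snd (last u) \<in> R \<and> snd (hd w) \<in> P" using uw(4) XY by blast
      have cr: "crosses (hdset {letter_inv (last u)}) (conjg (g \<cdot> u) ` H)" "crosses (hdset {hd w}) (conjg (g \<cdot> u) ` H)"
        unfolding cu crosses_letter[OF sub] using h cbu by blast+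
      have "coset H (g \<cdot> u) \<in> verts B (part P H) \<and> coset H (g \<cdot> u) \<in> verts B (part R H)"
        unfolding verts_part_iff[OF H gu(1) PB(1)] verts_part_iff[OF H gu(1) PB(2)]
        using side cr by (metis snd_letter_inv)
      then have "coset H (g \<cdot> u) = coset H g" using v(2) g(2) by blast
      then show "u \<in> ?L" using coset_rep(3)[OF H g(1) gu(1)] gu(2) by simp
    qed
    then show "\<exists>g\<in>F. core_based (conjg g ` H) \<and> splits P (conjg g ` H)" using g(1) cb by blast
  next
    assume "\<exists>g\<in>F. core_based (conjg g ` H) \<and> splits P (conjg g ` H)"
    then obtain g where g: "g \<in> F" and cb: "core_based (conjg g ` H)" and sp: "splits P (conjg g ` H)" by blast
    let ?L = "conjg g ` H" and ?v = "coset H g"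
    have L: "subgroup ?L (free_group B)" using conjg_subgroup[OF g H] .
    have Lsub: "?L \<subseteq> F" using subgroup.subset[OF L] .
    have spR: "splits R ?L" using splits_swap[OF Lsub XY sp] .
    obtain y where "y \<in> heads ?L" using cb unfolding core_based_def by blast
    then have v: "?v \<in> verts B (part B H)"
      unfolding verts_part_iff[OF H g order_refl] crosses_letter[OF Lsub] using cb heads_B[OF Lsub] by blast
    have one: "x = ?v" if x: "x \<in> verts B (part P H)" "x \<in> verts B (part R H)" for x
    proof -
      obtain k where k: "k \<in> F" "x = coset H k" using vert_coset[OF H x(1)] by blast
      let ?u = "winv g \<cdot> k"
      note u = coset_rep[OF H g k(1)]
      have sub: "conjg ?u ` ?L \<subseteq> F" using u(1) Lsub by simp
      obtain a where a: "snd a \<in> P" "a \<in> heads (conjg ?u ` ?L)"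
        using x(1) unfolding k(2) verts_part_iff[OF H k(1) PB(1)] u(2)[symmetric] crosses_letter[OF sub] by blast
      obtain b where b: "snd b \<in> R" "b \<in> heads (conjg ?u ` ?L)"
        using x(2) unfolding k(2) verts_part_iff[OF H k(1) PB(2)] u(2)[symmetric] crosses_letter[OF sub] by blast
      have "?u \<in> ?L" using both_sides[OF L sp u(1) a(2,1) b(2)] b(1) XY by blast
      then show ?thesis using u(3) k(2) by simp
    qed
    have conn: "graph_connected B (verts B (part D H) \<union> {?v}) (part D H)" if D: "D \<subseteq> B" "splits D ?L" for D
    proof -
      let ?R = "(links (part D H))\<^sup>*"
      have to: "(?v, x) \<in> ?R" if "x \<in> verts B (part D H) \<union> {?v}" for x
        using part_connected[OF H g D(1) cb D(2)] that by auto
      have "sym ?R" by (rule sym_rtrancl[OF sym_links])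
      then have "(x, y) \<in> ?R" if "x \<in> verts B (part D H) \<union> {?v}" "y \<in> verts B (part D H) \<union> {?v}" for x y
        using to[OF that(1)] to[OF that(2)] by (meson rtrancl_trans symD)
      then show ?thesis unfolding graph_connected_def links_def by blast
    qed
    show "wedge_split B (core_edges B H) P R"
      unfolding ws using v one conn[OF PB(1) sp] conn[OF PB(2) spR] by (intro bexI[of _ ?v]) auto
  qed
qed

text \<open>The base is moved along the stem \<open>u\<close> of a nontrivial element to its
  cyclically reduced core, where the word and its inverse start differently.\<close>

lemma core_based_conjugate:
  assumes H: "subgroup H (free_group B)" and l: "l \<in> H" "l \<noteq> []"
  shows "\<exists>u v. l = u @ v @ winv u \<and> u \<in> F \<and> core_based (conjg u ` H)"
proof -
  have lF: "l \<in> F" using subgroup.mem_carrier[OF H l(1)] .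
  obtain u v where uv: "l = u @ v @ winv u" "v \<noteq> []" "cyclically_reduced v"
    using cyclically_reduced_decomp[of l] lF l by (auto simp: mem_F)
  have F: "u \<in> F" "v \<in> F" "conjg u l = v" using conjg_decomp[of u v] lF uv(1) by auto
  have vL: "v \<in> conjg u ` H" using F(3) l(1) by blast
  then have "winv v \<in> conjg u ` H" using subgroup.m_inv_closed[OF conjg_subgroup[OF F(1) H]] F(2) by force
  moreover have "hd v \<noteq> hd (winv v)" using uv by (auto simp: cyclically_reduced_def)
  ultimately have "core_based (conjg u ` H)" unfolding core_based_def heads_def using vL uv(2)
    by (metis (no_types, lifting) Diff_iff image_eqI singletonD winv_simps(6))
  then show ?thesis using uv F by blast
qed

lemma words_over_mul: "u \<in> words_over D \<Longrightarrow> v \<in> words_over D \<Longrightarrow> u \<cdot> v \<in> words_over D"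
proof -
  assume uv: "u \<in> words_over D" "v \<in> words_over D"
  have "snd ` set (u \<cdot> v) \<subseteq> snd ` set (u @ v)" unfolding mul_def by (rule image_mono[OF set_reduce])
  also have "\<dots> \<subseteq> D" using uv by (simp add: words_over_def image_Un)
  finally show ?thesis using uv by (simp add: words_over_def)
qed

lemma words_over_winv: "u \<in> words_over D \<Longrightarrow> winv u \<in> words_over D"
  by (simp add: words_over_def)

lemma words_over_conjg: "u \<in> words_over D \<Longrightarrow> v \<in> words_over D \<Longrightarrow> conjg u v \<in> words_over D"
  unfolding conjg_def using words_over_mul words_over_winv by (simp add: words_over_def)

lemma words_over_append: "u @ v \<in> words_over D \<Longrightarrow> u \<in> words_over D \<and> v \<in> words_over D"
  using append_F[of u v] by (auto simp: words_over_def)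

text \<open>From a base in the core every loop reads core edges only. Conversely the path from the
  base to a core vertex is a prefix of a loop, hence over \<open>D\<close>, and so are the loops at
  that vertex.\<close>

lemma one_sided_iff:
  assumes H: "subgroup H (free_group B)" and D: "D \<subseteq> B"
  shows "snd ` core_edges B H \<subseteq> D \<longleftrightarrow> (\<exists>g\<in>F. conjg g ` H \<subseteq> words_over D)"
proof
  assume sub: "snd ` core_edges B H \<subseteq> D"
  show "\<exists>g\<in>F. conjg g ` H \<subseteq> words_over D"
  proof (cases "H \<subseteq> {[]}")
    case True
    then show ?thesis by (intro bexI[of _ "[]"]) (auto simp: words_over_def)
  next
    case False
    then obtain l where "l \<in> H" "l \<noteq> []" by blast
    then obtain g where g: "g \<in> F" "core_based (conjg g ` H)" using core_based_conjugate[OF H] by blast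
    let ?L = "conjg g ` H"
    have L: "subgroup ?L (free_group B)" using conjg_subgroup[OF g(1) H] .
    have "k \<in> words_over D" if k: "k \<in> ?L" for k
    proof -
      have kF: "k \<in> F" using subgroup.mem_carrier[OF L k] .
      have "snd z \<in> D" if "z \<in> set k" for z
      proof -
        obtain p w where pw: "k = p @ z # w" using \<open>z \<in> set k\<close> by (metis split_list)
        have pF: "p \<in> F" "snd z \<in> B" using kF pw append_F[of p "z # w"] Cons_F[of z w] by auto
        have gp: "g \<cdot> p \<in> F" using g pF by simp
        have cp: "conjg (g \<cdot> p) ` H = conjg p ` ?L" using conjg_image_image[OF g(1) pF(1) subgroup.subset[OF H]] by simp
        have "crosses (hdset {z}) (conjg (g \<cdot> p) ` H)"
          using crosses_at_prefix[OF L g(2), of p "z # w"] k pw cp by simp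
        then have "coset H (g \<cdot> p) \<in> verts B (part {snd z} H)" using verts_part_iff[OF H gp, of "{snd z}"] pF by blast
        then have "part {snd z} H \<noteq> {}" by (auto simp: verts_def)
        then show ?thesis using sub by (auto simp: part_def)
      qed
      then show ?thesis using kF by (auto simp: words_over_def)
    qed
    then show ?thesis using g by blast
  qed
next
  assume "\<exists>g\<in>F. conjg g ` H \<subseteq> words_over D"
  then obtain g where g: "g \<in> F" "conjg g ` H \<subseteq> words_over D" by blast
  let ?L = "conjg g ` H"
  have L: "subgroup ?L (free_group B)" using conjg_subgroup[OF g(1) H] .
  show "snd ` core_edges B H \<subseteq> D"
  proof
    fix b assume "b \<in> snd ` core_edges B H"
    then obtain e where e: "e \<in> core_edges B H" "b = snd e" by blast
    obtain k where k: "k \<in> F" "e = (coset H k, b)" using core_edge_coset[OF H e(1)] e(2) by blast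
    have cr: "crosses (hdset {(True, b)}) (conjg k ` H)"
    proof -
      have "(coset H k, b) \<in> part B H" using e(1) k(2) core_edges_part[of H] by simp
      then show ?thesis using mem_part[OF H k(1), of b B] by simp
    qed
    let ?u = "winv g \<cdot> k"
    note u = coset_rep[OF H g(1) k(1)]
    have sub: "conjg ?u ` ?L \<subseteq> F" using u(1) subgroup.subset[OF L] by simp
    have h: "(True, b) \<in> heads (conjg ?u ` ?L)" "core_based (conjg ?u ` ?L)"
      using cr unfolding u(2)[symmetric] crosses_letter[OF sub] by blast+
    obtain y where y: "y \<in> heads (conjg ?u ` ?L)" "?u \<noteq> [] \<Longrightarrow> y \<noteq> letter_inv (last ?u)"
      using h(2) unfolding core_based_def by metis
    obtain w where "?u @ y # w \<in> ?L" using prefix_of_head[OF L u(1) y] by blast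
    then have uD: "?u \<in> words_over D" using g(2) words_over_append by blast
    have "conjg ?u ` ?L \<subseteq> words_over D" using words_over_conjg[OF uD] g(2) by blast
    then obtain m where m: "m \<in> words_over D" "m \<noteq> []" "hd m = (True, b)" using h(1) unfolding heads_def by force
    then show "b \<in> D" by (cases m) (auto simp: words_over_def)
  qed
qed

text \<open>Formulated for chosen conjugates: component \<open>i0\<close> is based at the wedge
  vertex, the others at a vertex from which all loops read one side.\<close>

definition cleaving :: "'b set \<Rightarrow> 'b set \<Rightarrow> nat \<Rightarrow> 'b word set list \<Rightarrow> bool" where
  "cleaving P R i0 Ks \<longleftrightarrow> P \<union> R = B \<and> P \<inter> R = {} \<and> P \<noteq> {} \<and> R \<noteq> {} \<and> i0 < length Ks \<and>
     core_based (Ks ! i0) \<and> splits P (Ks ! i0) \<and>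
     (\<forall>i<length Ks. i \<noteq> i0 \<longrightarrow> Ks ! i \<subseteq> words_over P \<or> Ks ! i \<subseteq> words_over R)"

definition conj_list :: "'b word set list \<Rightarrow> 'b word set list \<Rightarrow> bool" where
  "conj_list Hs Ks \<longleftrightarrow> length Ks = length Hs \<and> (\<forall>i<length Hs. \<exists>g\<in>F. Ks ! i = conjg g ` (Hs ! i))"

definition cleaved :: "'b word set list \<Rightarrow> bool" where
  "cleaved Hs \<longleftrightarrow> (\<exists>P R i0 Ks. conj_list Hs Ks \<and> cleaving P R i0 Ks)"

lemma conj_list_choice:
  assumes "\<And>i. i < length Hs \<Longrightarrow> \<exists>g\<in>F. Q i (conjg g ` (Hs ! i))"
  shows "\<exists>Ks. conj_list Hs Ks \<and> (\<forall>i<length Hs. Q i (Ks ! i))"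
proof -
  obtain g where g: "\<And>i. i < length Hs \<Longrightarrow> g i \<in> F \<and> Q i (conjg (g i) ` (Hs ! i))" using assms by metis
  show ?thesis
    by (rule exI[of _ "map (\<lambda>i. conjg (g i) ` (Hs ! i)) [0..<length Hs]"]) (use g in \<open>auto simp: conj_list_def\<close>)
qed

theorem visibly_cleavable_iff:
  assumes "fg_list Hs"
  shows "visibly_cleavable B (Sigma B Hs) \<longleftrightarrow> cleaved Hs"
proof
  have s: "subgroup (Hs ! i) (free_group B)" if "i < length Hs" for i
    using fg_subgroup_subgroup[OF fg_list_nth[OF assms that]] .
  show "cleaved Hs" if vc: "visibly_cleavable B (Sigma B Hs)"
  proof -
    obtain P R i0 where "P \<union> R = B" "P \<inter> R = {}" "P \<noteq> {}" "R \<noteq> {}" "i0 < length (Sigma B Hs)"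
      "wedge_split B (Sigma B Hs ! i0) P R"
      "\<forall>i<length (Sigma B Hs). i \<noteq> i0 \<longrightarrow> snd ` (Sigma B Hs ! i) \<subseteq> P \<or> snd ` (Sigma B Hs ! i) \<subseteq> R"
      using vc unfolding visibly_cleavable_def by blast
    then have d: "P \<union> R = B" "P \<inter> R = {}" "P \<noteq> {}" "R \<noteq> {}" "i0 < length Hs"
      "wedge_split B (core_edges B (Hs ! i0)) P R"
      "i < length Hs \<Longrightarrow> i \<noteq> i0 \<Longrightarrow> snd ` core_edges B (Hs ! i) \<subseteq> P \<or> snd ` core_edges B (Hs ! i) \<subseteq> R" for i
      by (simp_all add: Sigma_def)
    have "\<exists>Ks. conj_list Hs Ks \<and> (\<forall>i<length Hs. if i = i0 then core_based (Ks ! i) \<and> splits P (Ks ! i)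
        else Ks ! i \<subseteq> words_over P \<or> Ks ! i \<subseteq> words_over R)"
    proof (rule conj_list_choice)
      fix i assume i: "i < length Hs"
      show "\<exists>g\<in>F. if i = i0 then core_based (conjg g ` (Hs ! i)) \<and> splits P (conjg g ` (Hs ! i))
        else conjg g ` (Hs ! i) \<subseteq> words_over P \<or> conjg g ` (Hs ! i) \<subseteq> words_over R"
      proof (cases "i = i0")
        case True
        then show ?thesis using wedge_split_iff[OF s[OF i] d(1,2)] d(6) by simp
      next
        case False
        have PB: "P \<subseteq> B" "R \<subseteq> B" using d(1) by blast+
        from d(7)[OF i False] have "\<exists>g\<in>F. conjg g ` (Hs ! i) \<subseteq> words_over P \<or> conjg g ` (Hs ! i) \<subseteq> words_over R"
          unfolding one_sided_iff[OF s[OF i] PB(1)] one_sided_iff[OF s[OF i] PB(2)] by blast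
        then show ?thesis using False by simp
      qed
    qed
    then obtain Ks where Ks: "conj_list Hs Ks" "\<And>i. i < length Hs \<Longrightarrow> if i = i0 then core_based (Ks ! i) \<and> splits P (Ks ! i)
        else Ks ! i \<subseteq> words_over P \<or> Ks ! i \<subseteq> words_over R" by blast
    have "cleaving P R i0 Ks" unfolding cleaving_def using d Ks(1) Ks(2)[of i0] Ks(2) by (auto simp: conj_list_def)
    then show ?thesis unfolding cleaved_def using Ks(1) by blast
  qed
  show "visibly_cleavable B (Sigma B Hs)" if "cleaved Hs"
  proof -
    obtain P R i0 Ks where cl: "conj_list Hs Ks" "cleaving P R i0 Ks" using \<open>cleaved Hs\<close> unfolding cleaved_def by blast
    note c = cl(2)[unfolded cleaving_def]
    have len: "length Ks = length Hs" using cl(1) by (simp add: conj_list_def)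
    have PB: "P \<subseteq> B" "R \<subseteq> B" "P \<union> R = B" "P \<inter> R = {}" using c by auto
    have i0: "i0 < length Hs" using c len by simp
    obtain g where g: "g \<in> F" "Ks ! i0 = conjg g ` (Hs ! i0)" using cl(1) i0 by (auto simp: conj_list_def)
    have "wedge_split B (core_edges B (Hs ! i0)) P R"
      unfolding wedge_split_iff[OF s[OF i0] PB(3,4)] using c g by metis
    moreover have "snd ` core_edges B (Hs ! i) \<subseteq> P \<or> snd ` core_edges B (Hs ! i) \<subseteq> R" if i: "i < length Hs" "i \<noteq> i0" for i
    proof -
      obtain g where g: "g \<in> F" "Ks ! i = conjg g ` (Hs ! i)" using cl(1) i by (auto simp: conj_list_def)
      moreover have "Ks ! i \<subseteq> words_over P \<or> Ks ! i \<subseteq> words_over R" using c i len by simp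
      ultimately show ?thesis unfolding one_sided_iff[OF s[OF i(1)] PB(1)] one_sided_iff[OF s[OF i(1)] PB(2)] by metis
    qed
    ultimately show ?thesis unfolding visibly_cleavable_def Sigma_def using c i0
      by (intro exI[of _ P] exI[of _ R] exI[of _ i0]) auto
  qed
qed


section \<open>Splittings and generating sets\<close>

abbreviation gen_by :: "'b word set \<Rightarrow> 'b word set" where
  "gen_by S \<equiv> generate (free_group B) S"

lemma words_over_F: "w \<in> words_over D \<Longrightarrow> w \<in> F"
  by (simp add: words_over_def)

lemma F_eq_words_over: "F = words_over B"
  unfolding words_over_def using mem_F by blast

lemma words_over_mono: "D \<subseteq> E \<Longrightarrow> words_over D \<subseteq> words_over E"
  by (auto simp: words_over_def)

lemma words_over_subgroup: "subgroup (words_over D) (free_group B)"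
proof (rule subgroupI)
  show "words_over D \<subseteq> F" by (auto simp: words_over_def)
  show "words_over D \<noteq> {}" using Nil_F by (auto simp: words_over_def intro!: exI[of _ "[]"])
  show "ginv u \<in> words_over D" if "u \<in> words_over D" for u
    using that words_over_winv words_over_F by simp
qed (rule words_over_mul)

lemma takeWhile_split:
  fixes w :: "'b word"
  obtains t d where "w = t @ d" "\<And>z. z \<in> set t \<Longrightarrow> snd z \<in> D" "d \<noteq> [] \<Longrightarrow> snd (hd d) \<notin> D"
    "w \<noteq> [] \<Longrightarrow> snd (hd w) \<in> D \<Longrightarrow> t \<noteq> []"
proof (rule that[of "takeWhile (\<lambda>z. snd z \<in> D) w" "dropWhile (\<lambda>z. snd z \<in> D) w"])
  show "takeWhile (\<lambda>z. snd z \<in> D) w \<noteq> []" if "w \<noteq> []" "snd (hd w) \<in> D" using that by (cases w) auto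
  show "snd (hd (dropWhile (\<lambda>z. snd z \<in> D) w)) \<notin> D" if "dropWhile (\<lambda>z. snd z \<in> D) w \<noteq> []"
    using hd_dropWhile[OF that] .
qed (auto dest: set_takeWhileD)

text \<open>The initial segment on one side belongs to \<open>L\<close> by the splitting; removing
  it leaves a shorter element of \<open>L\<close>.\<close>

lemma splits_generate:
  assumes L: "subgroup L (free_group B)" and LD: "L \<subseteq> words_over (D \<union> E)" and DE: "D \<inter> E = {}" and sp: "splits D L"
  shows "L = gen_by ((L \<inter> words_over D) \<union> (L \<inter> words_over E))"
proof
  let ?S = "(L \<inter> words_over D) \<union> (L \<inter> words_over E)"
  show "gen_by ?S \<subseteq> L" using generate_subgroup_incl[OF _ L, of ?S] by blast
  have "l \<in> L \<Longrightarrow> l \<in> gen_by ?S" for l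
  proof (induction l rule: length_induct)
    case (1 l)
    have lF: "l \<in> F" using subgroup.mem_carrier[OF L] 1(2) .
    have lw: "l \<in> words_over (D \<union> E)" using 1(2) LD by blast
    show ?case
    proof (cases "l = []")
      case True
      then show ?thesis using generate.one[of "free_group B" ?S] by simp
    next
      case False
      have side: "\<exists>M. (M = D \<or> M = E) \<and> snd (hd l) \<in> M"
        using lw False by (cases l) (auto simp: words_over_def)
      then obtain M where M: "M = D \<or> M = E" "snd (hd l) \<in> M" by blast
      obtain t d where td: "l = t @ d" "\<And>z. z \<in> set t \<Longrightarrow> snd z \<in> M" "d \<noteq> [] \<Longrightarrow> snd (hd d) \<notin> M" "t \<noteq> []"
        using takeWhile_split[of l M] False M(2) by metis
      have tF: "t \<in> F" "d \<in> F" using lF td(1) append_F by blast+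
      have tM: "t \<in> words_over M" using tF td(2) by (auto simp: words_over_def)
      have tL: "t \<in> L"
      proof (cases "d = []")
        case True
        then show ?thesis using td 1(2) by simp
      next
        case dne: False
        have "snd (last t) \<in> M" "snd (hd d) \<notin> M" using td dne by auto
        moreover have "snd z \<in> D \<union> E" if "z \<in> set l" for z using lw that by (auto simp: words_over_def)
        then have "snd (hd d) \<in> D \<union> E" "snd (last t) \<in> D \<union> E" using td(1,4) dne by simp_all
        ultimately have "(snd (last t) \<in> D) \<noteq> (snd (hd d) \<in> D)" using M(1) DE by blast
        then show ?thesis using sp 1(2) td(1,4) dne unfolding splits_def by blast
      qed
      have tS: "t \<in> gen_by ?S" using tL tM M(1) by (intro generate.incl) blast
      have "d = winv t \<cdot> l" using td(1) mul_append[of t d] lF tF inv_cancel_left(1)[OF tF] by simp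
      then have dL: "d \<in> L" using subgroup.m_closed[OF L subgroup.m_inv_closed[OF L tL] 1(2)] tF by simp
      have "d \<in> gen_by ?S" using 1(1) dL td(1,4) by simp
      then show ?thesis using generate.eng[OF tS] td(1) mul_append[of t d] lF by metis
    qed
  qed
  then show "L \<subseteq> gen_by ?S" by blast
qed

text \<open>Left multiplication by a one-sided element alters only the initial segment on its side,
  and the new segment again lies in the subgroup, so later changes of sides remain returns to the
  base.\<close>

lemma generate_splits:
  assumes A: "A \<subseteq> words_over P" and C: "C \<subseteq> words_over R" and PR: "P \<union> R = B" "P \<inter> R = {}"
  shows "splits P (gen_by (A \<union> C))"
proof -
  let ?L = "gen_by (A \<union> C)"
  have SF: "A \<union> C \<subseteq> F" using A C words_over_F by blast
  have L: "subgroup ?L (free_group B)" by (rule generate_is_subgroup[OF SF])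
  define good where "good m \<longleftrightarrow> m \<in> ?L \<and> (\<forall>u v. m = u @ v \<longrightarrow> u \<noteq> [] \<longrightarrow> v \<noteq> [] \<longrightarrow>
      (snd (last u) \<in> P) \<noteq> (snd (hd v) \<in> P) \<longrightarrow> u \<in> ?L)" for m
  have step: "good (a \<cdot> m)" if a: "a \<in> ?L" "a \<in> words_over D" "D = P \<or> D = R" and m: "good m" for a m D
  proof -
    have mL: "m \<in> ?L" using m by (simp add: good_def)
    have F: "a \<in> F" "m \<in> F" using subgroup.mem_carrier[OF L] a(1) mL by auto
    have sideD: "(snd x \<in> P) \<noteq> (snd y \<in> P) \<longleftrightarrow> (snd x \<in> D) \<noteq> (snd y \<in> D)" if "snd x \<in> B" "snd y \<in> B" for x y :: "'b letter"
      using that a(3) PR by blast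
    have inB: "snd z \<in> B" if "z \<in> set w" "w \<in> F" for z w using that by (auto simp: mem_F)
    obtain t d where td: "m = t @ d" "\<And>z. z \<in> set t \<Longrightarrow> snd z \<in> D" "d \<noteq> [] \<Longrightarrow> snd (hd d) \<notin> D"
      using takeWhile_split[of m D] by metis
    have tF: "t \<in> F" "d \<in> F" using F td(1) append_F by blast+
    have tD: "t \<in> words_over D" using tF td(2) by (auto simp: words_over_def)
    have sw: "u \<in> ?L" if "m = u @ v" "u \<noteq> []" "v \<noteq> []" "(snd (last u) \<in> D) \<noteq> (snd (hd v) \<in> D)" for u v
    proof -
      have "snd (last u) \<in> B" "snd (hd v) \<in> B" using inB[of _ m] that(1-3) F(2) by auto
      then show ?thesis using m that sideD[of "last u" "hd v"] by (simp add: good_def)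
    qed
    have tL: "t \<in> ?L"
    proof (cases "t = [] \<or> d = []")
      case True
      then show ?thesis using td(1) mL subgroup.one_closed[OF L] by auto
    next
      case False
      then show ?thesis using sw[of t d] td by auto
    qed
    \<comment> \<open>Cancellation is confined to this segment: \<open>d\<close> starts on the other
      side, so \<open>?b @ d\<close> stays reduced.\<close>
    let ?b = "a \<cdot> t"
    have b: "?b \<in> ?L" "?b \<in> words_over D" "?b \<in> F"
      using subgroup.m_closed[OF L a(1) tL] words_over_mul[OF a(2) tD] F tF by auto
    have bD: "snd z \<in> D" if "z \<in> set ?b" for z using b(2) that by (auto simp: words_over_def)
    have bdF: "?b @ d \<in> F"
    proof -
      have "hd d \<noteq> letter_inv (last ?b)" if "?b \<noteq> []" "d \<noteq> []"
        using bD[of "last ?b"] td(3)[OF that(2)] that by (metis last_in_set snd_letter_inv)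
      then show ?thesis using b tF by (simp add: append_F)
    qed
    have am: "a \<cdot> m = ?b @ d"
      using td(1) mul_append[of t d] F tF mul_append[OF bdF] by (simp add: m_assoc)
    have "u \<in> ?L" if uv: "a \<cdot> m = u @ v" "u \<noteq> []" "v \<noteq> []" "(snd (last u) \<in> P) \<noteq> (snd (hd v) \<in> P)" for u v
    proof -
      have "snd (last u) \<in> B" "snd (hd v) \<in> B" using inB[of _ "u @ v"] uv bdF am by auto
      then have sd: "(snd (last u) \<in> D) \<noteq> (snd (hd v) \<in> D)" using sideD uv(4) by blast
      have "u @ v = ?b @ d" using uv am by simp
      then consider x where "?b = u @ x" "x \<noteq> []" "v = x @ d" | y where "u = ?b @ y" "d = y @ v"
        by (auto simp: append_eq_append_conv2) (metis append_Nil append_Nil2)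
      then show ?thesis
      proof cases
        case 1
        then have "last u \<in> set ?b" "hd v \<in> set ?b" using uv(2) by auto
        then show ?thesis using bD sd by blast
      next
        case 2
        show ?thesis
        proof (cases "y = []")
          case True
          then show ?thesis using 2 b by simp
        next
          case False
          have tyF: "t @ y \<in> F" using F(2) td(1) 2 append_F[of "t @ y" v] by simp
          have "t @ y \<in> ?L" using sw[of "t @ y" v] td(1) 2 False uv(3) sd by simp
          then have "a \<cdot> (t @ y) \<in> ?L" using subgroup.m_closed[OF L a(1)] by blast
          moreover have "?b @ y \<in> F" using bdF 2 append_F[of "?b @ y" v] by simp
          then have "a \<cdot> (t @ y) = ?b @ y"
            using mul_append[OF tyF] F tF tyF append_F[of t y] mul_append[of ?b y] by (simp add: m_assoc)
          ultimately show ?thesis using 2 by simp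
        qed
      qed
    qed
    then show ?thesis unfolding good_def using subgroup.m_closed[OF L a(1) mL] by blast
  qed
  have base: "\<exists>D. (D = P \<or> D = R) \<and> h \<in> words_over D" if "h \<in> A \<union> C" for h using that A C by blast
  have all: "good m \<longrightarrow> good (l \<cdot> m)" if l: "l \<in> ?L" for l m
    using l
  proof (induction l arbitrary: m rule: generate.induct)
    case one
    then show ?case using subgroup.mem_carrier[OF L] by (auto simp: good_def)
  next
    case (incl h)
    then show ?case using step[of h] base[OF incl] generate.incl[OF incl] by blast
  next
    case (inv h)
    have "h \<in> F" using inv SF by blast
    then have "\<exists>D. (D = P \<or> D = R) \<and> ginv h \<in> words_over D" using base[OF inv] words_over_winv by auto
    then show ?case using step[of "ginv h"] generate.inv[OF inv] by blast
  next
    case (eng h1 h2)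
    have F: "h1 \<in> F" "h2 \<in> F" using eng.hyps subgroup.mem_carrier[OF L] by auto
    have "m \<in> F" if "good m" using that subgroup.mem_carrier[OF L] by (auto simp: good_def)
    then show ?case using eng.IH F by (auto simp: m_assoc)
  qed
  have "good []" using subgroup.one_closed[OF L] by (simp add: good_def)
  then have "good l" if "l \<in> ?L" for l
    using all[OF that, of "[]"] subgroup.mem_carrier[OF L that] by simp
  then show ?thesis unfolding splits_def good_def by blast
qed

lemma splits_one_sided:
  assumes "L \<subseteq> words_over D" "D = P \<or> D = R" "P \<inter> R = {}"
  shows "splits P L"
  unfolding splits_def
proof (intro allI impI)
  fix u v assume uv: "u @ v \<in> L" "u \<noteq> []" "v \<noteq> []" "(snd (last u) \<in> P) \<noteq> (snd (hd v) \<in> P)"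
  then have "u @ v \<in> words_over D" using assms(1) by blast
  then have "snd (last u) \<in> D" "snd (hd v) \<in> D" using uv(2,3) by (auto simp: words_over_def)
  then show "u \<in> L" using uv(4) assms(2,3) by blast
qed

lemma generate_image_conjg: "g \<in> F \<Longrightarrow> S \<subseteq> F \<Longrightarrow> conjg g ` gen_by S = gen_by (conjg g ` S)"
  using group_hom.generate_img[OF conjg_hom] by simp

text \<open>The generators may all lie on one side and the base may lie off the core. If it does,
  all nontrivial elements start with the same letter, so the group is one-sided; moving the base
  into the core keeps it one-sided, and then it splits trivially.\<close>

lemma cleavedI:
  assumes fg: "fg_list Hs" and PR: "P \<union> R = B" "P \<inter> R = {}" "P \<noteq> {}" "R \<noteq> {}"
    and i0: "i0 < length Hs" "Hs ! i0 \<noteq> {[]}"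
    and g0: "g0 \<in> F" "conjg g0 ` (Hs ! i0) = gen_by (A \<union> C)" and A: "A \<subseteq> words_over P" and C: "C \<subseteq> words_over R"
    and others: "\<And>i. i < length Hs \<Longrightarrow> i \<noteq> i0 \<Longrightarrow> \<exists>g\<in>F. conjg g ` (Hs ! i) \<subseteq> words_over P \<or> conjg g ` (Hs ! i) \<subseteq> words_over R"
  shows "cleaved Hs"
proof -
  let ?L = "conjg g0 ` (Hs ! i0)"
  have s: "subgroup (Hs ! i0) (free_group B)" using fg_subgroup_subgroup[OF fg_list_nth[OF fg i0(1)]] .
  have L: "subgroup ?L (free_group B)" using conjg_subgroup[OF g0(1) s] .
  have sp: "splits P ?L" unfolding g0(2) by (rule generate_splits[OF A C PR(1,2)])
  have "\<exists>g\<in>F. core_based (conjg g ` (Hs ! i0)) \<and> splits P (conjg g ` (Hs ! i0))"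
  proof (cases "core_based ?L")
    case True
    then show ?thesis using sp g0 by blast
  next
    case ncb: False
    have "\<exists>l\<in>Hs ! i0. l \<noteq> []" using i0(2) subgroup.one_closed[OF s] by auto
    then obtain h where h: "h \<in> Hs ! i0" "h \<noteq> []" by blast
    define l where "l = conjg g0 h"
    have hF: "h \<in> F" using subgroup.mem_carrier[OF s h(1)] .
    have l: "l \<in> ?L" "l \<noteq> []" using h g0 hF by (auto simp: l_def)
    have single: "x = hd l" if "x \<in> heads ?L" for x
    proof -
      have "hd l \<in> heads ?L" using l unfolding heads_def by blast
      then show ?thesis using ncb that unfolding core_based_def by blast
    qed
    have lF: "l \<in> F" using subgroup.mem_carrier[OF L l(1)] .
    then have "snd (hd l) \<in> B" using l(2) by (cases l) (auto simp: Cons_F)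
    then have "snd (hd l) \<in> P \<or> snd (hd l) \<in> R" using PR(1) by blast
    \<comment> \<open>\<open>D\<close> is the side of the only first letter; elements over the other
      side \<open>E\<close> must be trivial.\<close>
    then obtain D E where DE: "D = P \<and> E = R \<or> D = R \<and> E = P" "snd (hd l) \<in> D" by metis
    have "?L \<inter> words_over E \<subseteq> {[]}"
    proof
      fix w assume w: "w \<in> ?L \<inter> words_over E"
      show "w \<in> {[]}"
      proof (rule ccontr)
        assume "w \<notin> {[]}"
        then have "hd w \<in> heads ?L" "snd (hd w) \<in> E" using w unfolding heads_def words_over_def by auto
        then show False using single DE PR(2) by auto
      qed
    qed
    moreover have "[] \<in> words_over D" by (simp add: words_over_def)
    ultimately have E0: "?L \<inter> words_over E \<subseteq> words_over D" by (meson empty_subsetI insert_subset order_trans)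
    have sub: "(?L \<inter> words_over P) \<union> (?L \<inter> words_over R) \<subseteq> words_over D"
      using DE(1)
    proof (elim disjE conjE)
      assume "D = P" "E = R"
      then show ?thesis using E0 by (simp only:) (rule Un_least[OF Int_lower2])
    next
      assume "D = R" "E = P"
      then show ?thesis using E0 by (simp only:) (rule Un_least[OF _ Int_lower2])
    qed
    have "?L \<subseteq> words_over (P \<union> R)" using subgroup.subset[OF L] unfolding PR(1) F_eq_words_over .
    then have "?L = gen_by ((?L \<inter> words_over P) \<union> (?L \<inter> words_over R))" by (rule splits_generate[OF L _ PR(2) sp])
    then have LD: "?L \<subseteq> words_over D" using generate_subgroup_incl[OF sub words_over_subgroup] by (simp only:)
    obtain u v where uv: "l = u @ v @ winv u" "u \<in> F" "core_based (conjg u ` ?L)" using core_based_conjugate[OF L l] by blast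
    have "u @ v @ winv u \<in> words_over D" using subsetD[OF LD l(1)] uv(1) by simp
    then have "u \<in> words_over D" using words_over_append by blast
    then have uL: "conjg u ` ?L \<subseteq> words_over D" using words_over_conjg subsetD[OF LD] by (intro image_subsetI) metis
    have "conjg u ` ?L = conjg (g0 \<cdot> u) ` (Hs ! i0)" using conjg_image_image[OF g0(1) uv(2) subgroup.subset[OF s]] .
    moreover have "splits P (conjg u ` ?L)" using splits_one_sided[OF uL _ PR(2)] DE(1) by blast
    ultimately show ?thesis using uv g0 by (intro bexI[of _ "g0 \<cdot> u"]) auto
  qed
  then have "\<exists>g\<in>F. if i = i0 then core_based (conjg g ` (Hs ! i)) \<and> splits P (conjg g ` (Hs ! i))
      else conjg g ` (Hs ! i) \<subseteq> words_over P \<or> conjg g ` (Hs ! i) \<subseteq> words_over R" if "i < length Hs" for i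
    using others[OF that] by (cases "i = i0") simp_all
  then have "\<exists>Ks. conj_list Hs Ks \<and> (\<forall>i<length Hs. if i = i0 then core_based (Ks ! i) \<and> splits P (Ks ! i)
      else Ks ! i \<subseteq> words_over P \<or> Ks ! i \<subseteq> words_over R)"
    by (rule conj_list_choice)
  then obtain Ks where Ks: "conj_list Hs Ks" "\<And>i. i < length Hs \<Longrightarrow> if i = i0 then core_based (Ks ! i) \<and> splits P (Ks ! i)
      else Ks ! i \<subseteq> words_over P \<or> Ks ! i \<subseteq> words_over R" by blast
  have "cleaving P R i0 Ks" unfolding cleaving_def using PR i0 Ks(1) Ks(2)[of i0] Ks(2) by (auto simp: conj_list_def)
  then show ?thesis unfolding cleaved_def using Ks(1) by blast
qed

subsection \<open>Conjugate lists\<close>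

lemma conj_list_fg: "fg_list Hs \<Longrightarrow> conj_list Hs Ks \<Longrightarrow> fg_list Ks"
  unfolding fg_list_def conj_list_def
  by (metis conjg_aut fg_subgroup_image in_set_conv_nth)

lemma conj_list_cut: "fg_list Hs \<Longrightarrow> conj_list Hs Ks \<Longrightarrow> cut Ks Q = cut Hs Q"
proof -
  assume a: "fg_list Hs" "conj_list Hs Ks"
  have "card (cuts Q (Ks ! i)) = card (cuts Q (Hs ! i))" if i: "i < length Hs" for i
  proof -
    obtain g where "g \<in> F" "Ks ! i = conjg g ` (Hs ! i)" using a(2) i by (auto simp: conj_list_def)
    then show ?thesis using card_cuts_conjg[OF fg_subgroup_subgroup[OF fg_list_nth[OF a(1) i]]] by simp
  qed
  then show ?thesis unfolding cut_def using a(2) by (simp add: conj_list_def)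
qed

lemma conj_list_complexity: "finite B \<Longrightarrow> fg_list Hs \<Longrightarrow> conj_list Hs Ks \<Longrightarrow> complexity B Ks = complexity B Hs"
  using complexity_eq_cut[of Hs] complexity_eq_cut[of Ks] conj_list_fg conj_list_cut by simp

lemma conj_list_trans: "fg_list Hs \<Longrightarrow> conj_list Hs Ks \<Longrightarrow> conj_list Ks Ms \<Longrightarrow> conj_list Hs Ms"
proof -
  assume a: "fg_list Hs" "conj_list Hs Ks" "conj_list Ks Ms"
  have "\<exists>g\<in>F. Ms ! i = conjg g ` (Hs ! i)" if i: "i < length Hs" for i
  proof -
    obtain g where g: "g \<in> F" "Ks ! i = conjg g ` (Hs ! i)" using a(2) i by (auto simp: conj_list_def)
    obtain k where k: "k \<in> F" "Ms ! i = conjg k ` (Ks ! i)" using a i by (auto simp: conj_list_def)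
    have "Hs ! i \<subseteq> F" using fg_list_subset[OF a(1)] i by simp
    then have "Ms ! i = conjg (g \<cdot> k) ` (Hs ! i)" using g k conjg_image_image[OF g(1) k(1)] by simp
    then show ?thesis using g k by (intro bexI[of _ "g \<cdot> k"]) auto
  qed
  then show ?thesis using a by (auto simp: conj_list_def)
qed

lemma cleaved_conj_list: "fg_list Hs \<Longrightarrow> conj_list Hs Ks \<Longrightarrow> cleaved Ks \<Longrightarrow> cleaved Hs"
  unfolding cleaved_def using conj_list_trans by blast

lemma aut_image_conjg: "\<alpha> \<in> aut B \<Longrightarrow> g \<in> F \<Longrightarrow> H \<subseteq> F \<Longrightarrow> \<alpha> ` conjg g ` H = conjg (\<alpha> g) ` \<alpha> ` H"
  using aut_simps(6)[of \<alpha>] by (auto simp: image_image subset_iff intro!: image_cong)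

lemma conj_list_act: "\<alpha> \<in> aut B \<Longrightarrow> fg_list Hs \<Longrightarrow> conj_list Hs Ks \<Longrightarrow> conj_list (act \<alpha> Hs) (act \<alpha> Ks)"
proof -
  assume a: "\<alpha> \<in> aut B" "fg_list Hs" "conj_list Hs Ks"
  have "\<exists>g\<in>F. act \<alpha> Ks ! i = conjg g ` (act \<alpha> Hs ! i)" if i: "i < length Hs" for i
  proof -
    obtain g where g: "g \<in> F" "Ks ! i = conjg g ` (Hs ! i)" using a(3) i by (auto simp: conj_list_def)
    have "Hs ! i \<subseteq> F" using fg_list_subset[OF a(2)] i by simp
    then have "\<alpha> ` (Ks ! i) = conjg (\<alpha> g) ` \<alpha> ` (Hs ! i)" using g aut_image_conjg[OF a(1)] by simp
    moreover have "length Ks = length Hs" using a(3) by (simp add: conj_list_def)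
    ultimately show ?thesis using g aut_simps(1)[OF a(1)] i by (intro bexI[of _ "\<alpha> g"]) (auto simp: act_def)
  qed
  then show ?thesis using a(3) by (auto simp: conj_list_def)
qed

end

section \<open>Whitehead moves and cleavings\<close>

context free_grp
begin

lemma cleavingD:
  assumes "cleaving P R i0 Ks"
  shows "P \<union> R = B" "P \<inter> R = {}" "P \<noteq> {}" "R \<noteq> {}" "i0 < length Ks" "core_based (Ks ! i0)" "splits P (Ks ! i0)"
    "\<And>i. i < length Ks \<Longrightarrow> i \<noteq> i0 \<Longrightarrow> Ks ! i \<subseteq> words_over P \<or> Ks ! i \<subseteq> words_over R"
  using assms unfolding cleaving_def by blast+

lemma cleaving_swap:
  assumes "cleaving P R i0 Ks" "Ks ! i0 \<subseteq> F" shows "cleaving R P i0 Ks"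
proof -
  note c = cleavingD[OF assms(1)]
  have "splits R (Ks ! i0)" using splits_swap[OF assms(2) c(1,2,7)] .
  then show ?thesis unfolding cleaving_def using c by blast
qed

lemma whitehead_Cons:
  assumes "snd a \<in> B" "y # w \<in> F"
  shows "whitehead a A (y # w) = whitehead_letter a A y \<cdot> whitehead a A w"
  using assms by (simp add: whitehead_def)

lemma words_over_Cons: "y # w \<in> words_over D \<Longrightarrow> snd y \<in> D \<and> w \<in> words_over D"
  using Cons_F[of y w] by (simp add: words_over_def)

lemma single_words_over: "snd y \<in> D \<Longrightarrow> snd y \<in> B \<Longrightarrow> [y] \<in> words_over D"
  by (simp add: words_over_def)

section \<open>A move that is symmetric on one side of a cleaving\<close>

context
  fixes a :: "'b letter" and A :: "'b letter set" and P R R' :: "'b set"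
  assumes PR: "P \<union> R = B" "P \<inter> R = {}" and a: "snd a \<in> P" and R': "\<And>y. snd y \<in> R \<Longrightarrow> y \<in> A \<longleftrightarrow> snd y \<in> R'"
begin

lemma aB: "snd a \<in> B"
  using PR a by blast

lemma whitehead_over_P: "w \<in> words_over P \<Longrightarrow> whitehead a A w \<in> words_over P"
proof (induction w)
  case Nil
  then show ?case by (simp add: whitehead_def)
next
  case (Cons y w)
  have yw: "snd y \<in> P" "w \<in> words_over P" "y # w \<in> F" using words_over_Cons[OF Cons.prems] words_over_F[OF Cons.prems] by auto
  have "snd y \<in> B" using yw PR by blast
  then have "[y] \<in> words_over P" "[a] \<in> words_over P" "[letter_inv a] \<in> words_over P" "[] \<in> words_over P"
    using yw a aB by (auto simp: words_over_def)
  then have "whitehead_letter a A y \<in> words_over P" by (auto simp: whitehead_letter_def intro!: words_over_mul)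
  then show ?case using whitehead_Cons[OF aB yw(3)] Cons.IH[OF yw(2)] words_over_mul by simp
qed

text \<open>Every letter over \<open>R'\<close> is conjugated by the multiplier, hence so is every
  word in such letters.\<close>

lemma whitehead_over_moved: "w \<in> words_over (R \<inter> R') \<Longrightarrow> conjg [a] (whitehead a A w) = w"
proof (induction w)
  case Nil
  then show ?case using aB by (simp add: whitehead_def)
next
  case (Cons y w)
  have yw: "snd y \<in> R" "snd y \<in> R'" "w \<in> words_over (R \<inter> R')" "y # w \<in> F"
    using words_over_Cons[OF Cons.prems] words_over_F[OF Cons.prems] by auto
  have ya: "snd y \<noteq> snd a" using yw(1) a PR(2) by (metis disjoint_iff)
  have yB: "snd y \<in> B" using yw(1) PR(1) by blast
  have F: "[a] \<in> F" "[y] \<in> F" "w \<in> F" using aB yB yw(4) Cons_F by auto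
  have wF: "whitehead a A w \<in> F" using aut_simps(1)[OF whitehead_aut[OF aB] F(3)] .
  have "y \<in> A" "letter_inv y \<in> A" using R'[of y] R'[of "letter_inv y"] yw by simp_all
  then have "whitehead_letter a A y = [a] \<cdot> [y] \<cdot> ginv [a]" using ya F(1) by (simp add: whitehead_letter_def)
  then have "conjg [a] (whitehead a A (y # w)) = conjg [a] ([a] \<cdot> [y] \<cdot> ginv [a]) \<cdot> conjg [a] (whitehead a A w)"
    using whitehead_Cons[OF aB yw(4)] F wF by (simp add: conjg_mult)
  also have "conjg [a] ([a] \<cdot> [y] \<cdot> ginv [a]) = [y]" using F by (simp add: conjg_def m_assoc del: ginv_eq)
  finally show ?case using Cons.IH[OF yw(3)] mul_append[of "[y]" w] yw(4) by simp
qed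

lemma whitehead_over_fixed: "w \<in> words_over (R - R') \<Longrightarrow> whitehead a A w = w"
proof (induction w)
  case Nil
  then show ?case by (simp add: whitehead_def)
next
  case (Cons y w)
  have yw: "snd y \<in> R" "snd y \<notin> R'" "w \<in> words_over (R - R')" "y # w \<in> F"
    using words_over_Cons[OF Cons.prems] words_over_F[OF Cons.prems] by auto
  have ya: "snd y \<noteq> snd a" using yw(1) a PR(2) by (metis disjoint_iff)
  have yB: "snd y \<in> B" using yw(1) PR(1) by blast
  have "y \<notin> A" "letter_inv y \<notin> A" using R'[of y] R'[of "letter_inv y"] yw by simp_all
  then have "whitehead_letter a A y = [y]" using ya yB by (simp add: whitehead_letter_def)
  then show ?case using whitehead_Cons[OF aB yw(4)] Cons.IH[OF yw(3)] mul_append[of "[y]" w] yw(4) by simp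
qed

lemma whitehead_over_moved_mem: "w \<in> words_over (R \<inter> R') \<Longrightarrow> whitehead a A w \<in> words_over (P \<union> (R \<inter> R'))"
proof -
  assume w: "w \<in> words_over (R \<inter> R')"
  have wF: "w \<in> F" using words_over_F[OF w] .
  have F: "[a] \<in> F" "whitehead a A w \<in> F" using aB aut_simps(1)[OF whitehead_aut[OF aB] wF] by auto
  have "whitehead a A w = conjg (ginv [a]) w"
    using whitehead_over_moved[OF w] conjg_cancel(1)[OF F] by metis
  also have "\<dots> \<in> words_over (P \<union> (R \<inter> R'))"
    using w a aB F by (intro words_over_conjg) (auto simp: words_over_def)
  finally show ?thesis .
qed

text \<open>A half-space containing with each letter over \<open>R\<close> also its inverse only moves the part of the
  graph over \<open>R'\<close> to the other end of a new edge labelled by the multiplier.\<close>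

lemma whitehead_cleaved:
  assumes fg: "fg_list Ks" and PRne: "P \<noteq> {}" "R \<noteq> {}" and i0: "i0 < length Ks" "Ks ! i0 \<noteq> {[]}"
    and gen: "Ks ! i0 = gen_by (S \<union> (C \<union> D))" "S \<subseteq> words_over P" "C \<subseteq> words_over (R \<inter> R')" "D \<subseteq> words_over (R - R')"
    and others: "\<And>i. i < length Ks \<Longrightarrow> i \<noteq> i0 \<Longrightarrow> \<exists>g\<in>F. conjg g ` (Ks ! i) \<subseteq> words_over P \<or>
        conjg g ` (Ks ! i) \<subseteq> words_over (R \<inter> R') \<or> conjg g ` (Ks ! i) \<subseteq> words_over (R - R')"
  shows "cleaved (act (whitehead a A) Ks)"
proof -
  let ?t = "whitehead a A"
  have t: "?t \<in> aut B" by (rule whitehead_aut[OF aB])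
  have fg': "fg_list (act ?t Ks)" using fg_list_act[OF t fg] .
  have nth: "act ?t Ks ! i = ?t ` (Ks ! i)" if "i < length Ks" for i using that by (simp add: act_def)
  have F: "S \<subseteq> F" "C \<subseteq> F" "D \<subseteq> F" using gen words_over_F by blast+
  have img: "?t ` gen_by T = gen_by (?t ` T)" if "T \<subseteq> F" for T
    using group_hom.generate_img[OF aut_hom[OF t] that] by simp
  have ne: "act ?t Ks ! i0 \<noteq> {[]}"
  proof -
    have s: "subgroup (Ks ! i0) (free_group B)" using fg_subgroup_subgroup[OF fg_list_nth[OF fg i0(1)]] .
    then have "\<exists>l\<in>Ks ! i0. l \<noteq> []" using i0(2) subgroup.one_closed[OF s] by auto
    then obtain l where l: "l \<in> Ks ! i0" "l \<noteq> []" by blast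
    have "?t l \<noteq> []" using aut_simps(3,5)[OF t] subgroup.mem_carrier[OF s l(1)] l(2) Nil_F by metis
    then show ?thesis using nth[OF i0(1)] l(1) by auto
  qed
  have gen': "act ?t Ks ! i0 = gen_by (?t ` S \<union> (?t ` C \<union> ?t ` D))"
    using nth[OF i0(1)] gen(1) img[of "S \<union> (C \<union> D)"] F by (simp add: image_Un)
  have S': "?t ` S \<subseteq> words_over P" using gen(2) whitehead_over_P by blast
  have conj': "?t ` conjg g ` (Ks ! i) = conjg (?t g) ` (act ?t Ks ! i)" "?t g \<in> F" if "i < length Ks" "g \<in> F" for g i
    using aut_image_conjg[OF t that(2)] fg_list_subset[OF fg] that nth aut_simps(1)[OF t] by auto
  show ?thesis
  proof (cases "R - R' = {}")
    case False
    \<comment> \<open>The moved part is conjugated by \<open>a\<close> and joins the side of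
      \<open>P\<close>; the unmoved part keeps its base and forms the other side.\<close>
    have PR': "(P \<union> (R \<inter> R')) \<union> (R - R') = B" "(P \<union> (R \<inter> R')) \<inter> (R - R') = {}" using PR by blast+
    show ?thesis
    proof (rule cleavedI[OF fg' PR' _ False])
      show "P \<union> (R \<inter> R') \<noteq> {}" using PRne by blast
      show "i0 < length (act ?t Ks)" using i0 by simp
      show "conjg [] ` (act ?t Ks ! i0) = gen_by ((?t ` S \<union> ?t ` C) \<union> ?t ` D)"
      proof -
        have "act ?t Ks ! i0 \<subseteq> F" using fg_list_subset[OF fg'] i0 by simp
        then show ?thesis using conjg_image_one[of "act ?t Ks ! i0"] gen' by (simp add: Un_assoc)
      qed
      show "?t ` S \<union> ?t ` C \<subseteq> words_over (P \<union> (R \<inter> R'))"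
        using S' words_over_mono[of P "P \<union> (R \<inter> R')"] whitehead_over_moved_mem gen(3) by blast
      show "?t ` D \<subseteq> words_over (R - R')" using whitehead_over_fixed gen(4) by force
      show "\<exists>g\<in>F. conjg g ` (act ?t Ks ! i) \<subseteq> words_over (P \<union> (R \<inter> R')) \<or> conjg g ` (act ?t Ks ! i) \<subseteq> words_over (R - R')"
        if i: "i < length (act ?t Ks)" "i \<noteq> i0" for i
      proof -
        have il: "i < length Ks" using i by simp
        obtain g where g: "g \<in> F" "conjg g ` (Ks ! i) \<subseteq> words_over P \<or>
          conjg g ` (Ks ! i) \<subseteq> words_over (R \<inter> R') \<or> conjg g ` (Ks ! i) \<subseteq> words_over (R - R')" using others[OF il i(2)] by blast
        have "?t ` conjg g ` (Ks ! i) \<subseteq> words_over (P \<union> (R \<inter> R')) \<or> ?t ` conjg g ` (Ks ! i) \<subseteq> words_over (R - R')"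
          using g(2)
        proof (elim disjE)
          assume "conjg g ` (Ks ! i) \<subseteq> words_over P"
          then have "?t ` conjg g ` (Ks ! i) \<subseteq> words_over P" using whitehead_over_P by (intro image_subsetI) blast
          then show ?thesis using words_over_mono[of P "P \<union> (R \<inter> R')"] by blast
        next
          assume "conjg g ` (Ks ! i) \<subseteq> words_over (R \<inter> R')"
          then have "?t ` conjg g ` (Ks ! i) \<subseteq> words_over (P \<union> (R \<inter> R'))"
            using whitehead_over_moved_mem by (intro image_subsetI) blast
          then show ?thesis by blast
        next
          assume *: "conjg g ` (Ks ! i) \<subseteq> words_over (R - R')"
          then have fx: "?t w = w" if "w \<in> conjg g ` (Ks ! i)" for w using whitehead_over_fixed[OF subsetD[OF _ that]] by simp
          have "?t ` (conjg g ` (Ks ! i)) = (\<lambda>w. w) ` (conjg g ` (Ks ! i))" by (rule image_cong[OF refl fx])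
          then have "?t ` conjg g ` (Ks ! i) = conjg g ` (Ks ! i)" unfolding image_ident .
          then show ?thesis using * by simp
        qed
        then show ?thesis using conj'[OF il g(1)] by metis
      qed
    qed (use ne in auto)
  next
    \<comment> \<open>Nothing of \<open>R\<close> stays behind, so moving the base along
      \<open>a\<close> restores the old partition.\<close>
    case True
    then have RR: "R \<inter> R' = R" by blast
    have D': "?t ` D \<subseteq> {[]}" using whitehead_over_fixed gen(4) True by (auto simp: words_over_def)
    have aF: "[a] \<in> F" using aB by simp
    have tF: "?t ` S \<subseteq> F" "?t ` C \<subseteq> F" "?t ` D \<subseteq> F" using F aut_simps(1)[OF t] by blast+
    show ?thesis
    proof (rule cleavedI[OF fg' PR PRne, where ?g0.0 = "[a]"])
      show "i0 < length (act ?t Ks)" using i0 by simp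
      show "[a] \<in> F" by (rule aF)
      show "conjg [a] ` (act ?t Ks ! i0) = gen_by (conjg [a] ` ?t ` S \<union> (conjg [a] ` ?t ` C \<union> conjg [a] ` ?t ` D))"
        unfolding gen' using generate_image_conjg[OF aF, of "?t ` S \<union> (?t ` C \<union> ?t ` D)"] tF by (simp add: image_Un)
      show "conjg [a] ` ?t ` S \<subseteq> words_over P"
        using S' words_over_conjg[OF single_words_over[OF a aB]] by (intro image_subsetI) blast
      have "conjg [a] (?t c) \<in> words_over R" if "c \<in> C" for c
        using whitehead_over_moved[of c] gen(3) that RR by auto
      moreover have "conjg [a] (?t d) \<in> words_over R" if "d \<in> D" for d
      proof -
        have "?t d = []" using D' that by blast
        moreover have "conjg [a] [] = []" using aF by simp
        ultimately show ?thesis by (simp add: words_over_def)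
      qed
      ultimately show "conjg [a] ` ?t ` C \<union> conjg [a] ` ?t ` D \<subseteq> words_over R" by blast
      show "\<exists>g\<in>F. conjg g ` (act ?t Ks ! i) \<subseteq> words_over P \<or> conjg g ` (act ?t Ks ! i) \<subseteq> words_over R"
        if i: "i < length (act ?t Ks)" "i \<noteq> i0" for i
      proof -
        have il: "i < length Ks" using i by simp
        have empty: "words_over (R - R') \<subseteq> words_over (R \<inter> R')" unfolding True by (auto simp: words_over_def)
        obtain g where g: "g \<in> F" "conjg g ` (Ks ! i) \<subseteq> words_over P \<or> conjg g ` (Ks ! i) \<subseteq> words_over (R \<inter> R')"
          using others[OF il i(2)] empty by (meson order_trans)
        from g(2) show ?thesis
        proof
          assume "conjg g ` (Ks ! i) \<subseteq> words_over P"
          then have "?t ` conjg g ` (Ks ! i) \<subseteq> words_over P" using whitehead_over_P by (intro image_subsetI) blast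
          then show ?thesis using conj'[OF il g(1)] by metis
        next
          assume *: "conjg g ` (Ks ! i) \<subseteq> words_over (R \<inter> R')"
          then have fx: "conjg [a] (?t w) = w" if "w \<in> conjg g ` (Ks ! i)" for w using whitehead_over_moved[OF subsetD[OF _ that]] by simp
          have "(\<lambda>w. conjg [a] (?t w)) ` (conjg g ` (Ks ! i)) = (\<lambda>w. w) ` (conjg g ` (Ks ! i))" by (rule image_cong[OF refl fx])
          then have "conjg [a] ` ?t ` conjg g ` (Ks ! i) = conjg g ` (Ks ! i)" unfolding image_image[of "conjg [a]" ?t] image_ident .
          then have "conjg [a] ` conjg (?t g) ` (act ?t Ks ! i) \<subseteq> words_over R" using * RR conj'(1)[OF il g(1)] by simp
          moreover have "act ?t Ks ! i \<subseteq> F" using fg_list_subset[OF fg'] i by simp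
          ultimately have "conjg (?t g \<cdot> [a]) ` (act ?t Ks ! i) \<subseteq> words_over R"
            using conjg_image_image[OF conj'(2)[OF il g(1)] aF] by simp
          then show ?thesis using conj'(2)[OF il g(1)] aF by (intro bexI[of _ "?t g \<cdot> [a]"]) auto
        qed
      qed
    qed (use ne in auto)
  qed
qed

end


text \<open>Every component splits along \<open>P\<close>, so a vertex with directions on both sides
  is its base; at their bases, the components other than \<open>i0\<close> have directions on one
  side only.\<close>

lemma mixed_heads:
  assumes fg: "fg_list Ks" and c: "cleaving P R i0 Ks" and i: "i < length Ks" and g: "g \<in> F"
    and x: "x \<in> heads (conjg g ` (Ks ! i))" "snd x \<in> P" and y: "y \<in> heads (conjg g ` (Ks ! i))" "snd y \<in> R"
  shows "i = i0 \<and> g \<in> Ks ! i0"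
proof -
  note cd = cleavingD[OF c]
  have K: "subgroup (Ks ! i) (free_group B)" using fg_subgroup_subgroup[OF fg_list_nth[OF fg i]] .
  have sp: "splits P (Ks ! i)"
  proof (cases "i = i0")
    case False
    then show ?thesis using cd(8)[OF i False] splits_one_sided[OF _ _ cd(2)] by blast
  qed (use cd(7) in simp)
  have "snd y \<notin> P" using y(2) cd(2) by blast
  then have gK: "g \<in> Ks ! i" by (rule both_sides[OF K sp g x y(1)])
  have "i = i0"
  proof (rule ccontr)
    assume ne: "i \<noteq> i0"
    have e: "conjg g ` (Ks ! i) = Ks ! i" by (rule conjg_self[OF K gK])
    have hd: "\<exists>l\<in>Ks ! i. l \<noteq> [] \<and> z = hd l" if "z \<in> heads (conjg g ` (Ks ! i))" for z
      using that unfolding e heads_def by blast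
    have "snd z \<in> D" if z: "z \<in> heads (conjg g ` (Ks ! i))" "Ks ! i \<subseteq> words_over D" for z D
    proof -
      obtain l where "l \<in> words_over D" "l \<noteq> []" "z = hd l" using hd[OF z(1)] z(2) by blast
      then show ?thesis by (cases l) (auto simp: words_over_def)
    qed
    then show False using cd(8)[OF i ne] x y cd(2) by blast
  qed
  then show ?thesis using gK by simp
qed

text \<open>\<open>A\<close> is made constant on \<open>R\<close>, with the value chosen to create
  no crossing at the wedge vertex. Every other vertex has directions on one side only, where the new
  set agrees with \<open>A\<close> or is constant.\<close>

lemma restricted_half_space:
  assumes fg: "fg_list Ks" and c: "cleaving P R i0 Ks"
  shows "\<exists>A'. (\<forall>y. snd y \<in> P \<longrightarrow> (y \<in> A' \<longleftrightarrow> y \<in> A)) \<and> ((\<forall>y. snd y \<in> R \<longrightarrow> y \<in> A') \<or> (\<forall>y. snd y \<in> R \<longrightarrow> y \<notin> A')) \<and>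
     (\<forall>i<length Ks. cuts (hdset A') (Ks ! i) \<subseteq> cuts (hdset A) (Ks ! i))"
proof -
  note cd = cleavingD[OF c]
  \<comment> \<open>If all directions over \<open>P\<close> at the wedge vertex lie in
    \<open>A\<close>, then \<open>R\<close> is put inside and the new set is not crossed there.
    Otherwise \<open>R\<close> stays outside, and \<open>A\<close> is crossed there whenever the new
    set is.\<close>
  let ?in = "\<forall>x\<in>heads (Ks ! i0). snd x \<in> P \<longrightarrow> x \<in> A"
  define A' where "A' = {y. snd y \<in> P \<and> y \<in> A} \<union> (if ?in then {y. snd y \<in> R} else {})"
  have onP: "y \<in> A' \<longleftrightarrow> y \<in> A" if "snd y \<in> P" for y using that cd(2) unfolding A'_def by auto
  have onR: "y \<in> A' \<longleftrightarrow> ?in" if "snd y \<in> R" for y using that cd(2) unfolding A'_def by auto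
  have "crosses (hdset A) (conjg g ` (Ks ! i))" if i: "i < length Ks" and g: "g \<in> F" and cr: "crosses (hdset A') (conjg g ` (Ks ! i))" for i g
  proof -
    let ?h = "heads (conjg g ` (Ks ! i))"
    have K: "subgroup (Ks ! i) (free_group B)" using fg_subgroup_subgroup[OF fg_list_nth[OF fg i]] .
    have sub: "conjg g ` (Ks ! i) \<subseteq> F" using g subgroup.subset[OF K] by simp
    obtain x y where xy: "x \<in> ?h" "y \<in> ?h" "x \<in> A'" "y \<notin> A'" using cr unfolding crosses_heads[OF sub] by blast
    have side: "snd z \<in> P \<or> snd z \<in> R" if "z \<in> ?h" for z using heads_B[OF sub that] cd(1) by blast
    show ?thesis
    proof (cases "\<exists>u\<in>?h. \<exists>v\<in>?h. snd u \<in> P \<and> snd v \<in> R")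
      case True
      then have gi: "i = i0" "g \<in> Ks ! i0" using mixed_heads[OF fg c i g] by blast+
      then have h: "?h = heads (Ks ! i0)" using conjg_self[OF K] by simp
      have "\<not> ?in"
      proof
        assume ins: ?in
        then have "y \<in> A'" using side[OF xy(2)] onP onR xy(2) h by blast
        then show False using xy by blast
      qed
      then obtain z where z: "z \<in> ?h" "z \<notin> A" using h by blast
      moreover have "x \<in> A" using xy(3) \<open>\<not> ?in\<close> unfolding A'_def by (simp split: if_splits)
      ultimately show ?thesis unfolding crosses_heads[OF sub] using xy(1) by blast
    next
      case False
      then have "(snd x \<in> P \<and> snd y \<in> P) \<or> (snd x \<in> R \<and> snd y \<in> R)" using side[OF xy(1)] side[OF xy(2)] xy(1,2) by blast
      then have "x \<in> A" "y \<notin> A" using xy(3,4) onP onR by blast+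
      then show ?thesis unfolding crosses_heads[OF sub] using xy(1,2) by blast
    qed
  qed
  then have "cuts (hdset A') (Ks ! i) \<subseteq> cuts (hdset A) (Ks ! i)" if "i < length Ks" for i
    using that unfolding cuts_def by blast
  then show ?thesis using onP onR by (intro exI[of _ A']) blast
qed

lemma cleaving_generators:
  assumes fg: "fg_list Ks" and c: "cleaving P R i0 Ks"
  shows "Ks ! i0 = gen_by ((Ks ! i0 \<inter> words_over P) \<union> (Ks ! i0 \<inter> words_over R))"
    and "Ks ! i0 \<noteq> {[]}"
proof -
  note cd = cleavingD[OF c]
  have K: "subgroup (Ks ! i0) (free_group B)" using fg_subgroup_subgroup[OF fg_list_nth[OF fg cd(5)]] .
  have "Ks ! i0 \<subseteq> words_over (P \<union> R)" using subgroup.subset[OF K] unfolding cd(1) F_eq_words_over .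
  then show "Ks ! i0 = gen_by ((Ks ! i0 \<inter> words_over P) \<union> (Ks ! i0 \<inter> words_over R))"
    by (rule splits_generate[OF K _ cd(2,7)])
  show "Ks ! i0 \<noteq> {[]}" using cd(6) unfolding core_based_def heads_def by auto
qed

lemma whitehead_restricted_cleaved:
  assumes fg: "fg_list Ks" and c: "cleaving P R i0 Ks" and a: "snd a \<in> P"
    and A': "(\<forall>y. snd y \<in> R \<longrightarrow> y \<in> A') \<or> (\<forall>y. snd y \<in> R \<longrightarrow> y \<notin> A')"
  shows "cleaved (act (whitehead a A') Ks)"
proof -
  note cd = cleavingD[OF c] and cg = cleaving_generators[OF fg c]
  let ?L = "Ks ! i0"
  have oth: "\<exists>g\<in>F. conjg g ` (Ks ! i) \<subseteq> words_over P \<or> conjg g ` (Ks ! i) \<subseteq> words_over R" if "i < length Ks" "i \<noteq> i0" for i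
  proof -
    have "Ks ! i \<subseteq> F" using fg_list_subset[OF fg] that by simp
    then have "conjg [] ` (Ks ! i) = Ks ! i" using conjg_image_one by simp
    then show ?thesis using cd(8)[OF that] Nil_F by metis
  qed
  from A' show ?thesis
  proof
    assume *: "\<forall>y. snd y \<in> R \<longrightarrow> y \<in> A'"
    show ?thesis
    proof (rule whitehead_cleaved[OF cd(1,2) a _ fg cd(3,4,5) cg(2), where R' = R and S = "?L \<inter> words_over P"
          and C = "?L \<inter> words_over R" and D = "{}"])
      show "y \<in> A' \<longleftrightarrow> snd y \<in> R" if "snd y \<in> R" for y using * that by blast
      show "?L = gen_by (?L \<inter> words_over P \<union> (?L \<inter> words_over R \<union> {}))" unfolding Un_empty_right by (rule cg(1))
      show "\<exists>g\<in>F. conjg g ` (Ks ! i) \<subseteq> words_over P \<or> conjg g ` (Ks ! i) \<subseteq> words_over (R \<inter> R) \<or> conjg g ` (Ks ! i) \<subseteq> words_over (R - R)"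
        if "i < length Ks" "i \<noteq> i0" for i unfolding Int_absorb using oth[OF that] by blast
    qed simp_all
  next
    assume *: "\<forall>y. snd y \<in> R \<longrightarrow> y \<notin> A'"
    show ?thesis
    proof (rule whitehead_cleaved[OF cd(1,2) a _ fg cd(3,4,5) cg(2), where R' = "{}" and S = "?L \<inter> words_over P"
          and C = "{}" and D = "?L \<inter> words_over R"])
      show "y \<in> A' \<longleftrightarrow> snd y \<in> {}" if "snd y \<in> R" for y using * that by blast
      show "?L = gen_by (?L \<inter> words_over P \<union> ({} \<union> ?L \<inter> words_over R))" unfolding Un_empty_left by (rule cg(1))
      show "\<exists>g\<in>F. conjg g ` (Ks ! i) \<subseteq> words_over P \<or> conjg g ` (Ks ! i) \<subseteq> words_over (R \<inter> {}) \<or> conjg g ` (Ks ! i) \<subseteq> words_over (R - {})"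
        if "i < length Ks" "i \<noteq> i0" for i unfolding Diff_empty using oth[OF that] by blast
    qed simp_all
  qed
qed

text \<open>Minimality is known only against cleaved competitors, so it can be used only for moves
  restricted to one side, which stay cleaved. The comparison shows that \<open>A\<close> is crossed
  at no vertex whose directions are all over \<open>R\<close>; hence \<open>A\<close> respects the
  graph over \<open>R\<close> and \<open>whitehead_cleaved\<close> applies.\<close>

theorem whitehead_step:
  assumes fin: "finite B" and fg: "fg_list Ks" and c: "cleaving P R i0 Ks"
    and min: "\<And>\<alpha>. \<alpha> \<in> aut B \<Longrightarrow> cleaved (act \<alpha> Ks) \<Longrightarrow> complexity B Ks \<le> complexity B (act \<alpha> Ks)"
    and two: "\<And>y. snd y \<in> B \<Longrightarrow> cut Ks (hdset {y}) \<ge> 2"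
    and a: "snd a \<in> P" "a \<in> A" "letter_inv a \<notin> A" and le: "cut Ks (hdset A) \<le> cut Ks (hdset {a})"
  shows "cleaved (act (whitehead a A) Ks)"
proof -
  note cd = cleavingD[OF c]
  have sub: "subgroup (Ks ! i) (free_group B)" if "i < length Ks" for i
    using fg_subgroup_subgroup[OF fg_list_nth[OF fg that]] .
  have FK: "Ks ! i \<subseteq> F" if "i < length Ks" for i using subgroup.subset[OF sub[OF that]] .
  have finc: "finite (cuts (hdset A) (Ks ! i))" if "i < length Ks" for A i
    using fg_subgroup_finite_cuts[OF fg_list_nth[OF fg that]] by simp
  have PB: "P \<subseteq> B" "R \<subseteq> B" using cd(1) by blast+
  have bound: "cut Ks (hdset {b}) \<le> cut Ks (hdset A')"
    if "snd b \<in> B" "b \<in> A'" "letter_inv b \<notin> A'" "cleaved (act (whitehead b A') Ks)" for b A'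
    using min[OF whitehead_aut[OF that(1)] that(4)] complexity_whitehead[OF fin fg that(1-3)] by linarith
  \<comment> \<open>Its cut cosets are among those of \<open>A\<close>, yet its cut number turns out
    to be no smaller, so both sets cut the same cosets.\<close>
  obtain A1 where A1: "\<forall>y. snd y \<in> P \<longrightarrow> (y \<in> A1 \<longleftrightarrow> y \<in> A)" "(\<forall>y. snd y \<in> R \<longrightarrow> y \<in> A1) \<or> (\<forall>y. snd y \<in> R \<longrightarrow> y \<notin> A1)"
    "\<forall>i<length Ks. cuts (hdset A1) (Ks ! i) \<subseteq> cuts (hdset A) (Ks ! i)"
    using restricted_half_space[OF fg c, of A] by blast
  have "a \<in> A1" "letter_inv a \<notin> A1" "snd a \<in> B" using A1(1)[rule_format, of a] A1(1)[rule_format, of "letter_inv a"] a PB(1) by auto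
  then have "cut Ks (hdset {a}) \<le> cut Ks (hdset A1)"
    using whitehead_restricted_cleaved[OF fg c a(1) A1(2)] by (intro bound)
  then have cut_le: "cut Ks (hdset A) \<le> cut Ks (hdset A1)" using le by simp
  have cuts_eq: "cuts (hdset A1) (Ks ! i) = cuts (hdset A) (Ks ! i)" if i: "i < length Ks" for i
  proof (rule ccontr)
    assume "\<not> ?thesis"
    then have "card (cuts (hdset A1) (Ks ! i)) < card (cuts (hdset A) (Ks ! i))"
      using A1(3) i finc[OF i] by (intro psubset_card_mono) auto
    then have "cut Ks (hdset A1) < cut Ks (hdset A)" unfolding cut_def
      using i A1(3) finc by (intro sum_strict_mono_ex1) (auto intro!: card_mono)
    then show False using cut_le by simp
  qed
  \<comment> \<open>A vertex crossed by \<open>A\<close> is crossed by \<open>A1\<close> as well,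
    and \<open>A1\<close> is constant on \<open>R\<close>, so some direction there is over
    \<open>P\<close>.\<close>
  have cross_P: "\<exists>x\<in>heads (conjg g ` (Ks ! i)). snd x \<in> P"
    if i: "i < length Ks" and g: "g \<in> F" and cr: "crosses (hdset A) (conjg g ` (Ks ! i))" for i g
  proof -
    have s: "conjg g ` (Ks ! i) \<subseteq> F" using g FK[OF i] by simp
    have "coset (Ks ! i) g \<in> cuts (hdset A1) (Ks ! i)"
      unfolding cuts_eq[OF i] coset_in_cuts_iff[OF sub[OF i] g] by (rule cr)
    then have "crosses (hdset A1) (conjg g ` (Ks ! i))" unfolding coset_in_cuts_iff[OF sub[OF i] g] .
    then obtain x y where xy: "x \<in> heads (conjg g ` (Ks ! i))" "y \<in> heads (conjg g ` (Ks ! i))" "x \<in> A1" "y \<notin> A1"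
      unfolding crosses_heads[OF s] by blast
    have "snd x \<in> P \<or> snd x \<in> R" "snd y \<in> P \<or> snd y \<in> R" using heads_B[OF s] xy(1,2) cd(1) by blast+
    then show ?thesis using xy A1(2) by blast
  qed
  text \<open>If \<open>A\<close> were not symmetric on \<open>R\<close>, the restriction of \<open>A\<close> to \<open>R\<close> would be crossed at most at the wedge
    point, and a Whitehead move over \<open>R\<close> would lower the complexity.\<close>
  have sym: "letter_inv b \<in> A" if b: "snd b \<in> R" "b \<in> A" for b
  proof (rule ccontr)
    assume nb: "letter_inv b \<notin> A"
    have c': "cleaving R P i0 Ks" using cleaving_swap[OF c FK[OF cd(5)]] .
    obtain A2 where A2: "\<forall>y. snd y \<in> R \<longrightarrow> (y \<in> A2 \<longleftrightarrow> y \<in> A)" "(\<forall>y. snd y \<in> P \<longrightarrow> y \<in> A2) \<or> (\<forall>y. snd y \<in> P \<longrightarrow> y \<notin> A2)"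
      "\<forall>i<length Ks. cuts (hdset A2) (Ks ! i) \<subseteq> cuts (hdset A) (Ks ! i)"
      using restricted_half_space[OF fg c', of A] by blast
    have "b \<in> A2" "letter_inv b \<notin> A2" "snd b \<in> B"
      using A2(1)[rule_format, of b] A2(1)[rule_format, of "letter_inv b"] b nb PB(2) by auto
    then have bb: "cut Ks (hdset {b}) \<le> cut Ks (hdset A2)"
      using whitehead_restricted_cleaved[OF fg c' b(1) A2(2)] by (intro bound)
    \<comment> \<open>\<open>A2\<close> is constant on \<open>P\<close>, so a crossing needs a
      direction over \<open>R\<close>, while \<open>cross_P\<close> supplies one over
      \<open>P\<close>. Only the wedge vertex has both.\<close>
    have only: "i = i0 \<and> C = Ks ! i0" if i: "i < length Ks" and C: "C \<in> cuts (hdset A2) (Ks ! i)" for i C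
    proof -
      obtain g where g: "g \<in> F" "C = coset (Ks ! i) g" "crosses (hdset A2) (conjg g ` (Ks ! i))" using C by (auto simp: cuts_def)
      have s: "conjg g ` (Ks ! i) \<subseteq> F" using g FK[OF i] by simp
      obtain x y where xy: "x \<in> heads (conjg g ` (Ks ! i))" "y \<in> heads (conjg g ` (Ks ! i))" "x \<in> A2" "y \<notin> A2"
        using g(3) unfolding crosses_heads[OF s] by blast
      have "snd x \<in> P \<or> snd x \<in> R" "snd y \<in> P \<or> snd y \<in> R" using heads_B[OF s] xy(1,2) cd(1) by blast+
      then obtain z where z: "z \<in> heads (conjg g ` (Ks ! i))" "snd z \<in> R" using xy A2(2) by blast
      have "C \<in> cuts (hdset A) (Ks ! i)" using A2(3) i C by blast
      then have "crosses (hdset A) (conjg g ` (Ks ! i))" using g coset_in_cuts_iff[OF sub[OF i] g(1)] by simp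
      then obtain w where "w \<in> heads (conjg g ` (Ks ! i))" "snd w \<in> P" using cross_P[OF i g(1)] by blast
      then have "i = i0 \<and> g \<in> Ks ! i0" using mixed_heads[OF fg c i g(1) _ _ z] by blast
      moreover have "coset (Ks ! i0) h = Ks ! i0" if "h \<in> Ks ! i0" for h
        using coset_join2[OF _ sub[OF cd(5)] that] subgroup.mem_carrier[OF sub[OF cd(5)] that] by blast
      ultimately show ?thesis using g(2) by simp
    qed
    have "card (cuts (hdset A2) (Ks ! i)) \<le> of_bool (i = i0)" if i: "i < length Ks" for i
    proof (cases "i = i0")
      case True
      then have "cuts (hdset A2) (Ks ! i) \<subseteq> {Ks ! i0}" using only[OF i] by blast
      then have "card (cuts (hdset A2) (Ks ! i)) \<le> card {Ks ! i0}" by (intro card_mono) auto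
      then show ?thesis using True by simp
    next
      case False
      then have "cuts (hdset A2) (Ks ! i) = {}" using only[OF i] by blast
      then show ?thesis by simp
    qed
    then have "cut Ks (hdset A2) \<le> (\<Sum>i<length Ks. of_bool (i = i0))" unfolding cut_def by (intro sum_mono) simp
    also have "\<dots> = 1" using cd(5) by (simp add: of_bool_def sum.delta)
    finally show False using bb two[of b] b PB(2) by auto
  qed
  \<comment> \<open>By the symmetry, membership in \<open>A\<close> over \<open>R\<close> depends
    only on the label.\<close>
  define R' where "R' = snd ` {y\<in>A. snd y \<in> R}"
  have R': "y \<in> A \<longleftrightarrow> snd y \<in> R'" if y: "snd y \<in> R" for y
  proof
    assume "snd y \<in> R'"
    then obtain z where z: "z \<in> A" "snd z \<in> R" "snd y = snd z" by (auto simp: R'_def)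
    then show "y \<in> A" using sym[of z] snd_eq_iff_letter[of y z] by auto
  qed (use y in \<open>auto simp: R'_def\<close>)
  let ?L = "Ks ! i0"
  have L: "subgroup ?L (free_group B)" using sub[OF cd(5)] .
  define C where "C = ?L \<inter> words_over R"
  have Csub: "subgroup C (free_group B)" unfolding C_def using subgroups_Inter_pair[OF L words_over_subgroup] .
  \<comment> \<open>Where all directions are over \<open>R\<close>, a path cannot pass between
    labels inside and outside \<open>R'\<close>, because \<open>A\<close> would be crossed at that
    vertex.\<close>
  have nocross: "(snd (last u) \<in> R') = (snd (hd v) \<in> R')"
    if i: "i < length Ks" and K: "K = conjg k ` (Ks ! i)" "k \<in> F" "core_based K" and uv: "u @ v \<in> K" "u \<noteq> []" "v \<noteq> []" "u @ v \<in> words_over R"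
      and noP: "\<And>x. x \<in> heads (conjg u ` K) \<Longrightarrow> snd x \<in> R" for i k K u v
  proof (rule ccontr)
    assume ne: "\<not> ?thesis"
    have Ksub: "subgroup K (free_group B)" unfolding K(1) by (rule conjg_subgroup[OF K(2) sub[OF i]])
    have uF: "u \<in> F" using words_over_F[OF uv(4)] append_F by blast
    have h: "letter_inv (last u) \<in> heads (conjg u ` K)" "hd v \<in> heads (conjg u ` K)"
      using heads_at_prefix[OF Ksub K(3) uv(1)] uv(2,3) by blast+
    have "snd (last u) \<in> R" "snd (hd v) \<in> R" using noP[OF h(1)] noP[OF h(2)] by simp_all
    then have "letter_inv (last u) \<in> A \<longleftrightarrow> hd v \<notin> A" using ne R'[of "letter_inv (last u)"] R'[of "hd v"] by simp
    moreover have s: "conjg u ` K \<subseteq> F" using uF subgroup.subset[OF Ksub] by simp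
    ultimately have cr: "crosses (hdset A) (conjg u ` K)" unfolding crosses_heads[OF s] using h by blast
    have e: "conjg u ` K = conjg (k \<cdot> u) ` (Ks ! i)" unfolding K(1) by (rule conjg_image_image[OF K(2) uF FK[OF i]])
    have "k \<cdot> u \<in> F" using K(2) uF by simp
    then obtain x where "x \<in> heads (conjg u ` K)" "snd x \<in> P" using cross_P[OF i] cr unfolding e by blast
    then show False using noP cd(2) by blast
  qed
  \<comment> \<open>Such a passage can thus happen only at a vertex that also has a direction over
    \<open>P\<close>, which is the wedge vertex.\<close>
  have spC: "splits R' C" unfolding splits_def
  proof (intro allI impI)
    fix u v assume uv: "u @ v \<in> C" "u \<noteq> []" "v \<noteq> []" "(snd (last u) \<in> R') \<noteq> (snd (hd v) \<in> R')"
    have uvL: "u @ v \<in> ?L" "u @ v \<in> words_over R" using uv(1) by (auto simp: C_def)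
    have uF: "u \<in> F" using words_over_F[OF uvL(2)] append_F by blast
    have e: "conjg [] ` ?L = ?L" using conjg_image_one[OF FK[OF cd(5)]] by simp
    have "\<exists>x\<in>heads (conjg u ` ?L). snd x \<notin> R"
      using nocross[OF cd(5), of ?L "[]" u v] e cd(6) uvL uv by auto
    then obtain x where x: "x \<in> heads (conjg u ` ?L)" "snd x \<notin> R" by blast
    have "conjg u ` ?L \<subseteq> F" using uF FK[OF cd(5)] by simp
    then have xP: "snd x \<in> P" using heads_B[OF _ x(1)] x(2) cd(1) by blast
    have "hd v \<in> heads (conjg u ` ?L)" using heads_at_prefix(2)[OF L cd(6) uvL(1) uv(3)] .
    moreover have "snd (hd v) \<in> R" using uvL(2) uv(3) by (auto simp: words_over_def)
    ultimately have "u \<in> ?L" using mixed_heads[OF fg c cd(5) uF x(1) xP] by blast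
    then show "u \<in> C" using words_over_append[OF uvL(2)] by (simp add: C_def)
  qed
  have "C \<subseteq> words_over ((R \<inter> R') \<union> (R - R'))"
  proof -
    have "(R \<inter> R') \<union> (R - R') = R" by blast
    then show ?thesis by (simp add: C_def)
  qed
  moreover have "splits (R \<inter> R') C"
  proof -
    have inR: "snd z \<in> R" if "z \<in> set w" "w \<in> C" for w z using that by (auto simp: C_def words_over_def)
    show ?thesis unfolding splits_def
    proof (intro allI impI)
      fix u v assume uv: "u @ v \<in> C" "u \<noteq> []" "v \<noteq> []" "(snd (last u) \<in> R \<inter> R') \<noteq> (snd (hd v) \<in> R \<inter> R')"
      have "snd (last u) \<in> R" "snd (hd v) \<in> R" using inR[of _ "u @ v"] uv(1-3) by simp_all
      then have "(snd (last u) \<in> R') \<noteq> (snd (hd v) \<in> R')" using uv(4) by simp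
      then show "u \<in> C" using spC uv(1-3) unfolding splits_def by blast
    qed
  qed
  ultimately have Cgen: "C = gen_by ((C \<inter> words_over (R \<inter> R')) \<union> (C \<inter> words_over (R - R')))"
    by (intro splits_generate[OF Csub]) auto
  let ?S = "?L \<inter> words_over P" and ?C1 = "C \<inter> words_over (R \<inter> R')" and ?C2 = "C \<inter> words_over (R - R')"
  have Lgen: "?L = gen_by (?S \<union> (?C1 \<union> ?C2))"
  proof
    show "gen_by (?S \<union> (?C1 \<union> ?C2)) \<subseteq> ?L"
      by (rule generate_subgroup_incl[OF _ L]) (auto simp: C_def)
    have SF: "?S \<union> (?C1 \<union> ?C2) \<subseteq> F" using FK[OF cd(5)] by (auto simp: C_def)
    have "C \<subseteq> gen_by (?S \<union> (?C1 \<union> ?C2))" by (subst Cgen) (rule mono_generate, blast)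
    moreover have "?S \<subseteq> gen_by (?S \<union> (?C1 \<union> ?C2))" by (auto intro: generate.incl)
    ultimately have "?S \<union> C \<subseteq> gen_by (?S \<union> (?C1 \<union> ?C2))" by (rule Un_least[rotated])
    then have "gen_by (?S \<union> C) \<subseteq> gen_by (?S \<union> (?C1 \<union> ?C2))"
      by (rule generate_subgroup_incl[OF _ generate_is_subgroup[OF SF]])
    then show "?L \<subseteq> gen_by (?S \<union> (?C1 \<union> ?C2))" using cleaving_generators(1)[OF fg c] unfolding C_def by (simp only:)
  qed
  \<comment> \<open>A component over \<open>R\<close> meets no directions over \<open>P\<close>, so
    all of its labels are of one kind.\<close>
  have others: "\<exists>g\<in>F. conjg g ` (Ks ! i) \<subseteq> words_over P \<or>
        conjg g ` (Ks ! i) \<subseteq> words_over (R \<inter> R') \<or> conjg g ` (Ks ! i) \<subseteq> words_over (R - R')"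
    if i: "i < length Ks" "i \<noteq> i0" for i
  proof (cases "Ks ! i \<subseteq> words_over P")
    case True
    moreover have "conjg [] ` (Ks ! i) = Ks ! i" using conjg_image_one[OF FK[OF i(1)]] by simp
    ultimately show ?thesis using Nil_F by metis
  next
    case False
    then have KR: "Ks ! i \<subseteq> words_over R" using cd(8)[OF i] by blast
    have "\<not> Ks ! i \<subseteq> {[]}" using False by (auto simp: words_over_def)
    then obtain l where l: "l \<in> Ks ! i" "l \<noteq> []" by blast
    obtain k v where k: "l = k @ v @ winv k" "k \<in> F" "core_based (conjg k ` (Ks ! i))" using core_based_conjugate[OF sub[OF i(1)] l] by blast
    let ?K = "conjg k ` (Ks ! i)"
    have "k @ v @ winv k \<in> words_over R" using subsetD[OF KR l(1)] k(1) by simp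
    then have kR: "k \<in> words_over R" using words_over_append by blast
    have KR': "?K \<subseteq> words_over R" using words_over_conjg[OF kR] subsetD[OF KR] by (intro image_subsetI) metis
    have headR: "snd x \<in> R" if "x \<in> heads (conjg u ` ?K)" "u \<in> words_over R" for x u
    proof -
      have "conjg u ` ?K \<subseteq> words_over R" using words_over_conjg[OF that(2)] subsetD[OF KR'] by (intro image_subsetI) metis
      then have "heads (conjg u ` ?K) \<subseteq> hd ` (words_over R - {[]})" unfolding heads_def by (intro image_mono Diff_mono) auto
      then have "x \<in> hd ` (words_over R - {[]})" using that(1) by (rule subsetD)
      then obtain m where "m \<in> words_over R" "m \<noteq> []" "x = hd m" by auto
      then show ?thesis by (cases m) (auto simp: words_over_def)
    qed
    have nc: "(snd (last u) \<in> R') = (snd (hd v) \<in> R')" if "u @ v \<in> ?K" "u \<noteq> []" "v \<noteq> []" for u v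
    proof -
      have uvR: "u @ v \<in> words_over R" using subsetD[OF KR' that(1)] .
      then show ?thesis using headR words_over_append[OF uvR] by (intro nocross[OF i(1) refl k(2,3) that]) auto
    qed
    have K1: "conjg [] ` ?K = ?K" using conjg_image_one[of ?K] k(2) FK[OF i(1)] by simp
    have nil: "[] \<in> words_over R" by (simp add: words_over_def)
    have hR: "snd x \<in> R" if "x \<in> heads ?K" for x using headR[of x "[]"] K1 that nil by simp
    have KF: "?K \<subseteq> F" using k(2) FK[OF i(1)] by simp
    have same: "(snd x \<in> R') = (snd y \<in> R')" if "x \<in> heads ?K" "y \<in> heads ?K" for x y
    proof (rule ccontr)
      assume ne: "\<not> ?thesis"
      then have "\<exists>x\<in>heads ?K. \<exists>y\<in>heads ?K. x \<in> A \<and> y \<notin> A" using R'[OF hR[OF that(1)]] R'[OF hR[OF that(2)]] that by metis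
      then have "crosses (hdset A) ?K" unfolding crosses_heads[OF KF] .
      then show False using cross_P[OF i(1) k(2)] hR cd(2) by blast
    qed
    obtain x where x: "x \<in> heads ?K" using k(3) unfolding core_based_def by blast
    have all: "(snd z \<in> R') = (snd x \<in> R')" if z: "z \<in> set w" "w \<in> ?K" for z w
    proof (rule ccontr)
      assume ne: "\<not> ?thesis"
      define M where "M = {b. (b \<in> R') = (snd x \<in> R')}"
      have "w \<noteq> []" using z by auto
      then have "hd w \<in> heads ?K" using z unfolding heads_def by blast
      then have hM: "snd (hd w) \<in> M" using same[OF _ x] by (simp add: M_def)
      obtain t d where td: "w = t @ d" "\<And>z. z \<in> set t \<Longrightarrow> snd z \<in> M" "d \<noteq> [] \<Longrightarrow> snd (hd d) \<notin> M" "t \<noteq> []"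
        using takeWhile_split[of w M] \<open>w \<noteq> []\<close> hM by metis
      have d: "d \<noteq> []" using td(1) td(2)[of z] z(1) ne unfolding M_def by auto
      have "t @ d \<in> ?K" using td(1) z(2) by simp
      then have "(snd (last t) \<in> R') = (snd (hd d) \<in> R')" using td(4) d by (rule nc)
      moreover have "snd (last t) \<in> M" "snd (hd d) \<notin> M" using td(2)[of "last t"] td(4) td(3)[OF d] by simp_all
      ultimately show False unfolding M_def by simp
    qed
    have "?K \<subseteq> words_over (R \<inter> R') \<or> ?K \<subseteq> words_over (R - R')"
    proof (cases "snd x \<in> R'")
      case True
      have "w \<in> words_over (R \<inter> R')" if w: "w \<in> ?K" for w
        using subsetD[OF KR' w] all[OF _ w] True by (auto simp: words_over_def)
      then show ?thesis by blast
    next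
      case False
      have "w \<in> words_over (R - R')" if w: "w \<in> ?K" for w
        using subsetD[OF KR' w] all[OF _ w] False by (auto simp: words_over_def)
      then show ?thesis by blast
    qed
    then show ?thesis using k(2) by blast
  qed
  show ?thesis
    by (rule whitehead_cleaved[OF cd(1,2) a(1) R' fg cd(3,4,5) cleaving_generators(2)[OF fg c] Lgen _ _ _ others]) auto
qed

end

section \<open>Signed permutations\<close>

context free_grp
begin

text \<open>With the conjugator removed, the automorphism acts letter by letter. No cancellation
  occurs because \<open>\<phi>\<close> is injective on the letters over \<open>B\<close> and
  commutes with inversion.\<close>

lemma signed_permutation_map:
  assumes \<gamma>: "\<gamma> \<in> aut B" "signed_permutation \<gamma>"
  shows "\<exists>g\<in>F. \<exists>\<phi> \<rho>. bij_betw \<rho> B B \<and> (\<forall>y. snd (\<phi> y) = \<rho> (snd y)) \<and>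
    (\<forall>y z. snd y \<in> B \<longrightarrow> snd z \<in> B \<longrightarrow> \<phi> y = \<phi> z \<longrightarrow> y = z) \<and> (\<forall>w\<in>F. conjg (winv g) (\<gamma> w) = map \<phi> w)"
proof -
  obtain g \<pi> where g: "g \<in> F" and bij: "bij_betw (snd \<circ> \<pi>) B B" and \<pi>: "\<forall>b\<in>B. \<gamma> [(True, b)] = conjg g [\<pi> b]"
    using \<gamma>(2) unfolding signed_permutation_def by blast
  define \<rho> where "\<rho> = snd \<circ> \<pi>"
  define \<phi> where "\<phi> y = (if fst y then \<pi> (snd y) else letter_inv (\<pi> (snd y)))" for y :: "'b letter"
  have sn: "snd (\<phi> y) = \<rho> (snd y)" for y by (simp add: \<phi>_def \<rho>_def)
  have \<phi>inv: "\<phi> (letter_inv y) = letter_inv (\<phi> y)" for y by (simp add: \<phi>_def letter_inv_def[of y])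
  have \<rho>B: "\<rho> b \<in> B" if "b \<in> B" for b using bij that unfolding \<rho>_def by (auto simp: bij_betw_def)
  have inj: "y = z" if "snd y \<in> B" "snd z \<in> B" "\<phi> y = \<phi> z" for y z
  proof -
    have "\<rho> (snd y) = \<rho> (snd z)" using sn that(3) by metis
    then have "snd y = snd z" using bij that(1,2) unfolding \<rho>_def bij_betw_def inj_on_def by blast
    then show ?thesis using snd_eq_iff_letter[of y z] \<phi>inv[of z] that(3) by auto
  qed
  have mapF: "map \<phi> w \<in> F" if "w \<in> F" for w
    using that
  proof (induction w)
    case (Cons y w)
    have yw: "snd y \<in> B" "w \<in> F" "w \<noteq> [] \<Longrightarrow> hd w \<noteq> letter_inv y" using Cons.prems Cons_F by auto
    have "hd (map \<phi> w) \<noteq> letter_inv (\<phi> y)" if ne: "w \<noteq> []"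
    proof
      assume "hd (map \<phi> w) = letter_inv (\<phi> y)"
      then have "\<phi> (hd w) = \<phi> (letter_inv y)" using ne \<phi>inv by (simp add: hd_map)
      moreover have "snd (hd w) \<in> B" using yw(2) ne by (cases w) (auto simp: Cons_F)
      ultimately show False using inj[of "hd w" "letter_inv y"] yw ne by simp
    qed
    then show ?case using Cons.IH yw \<rho>B sn by (simp add: Cons_F)
  qed simp
  let ?d = "conjg (winv g) \<circ> \<gamma>"
  have d: "?d \<in> aut B" using aut_comp[OF conjg_aut \<gamma>(1)] g by simp
  have d1: "?d [(True, b)] = [\<pi> b]" if "b \<in> B" for b
  proof -
    have "[\<pi> b] \<in> F" using \<rho>B[OF that] by (simp add: \<rho>_def)
    then show ?thesis using \<pi> that conjg_cancel(1)[OF g, of "[\<pi> b]"] g by simp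
  qed
  have dl: "?d [y] = [\<phi> y]" if "snd y \<in> B" for y
  proof (cases "fst y")
    case True
    then show ?thesis using d1[OF that] by (cases y) (simp add: \<phi>_def)
  next
    case False
    have y: "[y] = winv [(True, snd y)]" using False by (cases y) (simp add: letter_inv_def)
    have "[(True, snd y)] \<in> F" using that by simp
    then have "?d [y] = winv (?d [(True, snd y)])" unfolding y by (rule aut_simps(4)[OF d])
    then show ?thesis using d1[OF that] False by (simp add: \<phi>_def)
  qed
  have "?d w = map \<phi> w" if "w \<in> F" for w
    using that
  proof (induction w)
    case Nil
    then show ?case using aut_simps(3)[OF d] by simp
  next
    case (Cons y w)
    have yw: "[y] \<in> F" "w \<in> F" "y # w = [y] \<cdot> w" using Cons.prems Cons_F mul_append[of "[y]" w] by auto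
    have "?d (y # w) = ?d [y] \<cdot> ?d w" unfolding yw(3) by (rule aut_simps(2)[OF d yw(1,2)])
    also have "\<dots> = [\<phi> y] \<cdot> map \<phi> w" using dl yw Cons.IH by simp
    also have "\<dots> = map \<phi> (y # w)" using mul_append[of "[\<phi> y]" "map \<phi> w"] mapF[OF Cons.prems] by simp
    finally show ?case .
  qed
  then show ?thesis using g bij inj sn unfolding \<rho>_def[symmetric]
    by (intro bexI[of _ g] exI[of _ \<phi>] exI[of _ \<rho>]) auto
qed

lemma signed_permutation_inverse:
  assumes \<gamma>: "\<gamma> \<in> aut B" "signed_permutation \<gamma>" and \<beta>: "\<beta> \<in> aut B" "\<forall>w\<in>F. \<beta> (\<gamma> w) = w"
  shows "signed_permutation \<beta>"
proof -
  obtain g \<pi> where g: "g \<in> F" and bij: "bij_betw (snd \<circ> \<pi>) B B" and \<pi>: "\<forall>b\<in>B. \<gamma> [(True, b)] = conjg g [\<pi> b]"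
    using \<gamma>(2) unfolding signed_permutation_def by blast
  define \<tau> where "\<tau> = inv_into B (snd \<circ> \<pi>)"
  \<comment> \<open>The inverse permutation keeps the sign: \<open>b \<mapsto> c^-1\<close> is
    undone by \<open>c \<mapsto> b^-1\<close>.\<close>
  define \<pi>' where "\<pi>' c = (fst (\<pi> (\<tau> c)), \<tau> c)" for c
  have "snd \<circ> \<pi>' = inv_into B (snd \<circ> \<pi>)" by (simp add: fun_eq_iff \<pi>'_def \<tau>_def)
  then have bij': "bij_betw (snd \<circ> \<pi>') B B" using bij_betw_inv_into[OF bij] by (simp only:)
  let ?k = "winv (\<beta> g)"
  have kF: "?k \<in> F" "\<beta> g \<in> F" using aut_simps(1)[OF \<beta>(1) g] by simp_all
  have "\<beta> [(True, c)] = conjg ?k [\<pi>' c]" if c: "c \<in> B" for c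
  proof -
    let ?b = "\<tau> c"
    have im: "c \<in> (snd \<circ> \<pi>) ` B" using bij c by (simp add: bij_betw_def)
    have b: "?b \<in> B" "snd (\<pi> ?b) = c"
      using inv_into_into[OF im] f_inv_into_f[OF im] unfolding \<tau>_def by simp_all
    have F: "[\<pi> ?b] \<in> F" "[(True, ?b)] \<in> F" using b c by simp_all
    have bF: "\<beta> [\<pi> ?b] \<in> F" using aut_simps(1)[OF \<beta>(1) F(1)] .
    have "[(True, ?b)] = \<beta> (conjg g [\<pi> ?b])" using \<beta>(2) F(2) \<pi> b(1) by metis
    also have "\<dots> = conjg (\<beta> g) (\<beta> [\<pi> ?b])" by (rule aut_simps(6)[OF \<beta>(1) F(1) g])
    finally have e: "\<beta> [\<pi> ?b] = conjg ?k [(True, ?b)]" using conjg_cancel(1)[OF kF(2) bF] kF(2) by simp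
    show ?thesis
    proof (cases "fst (\<pi> ?b)")
      case True
      then have "\<pi> ?b = (True, c)" using b(2) by (metis prod.collapse)
      then show ?thesis using e True by (simp add: \<pi>'_def)
    next
      case False
      then have "\<pi> ?b = (False, c)" using b(2) by (metis prod.collapse)
      then have "[(True, c)] = winv [\<pi> ?b]" by (simp add: letter_inv_def)
      then have "\<beta> [(True, c)] = winv (\<beta> [\<pi> ?b])" using aut_simps(4)[OF \<beta>(1) F(1)] by metis
      also have "\<dots> = conjg ?k [letter_inv (True, ?b)]" unfolding e using conjg_letter_inv[OF kF(1), of "(True, ?b)"] b(1) by simp
      finally show ?thesis using False by (simp add: \<pi>'_def letter_inv_def)
    qed
  qed
  then show ?thesis unfolding signed_permutation_def using bij' kF(1) by blast
qed

context
  fixes \<gamma> Ks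
  assumes fg: "fg_list Ks" and \<gamma>: "\<gamma> \<in> aut B" "signed_permutation \<gamma>"
begin

lemma signed_permutation_cut:
  assumes "b \<in> B" shows "\<exists>y. snd y \<in> B \<and> cut (act \<gamma> Ks) (hdset {(True, b)}) = cut Ks (hdset {y})"
proof -
  obtain g \<phi> \<rho> where g: "g \<in> F" and bij: "bij_betw \<rho> B B" and sn: "\<forall>y. snd (\<phi> y) = \<rho> (snd y)"
    and inj: "\<forall>y z. snd y \<in> B \<longrightarrow> snd z \<in> B \<longrightarrow> \<phi> y = \<phi> z \<longrightarrow> y = z" and map: "\<forall>w\<in>F. conjg (winv g) (\<gamma> w) = map \<phi> w"
    using signed_permutation_map[OF \<gamma>] by blast
  let ?d = "conjg (winv g) \<circ> \<gamma>"
  have d: "?d \<in> aut B" using aut_comp[OF conjg_aut \<gamma>(1)] g by simp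
  have "conj_list (act \<gamma> Ks) (act ?d Ks)" using g by (auto simp: conj_list_def act_def image_comp intro!: bexI[of _ "winv g"])
  then have cd: "cut (act ?d Ks) Q = cut (act \<gamma> Ks) Q" for Q using conj_list_cut[OF fg_list_act[OF \<gamma>(1) fg]] by blast
  have "b \<in> \<rho> ` B" using bij assms by (simp add: bij_betw_def)
  then obtain c where c: "c \<in> B" "\<rho> c = b" by blast
  let ?y = "(True, c)"
  have yB: "snd ?y \<in> B" "snd (\<phi> ?y) = b" using c sn by simp_all
  have "cut (act ?d Ks) (hdset {\<phi> ?y}) = cut Ks (?d -` hdset {\<phi> ?y})" by (rule cut_act[OF fg d])
  also have "\<dots> = cut Ks (hdset {?y})"
  proof (rule cut_cong[OF fg])
    fix w assume w: "w \<in> F"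
    have "?d w = map \<phi> w" "?d w \<in> F" using map w aut_simps(1)[OF d w] by simp_all
    moreover have "\<phi> (hd w) = \<phi> ?y \<longleftrightarrow> hd w = ?y" if "w \<noteq> []"
    proof -
      have "snd (hd w) \<in> B" using w that by (cases w) (auto simp: Cons_F)
      then show ?thesis using inj[rule_format, of "hd w" ?y] yB(1) by auto
    qed
    ultimately show "w \<in> ?d -` hdset {\<phi> ?y} \<longleftrightarrow> w \<in> hdset {?y}" using w by (auto simp: hdset_def hd_map)
  qed
  finally have e: "cut (act \<gamma> Ks) (hdset {\<phi> ?y}) = cut Ks (hdset {?y})" using cd by simp
  have "\<phi> ?y = (True, b) \<or> letter_inv (\<phi> ?y) = (True, b)" using yB(2) by (cases "\<phi> ?y") (auto simp: letter_inv_def)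
  then have "cut (act \<gamma> Ks) (hdset {(True, b)}) = cut (act \<gamma> Ks) (hdset {\<phi> ?y})"
    using cut_hdset_letter_inv[OF fg_list_act[OF \<gamma>(1) fg], of "\<phi> ?y"] yB(2) assms by auto
  then show ?thesis using e yB(1) by metis
qed

text \<open>Relabelling carries the two sides to their images under \<open>\<rho>\<close>; the
  conjugator is absorbed by passing to a conjugate sequence.\<close>

lemma signed_permutation_cleaved:
  assumes "cleaved Ks" shows "cleaved (act \<gamma> Ks)"
proof -
  obtain g \<phi> \<rho> where g: "g \<in> F" and bij: "bij_betw \<rho> B B" and sn: "\<forall>y. snd (\<phi> y) = \<rho> (snd y)"
    and map: "\<forall>w\<in>F. conjg (winv g) (\<gamma> w) = map \<phi> w"
    using signed_permutation_map[OF \<gamma>] by blast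
  let ?d = "conjg (winv g) \<circ> \<gamma>"
  have d: "?d \<in> aut B" using aut_comp[OF conjg_aut \<gamma>(1)] g by simp
  have "conj_list (act \<gamma> Ks) (act ?d Ks)" using g by (auto simp: conj_list_def act_def image_comp intro!: bexI[of _ "winv g"])
  then have red: "cleaved (act ?d Ks) \<Longrightarrow> cleaved (act \<gamma> Ks)" using cleaved_conj_list[OF fg_list_act[OF \<gamma>(1) fg]] by blast
  obtain P R i0 Ms where Ms: "conj_list Ks Ms" "cleaving P R i0 Ms" using assms unfolding cleaved_def by blast
  note cd = cleavingD[OF Ms(2)]
  have fgM: "fg_list Ms" using conj_list_fg[OF fg Ms(1)] .
  have fgd: "fg_list (act ?d Ms)" using fg_list_act[OF d fgM] .
  note cg = cleaving_generators[OF fgM Ms(2)]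
  let ?L = "Ms ! i0"
  have nth: "act ?d Ms ! i = ?d ` (Ms ! i)" if "i < length Ms" for i using that by (simp add: act_def)
  have MF: "Ms ! i \<subseteq> F" if "i < length Ms" for i using fg_list_subset[OF fgM] that by simp
  have over: "?d w \<in> words_over (\<rho> ` D)" if "w \<in> words_over D" for w D
  proof -
    have w: "w \<in> F" "snd ` set w \<subseteq> D" using that by (simp_all add: words_over_def)
    have sn': "snd (\<phi> y) = \<rho> (snd y)" for y using sn by blast
    have "snd ` set (?d w) = \<rho> ` snd ` set w" using map w(1) by (simp add: image_image sn')
    then show ?thesis using w aut_simps(1)[OF d w(1)] unfolding words_over_def by blast
  qed
  have conj1: "conjg [] ` (act ?d Ms ! i) = ?d ` (Ms ! i)" if "i < length Ms" for i
  proof -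
    have "act ?d Ms ! i \<subseteq> F" using fg_list_subset[OF fgd] that by simp
    then show ?thesis using conjg_image_one[of "act ?d Ms ! i"] nth[OF that] by simp
  qed
  have injB: "inj_on \<rho> B" "\<rho> ` B = B" using bij by (simp_all add: bij_betw_def)
  have PB: "P \<subseteq> B" "R \<subseteq> B" using cd(1) by blast+
  have "cleaved (act ?d Ms)"
  proof (rule cleavedI[OF fgd, of "\<rho> ` P" "\<rho> ` R" i0 "[]"])
    show "\<rho> ` P \<union> \<rho> ` R = B" using injB(2) cd(1) by (metis image_Un)
    show "\<rho> ` P \<inter> \<rho> ` R = {}" using inj_on_image_Int[OF injB(1) PB] cd(2) by simp
    show "\<rho> ` P \<noteq> {}" "\<rho> ` R \<noteq> {}" using cd(3,4) by simp_all
    show "i0 < length (act ?d Ms)" using cd(5) by simp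
    show "[] \<in> F" by simp
    show "act ?d Ms ! i0 \<noteq> {[]}"
    proof
      assume *: "act ?d Ms ! i0 = {[]}"
      have "l = []" if "l \<in> ?L" for l
      proof -
        have "?d l \<in> {[]}" using imageI[OF that, of ?d] * nth[OF cd(5)] by (simp only:)
        then have "?d l = ?d []" using aut_simps(3)[OF d] by (simp only: singleton_iff)
        then show ?thesis using aut_simps(5)[OF d subsetD[OF MF[OF cd(5)] that] Nil_F] by blast
      qed
      moreover have "?L \<noteq> {}" using * nth[OF cd(5)] by auto
      ultimately show False using cg(2) by blast
    qed
    have F: "?L \<inter> words_over P \<union> ?L \<inter> words_over R \<subseteq> F" using MF[OF cd(5)] by blast
    show "conjg [] ` (act ?d Ms ! i0) = gen_by (?d ` (?L \<inter> words_over P) \<union> ?d ` (?L \<inter> words_over R))"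
    proof -
      have "?d ` ?L = ?d ` gen_by (?L \<inter> words_over P \<union> ?L \<inter> words_over R)" using arg_cong[OF cg(1), of "image ?d"] .
      also have "\<dots> = gen_by (?d ` (?L \<inter> words_over P \<union> ?L \<inter> words_over R))"
        using group_hom.generate_img[OF aut_hom[OF d] F] by (rule sym)
      finally show ?thesis unfolding conj1[OF cd(5)] image_Un .
    qed
    show "?d ` (?L \<inter> words_over P) \<subseteq> words_over (\<rho> ` P)" "?d ` (?L \<inter> words_over R) \<subseteq> words_over (\<rho> ` R)"
      using over by (intro image_subsetI, blast)+
    show "\<exists>g\<in>F. conjg g ` (act ?d Ms ! i) \<subseteq> words_over (\<rho> ` P) \<or> conjg g ` (act ?d Ms ! i) \<subseteq> words_over (\<rho> ` R)"
      if i: "i < length (act ?d Ms)" "i \<noteq> i0" for i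
    proof -
      have il: "i < length Ms" using i by simp
      have "?d ` (Ms ! i) \<subseteq> words_over (\<rho> ` P) \<or> ?d ` (Ms ! i) \<subseteq> words_over (\<rho> ` R)"
        using cd(8)[OF il i(2)] over by (meson image_subsetI subsetD)
      then show ?thesis using conj1[OF il] Nil_F by metis
    qed
  qed
  then have "cleaved (act ?d Ks)" using cleaved_conj_list[OF fg_list_act[OF d fg] conj_list_act[OF d fg Ms(1)]] by blast
  then show ?thesis by (rule red)
qed

end

section \<open>Edge counts and cleavings along a descent\<close>

lemma two_letter: "fg_list Ks \<Longrightarrow> (\<And>b. b \<in> B \<Longrightarrow> cut Ks (hdset {(True, b)}) \<ge> 2) \<Longrightarrow> snd y \<in> B \<Longrightarrow> cut Ks (hdset {y}) \<ge> 2"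
  using cut_hdset_letter_inv[of Ks "(True, snd y)"] by (cases y; cases "fst y") (auto simp: letter_inv_def)

context
  fixes Y
  assumes fin: "finite B" and fgY: "fg_list Y"
    and min: "\<And>\<alpha>. \<alpha> \<in> aut B \<Longrightarrow> complexity B Y \<le> complexity B (act \<alpha> Y)"
    and two: "\<And>b. b \<in> B \<Longrightarrow> cut Y (hdset {(True, b)}) \<ge> 2"
begin

text \<open>Along a descent towards \<open>Y\<close> the multiplier's edge count never increases and the others stay the same.\<close>

lemma orbit_counts:
  assumes "\<gamma> \<in> aut B" "b \<in> B" shows "cut (act \<gamma> Y) (hdset {(True, b)}) \<ge> 2"
proof -
  obtain W where W: "fg_list W" "\<And>\<gamma>. \<gamma> \<in> aut B \<Longrightarrow> complexity B (act \<gamma> W) \<le> complexity B W \<Longrightarrow> signed_permutation \<gamma>"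
    using test_list[OF fin] by blast
  have "\<gamma> \<in> aut B \<Longrightarrow> \<forall>b\<in>B. cut (act \<gamma> Y) (hdset {(True, b)}) \<ge> 2" for \<gamma>
  \<comment> \<open>A move lowers the complexity over \<open>Y\<close>, or keeps it and lowers the
    test complexity. The bound is known for the lower element and is carried back up.\<close>
  proof (induction "(complexity B (act \<gamma> Y), complexity B (act \<gamma> W))" arbitrary: \<gamma> rule: wf_induct_rule[OF wf_lex_prod[OF wf_less_than wf_less_than]])
    case (1 \<gamma>)
    have fg: "fg_list (act \<gamma> Y)" using fg_list_act[OF 1(2) fgY] .
    from whitehead_descent[OF fin fgY W min 1(2)] show ?case
    proof
      assume s: "signed_permutation \<gamma>"
      show ?thesis
      proof
        fix b assume "b \<in> B"
        then obtain y where "snd y \<in> B" "cut (act \<gamma> Y) (hdset {(True, b)}) = cut Y (hdset {y})"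
          using signed_permutation_cut[OF fgY 1(2) s] by blast
        then show "cut (act \<gamma> Y) (hdset {(True, b)}) \<ge> 2" using two_letter[OF fgY two] by simp
      qed
    next
      assume "\<exists>a A. snd a \<in> B \<and> a \<in> A \<and> letter_inv a \<notin> A \<and>
        (complexity B (act (whitehead a A \<circ> \<gamma>) Y) < complexity B (act \<gamma> Y) \<or>
         complexity B (act (whitehead a A \<circ> \<gamma>) Y) = complexity B (act \<gamma> Y) \<and>
         complexity B (act (whitehead a A \<circ> \<gamma>) W) < complexity B (act \<gamma> W))"
      then obtain a A where a: "snd a \<in> B" "a \<in> A" "letter_inv a \<notin> A"
        and lt: "complexity B (act (whitehead a A \<circ> \<gamma>) Y) < complexity B (act \<gamma> Y) \<or>
         complexity B (act (whitehead a A \<circ> \<gamma>) Y) = complexity B (act \<gamma> Y) \<and>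
         complexity B (act (whitehead a A \<circ> \<gamma>) W) < complexity B (act \<gamma> W)" by blast
      let ?t = "whitehead a A \<circ> \<gamma>"
      have t: "?t \<in> aut B" using aut_comp[OF whitehead_aut[OF a(1)] 1(2)] .
      have IH: "\<forall>b\<in>B. cut (act ?t Y) (hdset {(True, b)}) \<ge> 2" by (rule 1(1)[OF _ t]) (use lt in auto)
      have IHl: "cut (act ?t Y) (hdset {y}) \<ge> 2" if "snd y \<in> B" for y
        using two_letter[OF fg_list_act[OF t fgY] _ that] IH by blast
      have act: "act ?t Y = act (whitehead a A) (act \<gamma> Y)" by (simp add: act_comp)
      have "complexity B (act (whitehead a A) (act \<gamma> Y)) \<le> complexity B (act \<gamma> Y)" using lt unfolding act by linarith
      then have "cut (act \<gamma> Y) (hdset A) \<le> cut (act \<gamma> Y) (hdset {a})"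
        using complexity_whitehead[OF fin fg a] by linarith
      \<comment> \<open>The lower element has as many edges labelled by the multiplier as
        \<open>A\<close> cuts in the present one, and this is at most the present count.\<close>
      then have ca: "cut (act \<gamma> Y) (hdset {a}) \<ge> 2"
        using IHl[OF a(1)] cut_whitehead_multiplier[OF fg a] unfolding act by linarith
      show ?thesis
      proof
        fix b assume b: "b \<in> B"
        show "cut (act \<gamma> Y) (hdset {(True, b)}) \<ge> 2"
        proof (cases "b = snd a")
          case True
          then have "(True, b) = a \<or> (True, b) = letter_inv a" using snd_eq_iff_letter[of "(True, b)" a] by simp
          then show ?thesis using ca cut_hdset_letter_inv[OF fg a(1)] by auto
        next
          case False
          then show ?thesis using bspec[OF IH b] b cut_whitehead_other[OF fg a(1), of "(True, b)" A] unfolding act by simp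
        qed
      qed
    qed
  qed
  then show ?thesis using assms by blast
qed

text \<open>Only cleaved elements of the least complexity \<open>c0\<close> are followed. A
  descending move keeps them cleaved, so it cannot go below \<open>c0\<close>; each move then lowers
  the test complexity, and the descent ends at \<open>Y\<close> up to a signed permutation.\<close>

lemma orbit_cleaved_imp_cleaved:
  assumes \<alpha>: "\<alpha> \<in> aut B" "cleaved (act \<alpha> Y)" shows "cleaved Y"
proof -
  obtain W where W: "fg_list W" "\<And>\<gamma>. \<gamma> \<in> aut B \<Longrightarrow> complexity B (act \<gamma> W) \<le> complexity B W \<Longrightarrow> signed_permutation \<gamma>"
    using test_list[OF fin] by blast
  define T where "T = {\<gamma>\<in>aut B. cleaved (act \<gamma> Y)}"
  define c0 where "c0 = (LEAST n. \<exists>\<gamma>\<in>T. complexity B (act \<gamma> Y) = n)"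
  have ex: "\<exists>n. \<exists>\<gamma>\<in>T. complexity B (act \<gamma> Y) = n" using \<alpha> by (auto simp: T_def)
  have "\<exists>\<gamma>\<in>T. complexity B (act \<gamma> Y) = c0" unfolding c0_def by (rule LeastI_ex[OF ex])
  then obtain \<gamma>0 where \<gamma>0: "\<gamma>0 \<in> T" "complexity B (act \<gamma>0 Y) = c0" by blast
  have least: "c0 \<le> complexity B (act \<gamma> Y)" if "\<gamma> \<in> T" for \<gamma> unfolding c0_def by (rule Least_le) (use that in blast)
  have "\<gamma> \<in> T \<Longrightarrow> complexity B (act \<gamma> Y) = c0 \<Longrightarrow> cleaved Y" for \<gamma>
  proof (induction "complexity B (act \<gamma> W)" arbitrary: \<gamma> rule: less_induct)
    case less
    have \<gamma>: "\<gamma> \<in> aut B" "cleaved (act \<gamma> Y)" using less.prems by (auto simp: T_def)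
    have fg: "fg_list (act \<gamma> Y)" using fg_list_act[OF \<gamma>(1) fgY] .
    from whitehead_descent[OF fin fgY W min \<gamma>(1)] show ?case
    proof
      assume s: "signed_permutation \<gamma>"
      obtain \<beta> where \<beta>: "\<beta> \<in> aut B" "\<forall>w\<in>F. \<beta> (\<gamma> w) = w" using aut_inverse[OF \<gamma>(1)] by blast
      have "cleaved (act \<beta> (act \<gamma> Y))"
        by (rule signed_permutation_cleaved[OF fg \<beta>(1) signed_permutation_inverse[OF \<gamma>(1) s \<beta>] \<gamma>(2)])
      moreover have "act \<beta> (act \<gamma> Y) = Y" unfolding act_comp by (rule act_id[OF fgY]) (use \<beta> in simp)
      ultimately show ?thesis by simp
    next
      assume "\<exists>a A. snd a \<in> B \<and> a \<in> A \<and> letter_inv a \<notin> A \<and>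
        (complexity B (act (whitehead a A \<circ> \<gamma>) Y) < complexity B (act \<gamma> Y) \<or>
         complexity B (act (whitehead a A \<circ> \<gamma>) Y) = complexity B (act \<gamma> Y) \<and>
         complexity B (act (whitehead a A \<circ> \<gamma>) W) < complexity B (act \<gamma> W))"
      then obtain a A where a: "snd a \<in> B" "a \<in> A" "letter_inv a \<notin> A"
        and lt: "complexity B (act (whitehead a A \<circ> \<gamma>) Y) < complexity B (act \<gamma> Y) \<or>
         complexity B (act (whitehead a A \<circ> \<gamma>) Y) = complexity B (act \<gamma> Y) \<and>
         complexity B (act (whitehead a A \<circ> \<gamma>) W) < complexity B (act \<gamma> W)" by blast
      let ?t = "whitehead a A \<circ> \<gamma>"
      have t: "?t \<in> aut B" using aut_comp[OF whitehead_aut[OF a(1)] \<gamma>(1)] .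
      have act: "act ?t Y = act (whitehead a A) (act \<gamma> Y)" by (simp add: act_comp)
      have "complexity B (act (whitehead a A) (act \<gamma> Y)) \<le> complexity B (act \<gamma> Y)" using lt unfolding act by linarith
      then have le: "cut (act \<gamma> Y) (hdset A) \<le> cut (act \<gamma> Y) (hdset {a})"
        using complexity_whitehead[OF fin fg a] by linarith
      obtain P R i0 Ks where Ks: "conj_list (act \<gamma> Y) Ks" "cleaving P R i0 Ks" using \<gamma>(2) unfolding cleaved_def by blast
      have fgK: "fg_list Ks" using conj_list_fg[OF fg Ks(1)] .
      have cutK: "cut Ks Q = cut (act \<gamma> Y) Q" for Q using conj_list_cut[OF fg Ks(1)] .
      have up: "cleaved (act \<delta> (act \<gamma> Y))" if "\<delta> \<in> aut B" "cleaved (act \<delta> Ks)" for \<delta>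
        using cleaved_conj_list[OF fg_list_act[OF that(1) fg] conj_list_act[OF that(1) fg Ks(1)] that(2)] .
      \<comment> \<open>Cleaved competitors of \<open>Ks\<close> are conjugate to elements given by
        members of \<open>T\<close>, so minimality within \<open>T\<close> is what
        \<open>whitehead_step\<close> requires.\<close>
      have minK: "complexity B Ks \<le> complexity B (act \<delta> Ks)" if \<delta>: "\<delta> \<in> aut B" "cleaved (act \<delta> Ks)" for \<delta>
      proof -
        have "\<delta> \<circ> \<gamma> \<in> T" using up[OF \<delta>] aut_comp[OF \<delta>(1) \<gamma>(1)] by (simp add: T_def act_comp)
        then have "c0 \<le> complexity B (act \<delta> (act \<gamma> Y))" using least by (simp add: act_comp)
        then show ?thesis
          using conj_list_complexity[OF fin fg Ks(1)] conj_list_complexity[OF fin fg_list_act[OF \<delta>(1) fg] conj_list_act[OF \<delta>(1) fg Ks(1)]]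
            less.prems(2) by simp
      qed
      have twoK: "cut Ks (hdset {y}) \<ge> 2" if "snd y \<in> B" for y
        by (rule two_letter[OF fgK _ that]) (use orbit_counts[OF \<gamma>(1)] cutK in simp)
      have leK: "cut Ks (hdset A) \<le> cut Ks (hdset {a})" using le cutK by simp
      \<comment> \<open>The two sides are interchangeable, so the multiplier may be assumed over
        \<open>P\<close>.\<close>
      have cK: "\<exists>P R. cleaving P R i0 Ks \<and> snd a \<in> P"
      proof -
        note cd = cleavingD[OF Ks(2)]
        have "Ks ! i0 \<subseteq> F" using fg_list_subset[OF fgK] cd(5) by simp
        then have "cleaving R P i0 Ks" using cleaving_swap[OF Ks(2)] by blast
        then show ?thesis using Ks(2) a(1) cd(1) by blast
      qed
      then obtain P R where PR: "cleaving P R i0 Ks" "snd a \<in> P" by blast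
      have "cleaved (act (whitehead a A) Ks)"
        by (rule whitehead_step[OF fin fgK PR(1) minK twoK PR(2) a(2,3) leK])
      then have clt: "cleaved (act ?t Y)" using up[OF whitehead_aut[OF a(1)]] unfolding act by blast
      then have "?t \<in> T" using t by (simp add: T_def)
      then have "c0 \<le> complexity B (act ?t Y)" by (rule least)
      then have "complexity B (act ?t Y) = c0" "complexity B (act ?t W) < complexity B (act \<gamma> W)"
        using lt less.prems(2) by linarith+
      then show ?thesis using less.hyps \<open>?t \<in> T\<close> by blast
    qed
  qed
  then show ?thesis using \<gamma>0 by blast
qed

end

end

theorem lemma9p17:
  fixes B :: "'b set" and Hs :: "'b word set list"
  assumes "finite B" and "B \<noteq> {}"
    and "\<forall>H\<in>set Hs. fg_subgroup B H"
    and "\<exists>Hs'. gersten_rep B Hs Hs' \<and> minlex B Hs' > 1"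
  shows "((\<exists>\<alpha>\<in>aut B. visibly_cleavable B (Sigma B (act \<alpha> Hs)))
            \<longleftrightarrow> (\<exists>Hs'. gersten_rep B Hs Hs' \<and> visibly_cleavable B (Sigma B Hs'))) \<and>
         ((\<exists>Hs'. gersten_rep B Hs Hs' \<and> visibly_cleavable B (Sigma B Hs'))
            \<longleftrightarrow> (\<forall>Hs'. gersten_rep B Hs Hs' \<longrightarrow> visibly_cleavable B (Sigma B Hs')))"
proof -
  interpret free_grp B .
  have fg: "fg_list Hs" using assms(3) by (simp add: fg_list_def)
  obtain Y0 where Y0: "gersten_rep B Hs Y0" "minlex B Y0 > 1" using assms(4) by blast
  have fgr: "fg_list Y" if "gersten_rep B Hs Y" for Y
    using that fg fg_list_act unfolding gersten_rep_def by blast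
  \<comment> \<open>Elements of the orbit are rewritten with \<open>Y\<close> as origin, because the
    descent starts from automorphisms applied to the minimal sequence.\<close>
  have orbit: "\<exists>\<delta>\<in>aut B. act \<delta> Y = act \<alpha> Hs" if Y: "gersten_rep B Hs Y" "\<alpha> \<in> aut B" for Y \<alpha>
  proof -
    obtain \<beta> where \<beta>: "\<beta> \<in> aut B" "Y = act \<beta> Hs" using Y(1) by (auto simp: gersten_rep_def)
    obtain \<beta>' where \<beta>': "\<beta>' \<in> aut B" "\<forall>w\<in>F. \<beta>' (\<beta> w) = w" using aut_inverse[OF \<beta>(1)] by blast
    have "act (\<alpha> \<circ> \<beta>') Y = act \<alpha> (act \<beta>' (act \<beta> Hs))" by (simp add: act_comp \<beta>(2) comp_assoc)
    also have "act \<beta>' (act \<beta> Hs) = Hs" unfolding act_comp by (rule act_id[OF fg]) (use \<beta>' in simp)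
    finally show ?thesis using aut_comp[OF Y(2) \<beta>'(1)] by blast
  qed
  have orbit': "\<exists>\<delta>\<in>aut B. act \<alpha> Y = act \<delta> Hs" if "gersten_rep B Hs Y" "\<alpha> \<in> aut B" for Y \<alpha>
    using that aut_comp unfolding gersten_rep_def by (metis act_comp)
  have minY: "complexity B Y \<le> complexity B (act \<alpha> Y)" if "gersten_rep B Hs Y" "\<alpha> \<in> aut B" for Y \<alpha>
    using orbit'[OF that] that(1) by (metis gersten_rep_def)
  have Y0two: "cut Y0 (hdset {(True, b)}) \<ge> 2" if "b \<in> B" for b
  proof -
    have "1 < n_count B Y0 b" using Y0(2) assms(1,2) that unfolding minlex_def by (subst (asm) Min_gr_iff) auto
    then show ?thesis using n_count_eq_cut[OF fgr[OF Y0(1)] that] by simp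
  qed
  \<comment> \<open>The bound is given for one representative only; holding on its whole orbit, it
    passes to all others.\<close>
  have twoY: "cut Y (hdset {(True, b)}) \<ge> 2" if Y: "gersten_rep B Hs Y" and b: "b \<in> B" for Y b
  proof -
    obtain \<beta> where "\<beta> \<in> aut B" "Y = act \<beta> Hs" using Y by (auto simp: gersten_rep_def)
    then obtain \<delta> where \<delta>: "\<delta> \<in> aut B" "act \<delta> Y0 = Y" using orbit[OF Y0(1)] by blast
    show ?thesis
      using orbit_counts[OF assms(1) fgr[OF Y0(1)] minY[OF Y0(1)] Y0two \<delta>(1) b] \<delta>(2) by simp
  qed
  have key: "visibly_cleavable B (Sigma B Y)"
    if Y: "gersten_rep B Hs Y" and \<alpha>: "\<alpha> \<in> aut B" "visibly_cleavable B (Sigma B (act \<alpha> Hs))" for Y \<alpha>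
  proof -
    obtain \<delta> where \<delta>: "\<delta> \<in> aut B" "act \<delta> Y = act \<alpha> Hs" using orbit[OF Y \<alpha>(1)] by blast
    have "cleaved (act \<delta> Y)" using \<alpha>(2) visibly_cleavable_iff[OF fg_list_act[OF \<alpha>(1) fg]] \<delta>(2) by simp
    then have "cleaved Y"
      using orbit_cleaved_imp_cleaved[OF assms(1) fgr[OF Y] minY[OF Y] twoY[OF Y] \<delta>(1)] by blast
    then show ?thesis using visibly_cleavable_iff[OF fgr[OF Y]] by simp
  qed
  have rep: "\<exists>\<alpha>\<in>aut B. Y = act \<alpha> Hs" if "gersten_rep B Hs Y" for Y using that by (simp add: gersten_rep_def)
  \<comment> \<open>\<open>Y0\<close> ensures that the condition on every representative is not
    vacuous.\<close>
  show ?thesis using key rep Y0(1) by metis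
qed

end
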